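(* Let $\gamma=\{t+iy(t):t\in[a,b]\}$, $-\infty<a<b<\infty$, be the graph of a Lipschitz function $y:[a,b]\to\mathbb{R}$, and let $\varphi\not\equiv-\infty$ be a subharmonic function on $\mathbb{C}$. Then for a point $\gamma(t)\in\gamma$, $\nu(\varphi)(\gamma(t))<1$ if and only if $e^{-\varphi}$ is locally integrable (with respect to arc length $ds$ on $\gamma$) in a neighborhood of $\gamma(t)$ on $\gamma$.
   Context: The Lelong number of a subharmonic function $\varphi\not\equiv-\infty$ at $z\in\mathbb{C}$ is $\nu(\varphi)(z)=\lim_{r\to0^+}\frac{\max_{|\zeta-z|=r}\varphi(\zeta)}{\log r}$; equivalently it is the mass at the point $z$ of the measure $\frac{1}{2\pi}\Delta\varphi$. $\gamma(t)=t+iy(t)$. *)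

theory Defs
  imports "HOL-Analysis.Analysis"
begin

definition usc_ereal :: "(complex \<Rightarrow> ereal) \<Rightarrow> bool" where
  "usc_ereal \<phi> \<longleftrightarrow> (\<forall>z c. \<phi> z < c \<longrightarrow> eventually (\<lambda>w. \<phi> w < c) (at z))"

text \<open>Mean value of \<phi> over the circle of radius r centred at z,
  (1/2pi) times the integral over [0,2pi] of \<phi>(z + r e^{i theta}),
  computed as (positive part) minus (negative part).\<close>
definition circle_mean :: "(complex \<Rightarrow> ereal) \<Rightarrow> complex \<Rightarrow> real \<Rightarrow> ereal" where
  "circle_mean \<phi> z r =
     (enn2ereal (\<integral>\<^sup>+\<theta>\<in>{0..2*pi}. e2ennreal (\<phi> (z + of_real r * cis \<theta>)) \<partial>lborel)
      - enn2ereal (\<integral>\<^sup>+\<theta>\<in>{0..2*pi}. e2ennreal (- \<phi> (z + of_real r * cis \<theta>)) \<partial>lborel))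
     / ereal (2 * pi)"

definition subharmonic :: "(complex \<Rightarrow> ereal) \<Rightarrow> bool" where
  "subharmonic \<phi> \<longleftrightarrow>
     (\<forall>z. \<phi> z < \<infinity>) \<and> usc_ereal \<phi> \<and>
     (\<forall>z. \<exists>R>0. \<forall>r. 0 < r \<and> r < R \<longrightarrow> \<phi> z \<le> circle_mean \<phi> z r)"

definition lelong :: "(complex \<Rightarrow> ereal) \<Rightarrow> complex \<Rightarrow> ereal" where
  "lelong \<phi> z = Lim (at_right 0) (\<lambda>r. (SUP \<zeta>\<in>sphere z r. \<phi> \<zeta>) / ereal (ln r))"

definition exp_neg :: "ereal \<Rightarrow> ennreal" where
  "exp_neg x = (case x of ereal v \<Rightarrow> ennreal (exp (- v)) | PInfty \<Rightarrow> 0 | MInfty \<Rightarrow> \<infinity>)"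

definition arclength_integral ::
    "(real \<Rightarrow> complex) \<Rightarrow> real set \<Rightarrow> (complex \<Rightarrow> ennreal) \<Rightarrow> ennreal" where
  "arclength_integral \<gamma> S f =
     (\<integral>\<^sup>+s\<in>S. f (\<gamma> s) * ennreal (norm (vector_derivative \<gamma> (at s))) \<partial>lborel)"

end

theory Submission
  imports Defs "HOL-Complex_Analysis.Complex_Analysis"
begin

text \<open>
  The Riesz measure of \<open>\<phi>\<close> is replaced by an explicit approximation built from means over discs.
  Let \<open>a r\<close> be the normalised indicator of the disc of radius \<open>r\<close>, let \<open>L = ln |\<cdot>|\<close> and
  \<open>g r = L * a r - L\<close>, which is nonnegative and supported in that disc. Commutativity of convolution gives
  \<open>(u * g h) * (a r - \<delta>) = (u * (a h - \<delta>)) * g r\<close>. Up to normalisation, \<open>u * g h\<close> is a smoothing of \<open>u\<close>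
  and \<open>u * (a h - \<delta>)\<close>, nonnegative for subharmonic \<open>u\<close>, is the density of its Riesz measure.
  Hence means over discs are convex in \<open>ln r\<close>, and their asymptotic slope at a point is the Lelong number there.

  If the slope is less than 1, some disc carries Riesz mass \<open>m < 1\<close>, and Jensen's inequality bounds \<open>exp (- u)\<close>
  on the graph by an average over \<open>\<zeta>\<close> of \<open>|s - Re \<zeta>| powr (- m)\<close>, which is uniformly integrable in \<open>s\<close>.
  If the slope is at least 1, then \<open>\<phi> \<le> C + ln r + ln (ln (1/r))\<close> at distance \<open>r\<close> from the point,
  and \<open>1 / (r ln (1/r))\<close> is not integrable at 0.

  The speed of the graph is only defined where the Lipschitz function is differentiable, which is
  almost everywhere; elsewhere the vector derivative is an unspecified value.
\<close>

text \<open>Subharmonicity is given as a sub-mean inequality on circles whose admissible radii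
  depend on the centre, so the inequality for every radius has to be won first, from the maximum
  principle and from approximation of boundary data by harmonic functions. Means over discs are
  preferred to means over circles because they are convolutions with a bounded density: they are
  continuous for every locally integrable function, and they commute by Fubini. The price is a
  factor \<open>1 - d^2\<close> in the mass estimate and a ratio of areas in the pointwise
  estimates. Two regularisations are stacked: \<phi> is replaced by its disc means
  \<open>U s\<close>, and these by \<open>smoothing h\<close>. All constants in the exponential
  estimate are independent of \<open>h\<close> and \<open>s\<close>, so that Fatou's lemma removes
  both. The Lipschitz constant enters through the speed of the graph and, in the converse, through
  the comparison of the distance between points of the graph with the distance of their
  parameters.\<close>

section \<open>Lipschitz functions are differentiable almost everywhere\<close>

text \<open>The intervals contain \<open>x\<close> anywhere, possibly as an endpoint, instead of
  starting at \<open>x\<close>. In this form the intervals of small (or large) mean slope are a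
  Vitali covering of the set, and one-sided difference quotients are included.\<close>

definition slope_below :: "(real \<Rightarrow> real) \<Rightarrow> real \<Rightarrow> real set" where
  "slope_below F p = {x. \<forall>d>0. \<exists>u v. u \<le> x \<and> x \<le> v \<and> u < v \<and> v - u < d \<and> F v - F u < p * (v - u)}"

definition slope_above :: "(real \<Rightarrow> real) \<Rightarrow> real \<Rightarrow> real set" where
  "slope_above F q = {x. \<forall>d>0. \<exists>u v. u \<le> x \<and> x \<le> v \<and> u < v \<and> v - u < d \<and> F v - F u > q * (v - u)}"

lemma cball_real_midpoint: "cball ((u + v) / 2) ((v - u) / 2) = {u..v::real}"
  by (auto simp: cball_eq_atLeastAtMost field_simps)

text \<open>A closed interval is the ball about its midpoint, so the covering theorem for balls
  applies, indexed by pairs of endpoints.\<close>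

lemma Vitali_covering_intervals:
  fixes E :: "real set"
  assumes cov: "\<And>x d. x \<in> E \<Longrightarrow> 0 < d \<Longrightarrow> \<exists>u v. P u v \<and> u < v \<and> u \<le> x \<and> x \<le> v \<and> v - u < d"
  obtains C where "countable C" "\<And>i. i \<in> C \<Longrightarrow> P (fst i) (snd i) \<and> fst i < snd i"
    "disjoint_family_on (\<lambda>i. {fst i..snd i}) C"
    "negligible (E - (\<Union>i\<in>C. {fst i..snd i}))"
proof -
  let ?K = "{i. P (fst i) (snd i) \<and> fst i < snd i}"
  let ?a = "\<lambda>i::real\<times>real. (fst i + snd i) / 2" and ?r = "\<lambda>i::real\<times>real. (snd i - fst i) / 2"
  have 1: "\<exists>i. i \<in> ?K \<and> x \<in> cball (?a i) (?r i) \<and> ?r i < d" if xd: "x \<in> E" "0 < d" for x d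
  proof -
    obtain u v where "P u v" "u < v" "u \<le> x" "x \<le> v" "v - u < d" using cov[OF xd] by blast
    then show ?thesis
      by (intro exI[of _ "(u,v)"]) (auto simp only: cball_real_midpoint fst_conv snd_conv, auto)
  qed
  obtain C where "countable C" "C \<subseteq> ?K"
     "pairwise (\<lambda>i j. disjnt (cball (?a i) (?r i)) (cball (?a j) (?r j))) C"
     "negligible (E - (\<Union>i \<in> C. cball (?a i) (?r i)))"
    by (rule Vitali_covering_theorem_cballs[of ?K ?r E ?a, OF _ 1]) auto
  then show ?thesis
    by (intro that[of C]) (auto simp: cball_real_midpoint disjoint_family_on_def pairwise_def disjnt_def)
qed

text \<open>Let \<open>m\<close> be the outer measure of the set \<open>E\<close>, whose
  measurability is not established. Disjoint intervals of slope below \<open>p\<close> cover almost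
  all of \<open>E\<close> inside an open \<open>O1\<close>, and intervals of slope above
  \<open>q\<close> inside those cover almost all of \<open>E\<close> again. Comparing the increments
  of \<open>F\<close> over both families gives \<open>q * m \<le> p * |O1|\<close>, hence
  \<open>q * m \<le> p * m\<close>. The cut-off by \<open>N\<close> makes \<open>m\<close> finite,
  so that \<open>m = 0\<close>.\<close>

lemma negligible_slope_gap:
  fixes F :: "real \<Rightarrow> real"
  assumes mono: "mono F" and cont: "continuous_on UNIV F"
    and p: "0 < p" and pq: "p < q"
  shows "negligible (slope_below F p \<inter> slope_above F q \<inter> {-N<..<N})"
proof -
  define E where "E = slope_below F p \<inter> slope_above F q \<inter> {-N<..<N}"
  define M where "M = interval_measure F"
  have sM [simp]: "sets M = sets borel" by (simp add: M_def)
  have MI: "emeasure M {u..v} = ennreal (F v - F u)" if "u < v" for u v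
    unfolding M_def using that mono cont by (intro emeasure_interval_measure_Icc) (auto simp: mono_def)
  define m where "m = (INF U\<in>{U. open U \<and> E \<subseteq> U}. emeasure lborel U)"
  have m_fin: "m \<le> ennreal (2 * \<bar>N\<bar>)"
  proof -
    have "m \<le> emeasure lborel {-\<bar>N\<bar><..<\<bar>N\<bar>}"
      unfolding m_def by (rule INF_lower) (auto simp: E_def)
    then show ?thesis by simp
  qed
  \<comment> \<open>Covers that miss a null set still bound the outer measure; Vitali families
    provide nothing better.\<close>
  have m_le: "m \<le> emeasure lborel S" if S: "S \<in> sets borel" "negligible (E - S)" for S
  proof (rule ennreal_le_epsilon)
    fix e :: real assume "0 < e"
    have "E - S \<in> sets lebesgue" using S(2) negligible_imp_sets by blast
    define W where "W = S \<union> (E - S)"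
    have W: "W \<in> sets lebesgue" unfolding W_def using S(1) \<open>E - S \<in> sets lebesgue\<close> by (intro sets.Un) auto
    then obtain T where T: "open T" "W \<subseteq> T" "emeasure lebesgue (T - W) < ennreal e"
      using sets_lebesgue_outer_open \<open>0 < e\<close> by metis
    have T': "T \<in> sets lebesgue" using T(1) by auto
    have "m \<le> emeasure lborel T" unfolding m_def using T by (intro INF_lower) (auto simp: W_def)
    also have "\<dots> = emeasure lebesgue T" using T(1) by simp
    also have "\<dots> = emeasure lebesgue (W \<union> (T - W))"
      using T by (intro arg_cong[where f="emeasure lebesgue"]) auto
    also have "\<dots> \<le> emeasure lebesgue W + emeasure lebesgue (T - W)"
      using W T' by (intro emeasure_subadditive sets.Diff)
    also have "\<dots> \<le> emeasure lebesgue W + ennreal e"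
      using T by (intro add_left_mono) auto
    also have "emeasure lebesgue W = emeasure lebesgue S"
      unfolding W_def using S negligible_iff_null_sets by (intro emeasure_Un_null_set) auto
    also have "\<dots> = emeasure lborel S" using S(1) by simp
    finally show "m \<le> emeasure lborel S + ennreal e" .
  qed
  have main: "ennreal q * m \<le> ennreal p * emeasure lborel O1" if O1: "open O1" "E \<subseteq> O1" for O1
  proof -
    have c1: "\<exists>u v. ({u..v} \<subseteq> O1 \<and> F v - F u < p * (v - u)) \<and> u < v \<and> u \<le> x \<and> x \<le> v \<and> v - u < d"
      if x: "x \<in> E" "0 < d" for x d
    proof -
      obtain e where e: "e > 0" "ball x e \<subseteq> O1" using O1 x(1) by (meson openE subsetD)
      obtain u v where "u \<le> x" "x \<le> v" "u < v" "v - u < min d e" "F v - F u < p * (v - u)"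
        using x e unfolding E_def slope_below_def by (auto dest!: spec[of _ "min d e"])
      moreover from this have "{u..v} \<subseteq> ball x e" by (auto simp: dist_real_def)
      ultimately show ?thesis using e by (intro exI[of _ u] exI[of _ v]) auto
    qed
    obtain C where C: "countable C" "\<And>i. i \<in> C \<Longrightarrow> ({fst i..snd i} \<subseteq> O1 \<and> F (snd i) - F (fst i) < p * (snd i - fst i)) \<and> fst i < snd i"
      "disjoint_family_on (\<lambda>i. {fst i..snd i}) C"
      "negligible (E - (\<Union>i\<in>C. {fst i..snd i}))"
      using Vitali_covering_intervals[of E "\<lambda>u v. {u..v} \<subseteq> O1 \<and> F v - F u < p * (v - u)", OF c1]
      by blast
    \<comment> \<open>Passing to interiors makes the union open and loses only countably many
      endpoints; the second family can then be chosen inside it, whence the inclusion of the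
      unions.\<close>
    define O2 where "O2 = (\<Union>i\<in>C. {fst i<..<snd i})"
    have "open O2" unfolding O2_def by auto
    have negO2: "negligible (E - O2)"
    proof (rule negligible_subset)
      show "negligible ((E - (\<Union>i\<in>C. {fst i..snd i})) \<union> (\<Union>i\<in>C. {fst i, snd i}))"
        using C by (intro negligible_Un negligible_countable_Union) (auto intro!: negligible_finite)
      show "E - O2 \<subseteq> (E - (\<Union>i\<in>C. {fst i..snd i})) \<union> (\<Union>i\<in>C. {fst i, snd i})"
        unfolding O2_def by force
    qed
    have c2: "\<exists>u v. ({u..v} \<subseteq> O2 \<and> F v - F u > q * (v - u)) \<and> u < v \<and> u \<le> x \<and> x \<le> v \<and> v - u < d"
      if x: "x \<in> E \<inter> O2" "0 < d" for x d
    proof -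
      obtain e where e: "e > 0" "ball x e \<subseteq> O2" using \<open>open O2\<close> x(1) by (meson openE IntD2)
      obtain u v where "u \<le> x" "x \<le> v" "u < v" "v - u < min d e" "F v - F u > q * (v - u)"
        using x e unfolding E_def slope_above_def by (auto dest!: spec[of _ "min d e"])
      moreover from this have "{u..v} \<subseteq> ball x e" by (auto simp: dist_real_def)
      ultimately show ?thesis using e by (intro exI[of _ u] exI[of _ v]) auto
    qed
    obtain D where D: "countable D" "\<And>i. i \<in> D \<Longrightarrow> ({fst i..snd i} \<subseteq> O2 \<and> F (snd i) - F (fst i) > q * (snd i - fst i)) \<and> fst i < snd i"
      "disjoint_family_on (\<lambda>i. {fst i..snd i}) D"
      "negligible (E \<inter> O2 - (\<Union>i\<in>D. {fst i..snd i}))"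
      using Vitali_covering_intervals[of "E \<inter> O2" "\<lambda>u v. {u..v} \<subseteq> O2 \<and> F v - F u > q * (v - u)", OF c2]
      by blast
    let ?UD = "\<Union>i\<in>D. {fst i..snd i}" and ?UC = "\<Union>i\<in>C. {fst i..snd i}"
    have UDb: "?UD \<in> sets borel" "?UC \<in> sets borel" using C(1) D(1) by auto
    have "negligible (E - ?UD)"
      by (rule negligible_subset[OF negligible_Un[OF negO2 D(4)]]) auto
    then have "ennreal q * m \<le> ennreal q * emeasure lborel ?UD"
      using m_le[OF UDb(1)] by (intro mult_left_mono) auto
    also have "emeasure lborel ?UD = (\<integral>\<^sup>+i. emeasure lborel {fst i..snd i} \<partial>count_space D)"
      using D by (intro emeasure_UN_countable) auto
    also have "ennreal q * \<dots> = (\<integral>\<^sup>+i. ennreal q * emeasure lborel {fst i..snd i} \<partial>count_space D)"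
      by (rule nn_integral_cmult[symmetric]) auto
    also have "\<dots> \<le> (\<integral>\<^sup>+i. emeasure M {fst i..snd i} \<partial>count_space D)"
    proof (rule nn_integral_mono)
      fix i assume "i \<in> space (count_space D)"
      then have i: "fst i < snd i" "F (snd i) - F (fst i) > q * (snd i - fst i)" using D(2) by auto
      then show "ennreal q * emeasure lborel {fst i..snd i} \<le> emeasure M {fst i..snd i}"
        using p pq by (simp add: MI ennreal_mult'[symmetric] ennreal_leI)
    qed
    also have "\<dots> = emeasure M ?UD"
      using D by (intro emeasure_UN_countable[symmetric]) auto
    also have "\<dots> \<le> emeasure M ?UC"
    proof (rule emeasure_mono)
      have "?UD \<subseteq> O2" using D(2) by blast
      also have "O2 \<subseteq> ?UC" unfolding O2_def by force
      finally show "?UD \<subseteq> ?UC" .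
    qed (use UDb in auto)
    also have "\<dots> = (\<integral>\<^sup>+i. emeasure M {fst i..snd i} \<partial>count_space C)"
      using C by (intro emeasure_UN_countable) auto
    also have "\<dots> \<le> (\<integral>\<^sup>+i. ennreal p * emeasure lborel {fst i..snd i} \<partial>count_space C)"
    proof (rule nn_integral_mono)
      fix i assume "i \<in> space (count_space C)"
      then have i: "fst i < snd i" "F (snd i) - F (fst i) < p * (snd i - fst i)" using C(2) by auto
      then show "emeasure M {fst i..snd i} \<le> ennreal p * emeasure lborel {fst i..snd i}"
        using p pq by (simp add: MI ennreal_mult'[symmetric] ennreal_leI)
    qed
    also have "\<dots> = ennreal p * (\<integral>\<^sup>+i. emeasure lborel {fst i..snd i} \<partial>count_space C)"
      by (rule nn_integral_cmult) auto
    also have "(\<integral>\<^sup>+i. emeasure lborel {fst i..snd i} \<partial>count_space C) = emeasure lborel ?UC"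
      using C by (intro emeasure_UN_countable[symmetric]) auto
    also have "ennreal p * emeasure lborel ?UC \<le> ennreal p * emeasure lborel O1"
      using C(2) O1 by (intro mult_left_mono emeasure_mono) auto
    finally show ?thesis .
  qed
  obtain k where k: "k \<ge> 0" "m = ennreal k" using m_fin by (cases m) (auto simp: top_unique)
  have "ennreal q * m \<le> ennreal p * m"
  proof (rule ennreal_le_epsilon)
    fix e :: real assume "0 < e"
    then have "m < m + ennreal (e / p)" using k p by (simp add: ennreal_plus[symmetric] ennreal_less_iff del: ennreal_plus)
    then obtain O1 where "open O1" "E \<subseteq> O1" "emeasure lborel O1 < m + ennreal (e / p)"
      unfolding m_def by (auto simp: INF_less_iff)
    with main have "ennreal q * m \<le> ennreal p * (m + ennreal (e / p))"
      by (meson mult_left_mono order.trans order.strict_implies_order zero_le)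
    also have "\<dots> = ennreal p * m + ennreal e"
      using p \<open>0 < e\<close> by (simp add: distrib_left ennreal_mult'[symmetric])
    finally show "ennreal q * m \<le> ennreal p * m + ennreal e" .
  qed
  then have "q * k \<le> p * k" using k p pq by (simp add: ennreal_mult'[symmetric] ennreal_le_iff)
  then have "m = 0" using k pq by (simp add: mult_le_cancel_right)
  have "negligible E"
    unfolding negligible_outer
  proof (intro allI impI)
    fix e :: real assume "0 < e"
    then have "m < ennreal e" using \<open>m = 0\<close> by simp
    then obtain O1 where O1: "open O1" "E \<subseteq> O1" "emeasure lborel O1 < ennreal e"
      unfolding m_def by (auto simp: INF_less_iff)
    then have em: "emeasure lebesgue O1 < ennreal e" by simp
    then have "O1 \<in> lmeasurable" using O1(1) by (auto simp: fmeasurable_def less_top[symmetric] top.extremum_strict dest: order.strict_trans2)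
    then show "\<exists>T. E \<subseteq> T \<and> T \<in> lmeasurable \<and> measure lebesgue T < e"
      using O1 em \<open>0 < e\<close> by (intro exI[of _ O1]) (auto simp: emeasure_eq_measure2 ennreal_less_iff)
  qed
  then show ?thesis unfolding E_def .
qed

text \<open>The derivative is the supremum \<open>D\<close> of the \<open>q\<close> with
  \<open>x\<close> in \<open>slope_above F q\<close>; the Lipschitz bound makes it finite. The upper
  estimate is the definition of \<open>D\<close>. For the lower one, \<open>x\<close> lies in
  \<open>slope_above F q'\<close> for a rational \<open>q'\<close> just below \<open>D\<close>,
  which excludes it from \<open>slope_below F p'\<close> for a smaller positive rational
  \<open>p'\<close>. When \<open>D - e \<le> 0\<close>, monotonicity of \<open>F\<close>
  suffices.\<close>

lemma differentiable_if_no_slope_gap: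
  fixes F :: "real \<Rightarrow> real"
  assumes mono: "mono F" and lip: "\<And>u v. u \<le> v \<Longrightarrow> F v - F u \<le> K * (v - u)"
    and nogap: "\<And>p q. p \<in> \<rat> \<Longrightarrow> q \<in> \<rat> \<Longrightarrow> 0 < p \<Longrightarrow> p < q \<Longrightarrow> x \<notin> slope_below F p \<inter> slope_above F q"
  shows "F differentiable (at x)"
proof -
  define A where "A = {q. x \<in> slope_above F q}"
  have "-1 \<in> A"
    unfolding A_def slope_above_def
  proof (safe)
    fix d :: real assume "0 < d"
    moreover have "F x \<le> F (x + d/2)" using mono \<open>0 < d\<close> by (simp add: mono_def)
    ultimately show "\<exists>u v. u \<le> x \<and> x \<le> v \<and> u < v \<and> v - u < d \<and> -1 * (v - u) < F v - F u"
      by (intro exI[of _ x] exI[of _ "x + d/2"]) auto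
  qed
  have ub: "q \<le> K" if "q \<in> A" for q
  proof -
    obtain u v where "u < v" "q * (v - u) < F v - F u"
      using \<open>q \<in> A\<close> unfolding A_def slope_above_def by (auto dest: spec[of _ 1])
    then have "q * (v - u) < K * (v - u)" using lip[of u v] by linarith
    then show ?thesis using \<open>u < v\<close> by (simp add: mult_less_cancel_right)
  qed
  have bdd: "bdd_above A" by (rule bdd_aboveI[OF ub])
  define D where "D = Sup A"
  have up: "\<exists>d>0. \<forall>u v. u \<le> x \<and> x \<le> v \<and> u < v \<and> v - u < d \<longrightarrow> F v - F u \<le> (D + e) * (v - u)" if "e > 0" for e
  proof -
    have "D + e \<notin> A" using cSup_upper[OF _ bdd, of "D + e"] \<open>e > 0\<close> unfolding D_def by auto
    then obtain d where "d > 0" "\<And>u v. u \<le> x \<Longrightarrow> x \<le> v \<Longrightarrow> u < v \<Longrightarrow> v - u < d \<Longrightarrow> F v - F u \<le> (D + e) * (v - u)"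
      unfolding A_def slope_above_def by (auto simp: not_less) fastforce
    then show ?thesis by (intro exI[of _ d]) auto
  qed
  have lo: "\<exists>d>0. \<forall>u v. u \<le> x \<and> x \<le> v \<and> u < v \<and> v - u < d \<longrightarrow> F v - F u \<ge> (D - e) * (v - u)" if "e > 0" for e
  proof (cases "D - e \<le> 0")
    case True
    have "F v - F u \<ge> (D - e) * (v - u)" if "u < v" for u v
      using mono that mult_nonpos_nonneg[OF True, of "v - u"] by (smt (verit) monoD)
    then show ?thesis by (intro exI[of _ 1]) auto
  next
    case False
    obtain q where q: "q \<in> A" "D - e/2 < q"
      using less_cSup_iff[of A "D - e/2"] \<open>-1 \<in> A\<close> bdd \<open>e > 0\<close> unfolding D_def by force
    obtain p' where p': "p' \<in> \<rat>" "D - e < p'" "p' < D - e/2" using Rats_dense_in_real[of "D - e" "D - e/2"] \<open>e > 0\<close> by auto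
    obtain q' where q': "q' \<in> \<rat>" "D - e/2 < q'" "q' < q" using Rats_dense_in_real[of "D - e/2" q] q by auto
    have "x \<in> slope_above F q'"
      using q(1) unfolding A_def slope_above_def
    proof safe
      fix d :: real assume "0 < d" and "\<forall>d>0. \<exists>u v. u \<le> x \<and> x \<le> v \<and> u < v \<and> v - u < d \<and> q * (v - u) < F v - F u"
      then obtain u v where "u \<le> x" "x \<le> v" "u < v" "v - u < d" "q * (v - u) < F v - F u" by blast
      moreover have "q' * (v - u) \<le> q * (v - u)" using q' \<open>u < v\<close> by (intro mult_right_mono) auto
      ultimately show "\<exists>u v. u \<le> x \<and> x \<le> v \<and> u < v \<and> v - u < d \<and> q' * (v - u) < F v - F u"
        by (meson order.strict_trans1)
    qed
    then have "x \<notin> slope_below F p'" using nogap[of p' q'] p' q' False by auto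
    then obtain d where d: "d > 0" "\<And>u v. u \<le> x \<Longrightarrow> x \<le> v \<Longrightarrow> u < v \<Longrightarrow> v - u < d \<Longrightarrow> F v - F u \<ge> p' * (v - u)"
      unfolding slope_below_def mem_Collect_eq by (metis not_less)
    show ?thesis
    proof (intro exI[of _ d] conjI allI impI)
      fix u v assume "u \<le> x \<and> x \<le> v \<and> u < v \<and> v - u < d"
      then have "p' * (v - u) \<le> F v - F u" "(D - e) * (v - u) \<le> p' * (v - u)"
        using d(2)[of u v] p' by (auto intro!: mult_right_mono)
      then show "F v - F u \<ge> (D - e) * (v - u)" by linarith
    qed (rule d(1))
  qed
  have "(F has_field_derivative D) (at x)"
    unfolding has_field_derivative_iff
  proof (rule LIM_I)
    fix r :: real assume "0 < r"
    obtain d1 where d1: "d1 > 0" "\<And>u v. u \<le> x \<Longrightarrow> x \<le> v \<Longrightarrow> u < v \<Longrightarrow> v - u < d1 \<Longrightarrow> F v - F u \<le> (D + r/2) * (v - u)"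
      using up[of "r/2"] \<open>0 < r\<close> by auto
    obtain d2 where d2: "d2 > 0" "\<And>u v. u \<le> x \<Longrightarrow> x \<le> v \<Longrightarrow> u < v \<Longrightarrow> v - u < d2 \<Longrightarrow> F v - F u \<ge> (D - r/2) * (v - u)"
      using lo[of "r/2"] \<open>0 < r\<close> by auto
    have "norm ((F y - F x) / (y - x) - D) < r" if y: "y \<noteq> x" "norm (y - x) < min d1 d2" for y
    proof (cases "x < y")
      case True
      then have "F y - F x \<le> (D + r/2) * (y - x)" "F y - F x \<ge> (D - r/2) * (y - x)"
        using d1(2)[of x y] d2(2)[of x y] y by auto
      then have "(F y - F x) / (y - x) \<le> D + r/2" "(F y - F x) / (y - x) \<ge> D - r/2"
        using True by (auto simp: field_simps)
      then show ?thesis using \<open>0 < r\<close> by (auto simp: abs_if)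
    next
      case False
      then have "y < x" using y by auto
      then have "F x - F y \<le> (D + r/2) * (x - y)" "F x - F y \<ge> (D - r/2) * (x - y)"
        using d1(2)[of y x] d2(2)[of y x] y by auto
      then have "(F x - F y) / (x - y) \<le> D + r/2" "(F x - F y) / (x - y) \<ge> D - r/2"
        using \<open>y < x\<close> by (auto simp: field_simps)
      moreover have "(F y - F x) / (y - x) = (F x - F y) / (x - y)"
        by (metis minus_diff_eq minus_divide_divide)
      ultimately show ?thesis using \<open>0 < r\<close> by (auto simp: abs_if)
    qed
    then show "\<exists>s>0. \<forall>y. y \<noteq> x \<and> norm (y - x) < s \<longrightarrow> norm ((F y - F x) / (y - x) - D) < r"
      using d1(1) d2(1) by (intro exI[of _ "min d1 d2"]) auto
  qed
  then show ?thesis using real_differentiable_def by blast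
qed

text \<open>Adding \<open>L * x\<close> makes \<open>f\<close> nondecreasing without affecting
  differentiability, and the rational pairs \<open>p < q\<close> are countably many.\<close>

theorem lipschitz_differentiable_AE:
  fixes f :: "real \<Rightarrow> real"
  assumes "L-lipschitz_on UNIV f"
  shows "negligible {x. \<not> f differentiable (at x)}"
proof -
  define F where "F x = f x + L * x" for x
  have bnd: "\<bar>f v - f u\<bar> \<le> L * (v - u)" if "u \<le> v" for u v
    using lipschitz_onD[OF assms, of v u] that by (simp add: dist_real_def)
  have mono: "mono F"
    unfolding mono_def F_def using bnd by (smt (verit) right_diff_distrib)
  have lip: "F v - F u \<le> (2 * L) * (v - u)" if "u \<le> v" for u v
    using bnd[OF that] unfolding F_def by (simp add: algebra_simps abs_le_iff)
  have cont: "continuous_on UNIV F"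
    unfolding F_def using lipschitz_on_continuous_on[OF assms] by (intro continuous_intros)
  have Q: "negligible (slope_below F p \<inter> slope_above F q)" if "0 < p" "p < q" for p q
  proof -
    have "negligible (\<Union>n::nat. slope_below F p \<inter> slope_above F q \<inter> {-real n<..<real n})"
      using negligible_slope_gap[OF mono cont that] by (intro negligible_countable_Union) auto
    moreover have "slope_below F p \<inter> slope_above F q \<subseteq> (\<Union>n::nat. slope_below F p \<inter> slope_above F q \<inter> {-real n<..<real n})"
    proof
      fix x assume x: "x \<in> slope_below F p \<inter> slope_above F q"
      obtain n where "\<bar>x\<bar> < real n" using reals_Archimedean2 by blast
      then show "x \<in> (\<Union>n::nat. slope_below F p \<inter> slope_above F q \<inter> {-real n<..<real n})"
        using x by (auto simp: abs_less_iff intro!: exI[of _ n])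
    qed
    ultimately show ?thesis by (rule negligible_subset)
  qed
  let ?I = "{(p,q). p \<in> \<rat> \<and> q \<in> \<rat> \<and> 0 < p \<and> p < (q::real)}"
  have "countable ?I"
    by (rule countable_subset[OF _ countable_SIGMA[OF countable_rat countable_rat]]) auto
  then have "negligible (\<Union>i\<in>?I. slope_below F (fst i) \<inter> slope_above F (snd i))"
    using Q by (intro negligible_countable_Union) auto
  moreover have "{x. \<not> f differentiable (at x)} \<subseteq> (\<Union>i\<in>?I. slope_below F (fst i) \<inter> slope_above F (snd i))"
  proof (rule ccontr)
    assume "\<not> ?thesis"
    then obtain x where x: "\<not> f differentiable (at x)" "x \<notin> (\<Union>i\<in>?I. slope_below F (fst i) \<inter> slope_above F (snd i))"
      by blast
    have "F differentiable (at x)"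
      by (rule differentiable_if_no_slope_gap[OF mono lip]) (use x(2) in auto)
    then have "(\<lambda>y. F y - L * y) differentiable (at x)" by (intro derivative_intros)
    then show False using x(1) by (simp add: F_def)
  qed
  ultimately show ?thesis by (rule negligible_subset)
qed

section \<open>Lebesgue measure on the complex plane\<close>

lemma lborel_complex_eq_pair:
  "(lborel :: complex measure) = distr (lborel \<Otimes>\<^sub>M lborel) borel (\<lambda>(x, y). Complex x y)"
proof (rule lborel_eqI)
  have [measurable]: "(\<lambda>(x, y). Complex x y) \<in> borel \<Otimes>\<^sub>M borel \<rightarrow>\<^sub>M borel"
    unfolding borel_prod by (rule borel_measurable_continuous_onI) (auto simp: case_prod_unfold intro!: continuous_intros)
  fix l u :: complex
  assume le: "\<And>b. b \<in> Basis \<Longrightarrow> l \<bullet> b \<le> u \<bullet> b"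
  have le': "Re l \<le> Re u" "Im l \<le> Im u" using le[of 1] le[of \<i>] by (auto simp: Basis_complex_def)
  have "(\<lambda>(x, y). Complex x y) -` box l u \<inter> space (lborel \<Otimes>\<^sub>M lborel) = {Re l<..<Re u} \<times> {Im l<..<Im u}"
    by (auto simp: in_box_complex_iff space_pair_measure)
  then have "emeasure (distr (lborel \<Otimes>\<^sub>M lborel) borel (\<lambda>(x, y). Complex x y)) (box l u)
     = emeasure (lborel \<Otimes>\<^sub>M lborel) ({Re l<..<Re u} \<times> {Im l<..<Im u})"
    by (subst emeasure_distr) auto
  also have "\<dots> = emeasure lborel {Re l<..<Re u} * emeasure lborel {Im l<..<Im u}"
    by (rule lborel.emeasure_pair_measure_Times) auto
  also have "\<dots> = ennreal (Re u - Re l) * ennreal (Im u - Im l)" using le' by simp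
  also have "\<dots> = (\<Prod>b\<in>Basis. (u - l) \<bullet> b)"
    using le' by (simp add: Basis_complex_def complex_i_not_one ennreal_mult')
  finally show "emeasure (distr (lborel \<Otimes>\<^sub>M lborel) borel (\<lambda>(x, y). Complex x y)) (box l u) = (\<Prod>b\<in>Basis. (u - l) \<bullet> b)" .
qed simp

lemma measurable_Complex [measurable (raw)]:
  assumes "f \<in> borel_measurable M" "g \<in> borel_measurable M"
  shows "(\<lambda>x. Complex (f x) (g x)) \<in> borel_measurable M"
  unfolding Complex_eq using assms by measurable

lemma e2ennreal_borel [measurable]: "e2ennreal \<in> borel_measurable borel"
  by (intro borel_measurable_continuous_onI continuous_on_e2ennreal)

lemma ball_borel [measurable]: "ball (c::complex) r \<in> sets borel" by simp

lemma cis_borel [measurable]: "cis \<in> borel_measurable borel"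
  by (intro borel_measurable_continuous_onI continuous_intros)

lemma nn_integral_lborel_complex:
  fixes f :: "complex \<Rightarrow> ennreal"
  assumes [measurable]: "f \<in> borel_measurable borel"
  shows "(\<integral>\<^sup>+z. f z \<partial>lborel) = (\<integral>\<^sup>+x. \<integral>\<^sup>+y. f (Complex x y) \<partial>lborel \<partial>lborel)"
  by (subst lborel_complex_eq_pair, subst nn_integral_distr)
     (auto simp: lborel.nn_integral_fst[symmetric] case_prod_unfold)

lemma nn_integral_lborel_complex_swap:
  fixes f :: "complex \<Rightarrow> ennreal"
  assumes [measurable]: "f \<in> borel_measurable borel"
  shows "(\<integral>\<^sup>+z. f z \<partial>lborel) = (\<integral>\<^sup>+y. \<integral>\<^sup>+x. f (Complex x y) \<partial>lborel \<partial>lborel)"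
  unfolding nn_integral_lborel_complex[OF assms]
  by (rule lborel_pair.Fubini') measurable

lemma nn_integral_real_shift:
  fixes f :: "real \<Rightarrow> ennreal"
  assumes [measurable]: "f \<in> borel_measurable borel"
  shows "(\<integral>\<^sup>+x. f (x + c) \<partial>lborel) = (\<integral>\<^sup>+x. f x \<partial>lborel)"
  using nn_integral_real_affine[of f 1 c] by (simp add: add.commute)

text \<open>For a fixed real part the shear is a translation of the imaginary part.\<close>

lemma nn_integral_shear_Im:
  fixes f :: "complex \<Rightarrow> ennreal"
  assumes [measurable]: "f \<in> borel_measurable borel"
  shows "(\<integral>\<^sup>+z. f (Complex (Re z) (Im z + s * Re z)) \<partial>lborel) = (\<integral>\<^sup>+z. f z \<partial>lborel)"
proof -
  have "(\<integral>\<^sup>+z. f (Complex (Re z) (Im z + s * Re z)) \<partial>lborel) = (\<integral>\<^sup>+x. \<integral>\<^sup>+y. f (Complex x (y + s * x)) \<partial>lborel \<partial>lborel)"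
    by (subst nn_integral_lborel_complex) simp_all
  also have "\<dots> = (\<integral>\<^sup>+x. \<integral>\<^sup>+y. f (Complex x y) \<partial>lborel \<partial>lborel)"
    by (intro nn_integral_cong nn_integral_real_shift[where f="\<lambda>y. f (Complex x y)" for x]) measurable
  also have "\<dots> = (\<integral>\<^sup>+z. f z \<partial>lborel)" by (rule nn_integral_lborel_complex[symmetric]) fact
  finally show ?thesis .
qed

lemma nn_integral_shear_Re:
  fixes f :: "complex \<Rightarrow> ennreal"
  assumes [measurable]: "f \<in> borel_measurable borel"
  shows "(\<integral>\<^sup>+z. f (Complex (Re z + t * Im z) (Im z)) \<partial>lborel) = (\<integral>\<^sup>+z. f z \<partial>lborel)"
proof -
  have "(\<integral>\<^sup>+z. f (Complex (Re z + t * Im z) (Im z)) \<partial>lborel) = (\<integral>\<^sup>+y. \<integral>\<^sup>+x. f (Complex (x + t * y) y) \<partial>lborel \<partial>lborel)"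
    by (subst nn_integral_lborel_complex_swap) simp_all
  also have "\<dots> = (\<integral>\<^sup>+y. \<integral>\<^sup>+x. f (Complex x y) \<partial>lborel \<partial>lborel)"
    by (intro nn_integral_cong nn_integral_real_shift[where f="\<lambda>x. f (Complex x y)" for y]) measurable
  also have "\<dots> = (\<integral>\<^sup>+z. f z \<partial>lborel)" by (rule nn_integral_lborel_complex_swap[symmetric]) fact
  finally show ?thesis .
qed

text \<open>A rotation by an angle other than \<open>\<pi>\<close> is a product of three shears.\<close>
lemma nn_integral_rotation_aux:
  fixes f :: "complex \<Rightarrow> ennreal"
  assumes f [measurable]: "f \<in> borel_measurable borel" and c: "cmod c = 1" "c \<noteq> -1"
  shows "(\<integral>\<^sup>+z. f (c * z) \<partial>lborel) = (\<integral>\<^sup>+z. f z \<partial>lborel)"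
proof -
  \<comment> \<open>\<open>t\<close> is minus the tangent of half the rotation angle, whence the
    excluded angle.\<close>
  define a b t where "a = Re c" and "b = Im c" and "t = - b / (1 + a)"
  have ab: "a^2 + b^2 = 1" using c(1) unfolding a_def b_def cmod_def by simp
  have a: "1 + a \<noteq> 0"
  proof
    assume "1 + a = 0"
    then have "a = -1" by simp
    then have "b = 0" using ab by simp
    with \<open>a = -1\<close> c(2) show False unfolding a_def b_def by (simp add: complex_eq_iff)
  qed
  have t1: "1 + b * t = a" using ab a unfolding t_def by (simp add: field_simps power2_eq_square)
  have t2: "t * (1 + a) = - b" using a unfolding t_def by simp
  let ?T = "\<lambda>z. Complex (Re z + t * Im z) (Im z)" and ?S = "\<lambda>z. Complex (Re z) (Im z + b * Re z)"
  have "c * z = ?T (?S (?T z))" for z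
  proof (rule complex_eqI)
    have "Re (?T (?S (?T z))) = (1 + b * t) * Re z + (t + t * (1 + b * t)) * Im z"
      by (simp add: algebra_simps)
    also have "\<dots> = a * Re z - b * Im z" using t1 t2 by (simp add: algebra_simps)
    finally show "Re (c * z) = Re (?T (?S (?T z)))" by (simp add: a_def b_def)
    have "Im (?T (?S (?T z))) = (1 + b * t) * Im z + b * Re z" by (simp add: algebra_simps)
    then show "Im (c * z) = Im (?T (?S (?T z)))" unfolding t1 by (simp add: a_def b_def)
  qed
  then have "(\<integral>\<^sup>+z. f (c * z) \<partial>lborel) = (\<integral>\<^sup>+z. f (?T (?S (?T z))) \<partial>lborel)" by simp
  also have "\<dots> = (\<integral>\<^sup>+z. f (?T (?S z)) \<partial>lborel)"
    by (rule nn_integral_shear_Re[where f="\<lambda>z. f (?T (?S z))"]) measurable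
  also have "\<dots> = (\<integral>\<^sup>+z. f (?T z) \<partial>lborel)"
    by (rule nn_integral_shear_Im[where f="\<lambda>z. f (?T z)"]) measurable
  also have "\<dots> = (\<integral>\<^sup>+z. f z \<partial>lborel)" by (rule nn_integral_shear_Re) fact
  finally show ?thesis .
qed

text \<open>Rotating twice by the principal square root, which has nonnegative real part and
  therefore is not -1, covers the angle left out above.\<close>

lemma nn_integral_rotation:
  fixes f :: "complex \<Rightarrow> ennreal"
  assumes [measurable]: "f \<in> borel_measurable borel" and c: "cmod c = 1"
  shows "(\<integral>\<^sup>+z. f (c * z) \<partial>lborel) = (\<integral>\<^sup>+z. f z \<partial>lborel)"
proof -
  define d where "d = csqrt c"
  have dd: "d * d = c" by (metis power2_csqrt d_def power2_eq_square)
  have nd: "cmod d = 1" using c by (simp add: d_def norm_csqrt)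
  have "Re d \<ge> 0" unfolding d_def using Re_csqrt by simp
  then have "d \<noteq> -1" by auto
  have "(\<integral>\<^sup>+z. f (c * z) \<partial>lborel) = (\<integral>\<^sup>+z. f (d * (d * z)) \<partial>lborel)"
    by (simp add: mult.assoc[symmetric] dd)
  also have "\<dots> = (\<integral>\<^sup>+z. f (d * z) \<partial>lborel)"
    by (rule nn_integral_rotation_aux[where f="\<lambda>z. f (d * z)"]) (use nd \<open>d \<noteq> -1\<close> in auto)
  also have "\<dots> = (\<integral>\<^sup>+z. f z \<partial>lborel)"
    by (rule nn_integral_rotation_aux) (use nd \<open>d \<noteq> -1\<close> in auto)
  finally show ?thesis .
qed

lemma lborel_distr_rotation:
  assumes "cmod c = 1"
  shows "distr lborel borel (\<lambda>z. c * z) = lborel"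
proof (rule measure_eqI)
  fix A :: "complex set" assume "A \<in> sets (distr lborel borel (\<lambda>z. c * z))"
  then have [measurable]: "A \<in> sets borel" by simp
  have "emeasure (distr lborel borel (\<lambda>z. c * z)) A = (\<integral>\<^sup>+z. indicator A z \<partial>distr lborel borel (\<lambda>z. c * z))"
    by (rule nn_integral_indicator[symmetric]) simp
  also have "\<dots> = (\<integral>\<^sup>+z. indicator A (c * z) \<partial>lborel)"
    by (rule nn_integral_distr) auto
  also have "\<dots> = (\<integral>\<^sup>+z. indicator A z \<partial>lborel)" by (rule nn_integral_rotation) (use assms in auto)
  finally show "emeasure (distr lborel borel (\<lambda>z. c * z)) A = emeasure lborel A" by simp
qed simp

lemma integral_rotation:
  fixes f :: "complex \<Rightarrow> real"
  assumes "f \<in> borel_measurable borel" "cmod c = 1"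
  shows "(\<integral>z. f (c * z) \<partial>lborel) = (\<integral>z. f z \<partial>lborel)"
  by (subst (2) lborel_distr_rotation[OF assms(2), symmetric], subst integral_distr) (use assms in auto)

lemma integral_translation:
  fixes f :: "complex \<Rightarrow> real"
  assumes "f \<in> borel_measurable borel"
  shows "(\<integral>z. f (w + z) \<partial>lborel) = (\<integral>z. f z \<partial>lborel)"
  by (subst (2) lborel_distr_plus[of w, symmetric], subst integral_distr) (use assms in auto)

lemma integrable_translation_iff:
  fixes f :: "complex \<Rightarrow> real"
  assumes "f \<in> borel_measurable borel"
  shows "integrable lborel (\<lambda>z. f (w + z)) \<longleftrightarrow> integrable lborel f"
  by (subst (2) lborel_distr_plus[of w, symmetric], subst integrable_distr_eq) (use assms in auto)

lemma nn_integral_translation: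
  fixes f :: "complex \<Rightarrow> ennreal"
  assumes "f \<in> borel_measurable borel"
  shows "(\<integral>\<^sup>+z. f (w + z) \<partial>lborel) = (\<integral>\<^sup>+z. f z \<partial>lborel)"
  by (subst (2) lborel_distr_plus[of w, symmetric], subst nn_integral_distr) (use assms in auto)

lemma integral_scaling:
  fixes f :: "complex \<Rightarrow> real"
  assumes "f \<in> borel_measurable borel" "r > 0"
  shows "(\<integral>z. f z \<partial>lborel) = r^2 * (\<integral>z. f (of_real r * z) \<partial>lborel)"
proof -
  have "(\<integral>z. f z \<partial>lborel) = (\<integral>z. f z \<partial>density (distr lborel borel (\<lambda>x. 0 + r *\<^sub>R x)) (\<lambda>_. ennreal (r^2)))"
    using assms by (subst lborel_affine[of r 0]) (auto simp: ennreal_power[symmetric])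
  also have "\<dots> = r^2 * (\<integral>z. f (of_real r * z) \<partial>lborel)"
    using assms by (subst integral_density) (auto simp: integral_distr scaleR_conv_of_real)
  finally show ?thesis .
qed

lemma nn_integral_abs_powr_finite:
  assumes m: "0 < m" "m < 1" and R: "R > 0"
  shows "(\<integral>\<^sup>+s\<in>{-R..R}. ennreal (\<bar>s\<bar> powr (-m)) \<partial>lborel) < \<infinity>"
proof -
  have hi: "((\<lambda>x. x powr (-m)) has_integral (R powr (-m + 1) / (-m + 1))) {0..R}"
    using has_integral_powr_from_0[of "-m" R] m R by auto
  have pos: "(\<integral>\<^sup>+s. ennreal (indicator {0..R} s * \<bar>s\<bar> powr (-m)) \<partial>lborel) = ennreal (R powr (-m + 1) / (-m + 1))"
  proof (rule nn_integral_has_integral_lborel)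
    have "((\<lambda>x. if x \<in> {0..R} then x powr (-m) else 0) has_integral (R powr (-m + 1) / (-m + 1))) UNIV"
      using hi by (simp only: has_integral_restrict_UNIV)
    then show "((\<lambda>x. indicator {0..R} x * \<bar>x\<bar> powr (-m)) has_integral R powr (-m + 1) / (-m + 1)) UNIV"
      by (rule has_integral_eq[rotated]) (auto simp: indicator_def)
  qed (auto simp: indicator_def)
  have neg: "(\<integral>\<^sup>+s. ennreal (indicator {-R..0} s * \<bar>s\<bar> powr (-m)) \<partial>lborel) = (\<integral>\<^sup>+s. ennreal (indicator {0..R} s * \<bar>s\<bar> powr (-m)) \<partial>lborel)"
    by (subst nn_integral_real_affine[where c="-1" and t=0]) (auto intro!: nn_integral_cong simp: indicator_def)
  have "(\<integral>\<^sup>+s\<in>{-R..R}. ennreal (\<bar>s\<bar> powr (-m)) \<partial>lborel) \<le>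
    (\<integral>\<^sup>+s. ennreal (indicator {0..R} s * \<bar>s\<bar> powr (-m)) + ennreal (indicator {-R..0} s * \<bar>s\<bar> powr (-m)) \<partial>lborel)"
    by (intro nn_integral_mono) (auto simp: indicator_def)
  also have "\<dots> = ennreal (R powr (-m + 1) / (-m + 1)) + ennreal (R powr (-m + 1) / (-m + 1))"
    by (subst nn_integral_add) (auto simp: neg pos simp del: ennreal_plus)
  also have "\<dots> < \<infinity>" by simp
  finally show ?thesis .
qed

text \<open>From \<open>ln x = 2 * ln (sqrt x) \<le> 2 * sqrt x\<close> the integrand is at most a
  multiple of \<open>|Re z| powr (-1/2)\<close> on a square, which is integrable coordinate by
  coordinate.\<close>

lemma integrable_log_plus:
  assumes R: "R > 0"
  shows "integrable lborel (\<lambda>z::complex. max 0 (ln (R / cmod z)))"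
proof (rule integrableI_nonneg)
  let ?h = "\<lambda>x. ennreal (2 * sqrt R * \<bar>x\<bar> powr (-(1/2))) * indicator {-R..R} x"
  have bound: "ennreal (max 0 (ln (R / cmod z))) \<le> ?h (Re z) * indicator {-R..R} (Im z)" if z0: "Re z \<noteq> 0" for z
  proof (cases "cmod z < R")
    case False
    with R have "0 < cmod z" "R \<le> cmod z" by linarith+
    with R have "0 < R / cmod z" "R / cmod z \<le> 1" by simp_all
    then have "ln (R / cmod z) \<le> 0" by simp
    then show ?thesis by simp
  next
    case True
    have z: "cmod z > 0" using z0 by auto
    have "ln (R / cmod z) = 2 * ln (sqrt (R / cmod z))" using R z by (simp add: ln_sqrt)
    also have "\<dots> \<le> 2 * sqrt (R / cmod z)" using ln_le_minus_one[of "sqrt (R / cmod z)"] R z by simp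
    also have "\<dots> \<le> 2 * sqrt (R / \<bar>Re z\<bar>)" using z0 R z abs_Re_le_cmod[of z] by (intro mult_left_mono real_sqrt_le_mono divide_left_mono) auto
    also have "\<dots> = 2 * sqrt R * \<bar>Re z\<bar> powr (-(1/2))"
    proof -
      have "\<bar>Re z\<bar> powr (-(1/2)) = inverse (sqrt \<bar>Re z\<bar>)"
        unfolding powr_minus by (simp add: powr_half_sqrt)
      then show ?thesis by (simp only: real_sqrt_divide divide_inverse[symmetric] times_divide_eq_right)
    qed
    finally have "max 0 (ln (R / cmod z)) \<le> 2 * sqrt R * \<bar>Re z\<bar> powr (-(1/2))" using R by (auto intro: mult_nonneg_nonneg)
    moreover have "\<bar>Re z\<bar> \<le> R" "\<bar>Im z\<bar> \<le> R" using abs_Re_le_cmod[of z] abs_Im_le_cmod[of z] True by auto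
    ultimately show ?thesis by (auto simp: indicator_def abs_le_iff intro!: ennreal_leI)
  qed
  have "(\<integral>\<^sup>+z. ennreal (max 0 (ln (R / cmod z))) \<partial>lborel)
      = (\<integral>\<^sup>+x. \<integral>\<^sup>+y. ennreal (max 0 (ln (R / cmod (Complex x y)))) \<partial>lborel \<partial>lborel)"
    by (rule nn_integral_lborel_complex) measurable
  also have "\<dots> \<le> (\<integral>\<^sup>+x. \<integral>\<^sup>+y. ?h x * indicator {-R..R} y \<partial>lborel \<partial>lborel)"
  proof (rule nn_integral_mono_AE)
    have "AE x in lborel. x \<noteq> (0::real)" by (rule AE_lborel_singleton)
    then show "AE x in lborel. (\<integral>\<^sup>+y. ennreal (max 0 (ln (R / cmod (Complex x y)))) \<partial>lborel) \<le> (\<integral>\<^sup>+y. ?h x * indicator {-R..R} y \<partial>lborel)"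
    proof eventually_elim
      case (elim x)
      then show ?case using bound[of "Complex x y" for y] by (intro nn_integral_mono) auto
    qed
  qed
  also have "\<dots> = (\<integral>\<^sup>+x. ?h x * ennreal (2 * R) \<partial>lborel)"
    using R by (intro nn_integral_cong) (simp add: nn_integral_cmult_indicator)
  also have "\<dots> = ennreal (2 * sqrt R) * ennreal (2 * R) * (\<integral>\<^sup>+s\<in>{-R..R}. ennreal (\<bar>s\<bar> powr (-(1/2))) \<partial>lborel)"
    using R by (subst nn_integral_cmult[symmetric]) (auto intro!: nn_integral_cong simp: ennreal_mult' ac_simps)
  also have "\<dots> < \<infinity>"
    using nn_integral_abs_powr_finite[of "1/2" R] R by (auto simp: ennreal_mult_less_top)
  finally show "(\<integral>\<^sup>+z. ennreal (max 0 (ln (R / cmod z))) \<partial>lborel) < \<infinity>" .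
qed auto

section \<open>Harmonic functions and the maximum principle\<close>

lemma has_integral_circle_holomorphic:
  fixes F :: "complex \<Rightarrow> complex"
  assumes "continuous_on (cball 0 1) F" "F holomorphic_on ball 0 1"
  shows "((\<lambda>t. F (cis t)) has_integral 2 * pi * F 0) {0..2*pi}"
proof -
  have "((\<lambda>u. F u / (u - 0)) has_contour_integral (2 * of_real pi * \<i> * F 0)) (circlepath 0 1)"
    by (rule Cauchy_integral_circlepath) (use assms in auto)
  then have "((\<lambda>t. F (0 + 1 * cis t) / (0 + 1 * cis t) * 1 * \<i> * cis t) has_integral 2 * of_real pi * \<i> * F 0) {0..2*pi}"
    unfolding circlepath_def using has_contour_integral_part_circlepath_iff[of 0 "2*pi"] by simp
  then have "((\<lambda>t. (-\<i>) * (F (0 + 1 * cis t) / (0 + 1 * cis t) * 1 * \<i> * cis t)) has_integral (-\<i>) * (2 * of_real pi * \<i> * F 0)) {0..2*pi}"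
    by (rule has_integral_mult_right)
  then show ?thesis by (simp add: field_simps)
qed

lemma has_integral_circle_Re_holomorphic:
  fixes F :: "complex \<Rightarrow> complex"
  assumes "F holomorphic_on UNIV"
  shows "((\<lambda>t. Re (F (z + cis t * x))) has_integral 2 * pi * Re (F z)) {0..2*pi}"
proof -
  have hol: "(\<lambda>u. F (z + u * x)) holomorphic_on UNIV"
    by (rule holomorphic_on_compose_gen[of "\<lambda>u. z + u * x" UNIV F UNIV, unfolded o_def, OF _ assms])
       (auto intro!: holomorphic_intros)
  have "((\<lambda>t. F (z + cis t * x)) has_integral 2 * pi * F (z + 0 * x)) {0..2*pi}"
    by (rule has_integral_circle_holomorphic[where F="\<lambda>u. F (z + u * x)"])
       (use hol in \<open>auto intro: holomorphic_on_subset holomorphic_on_imp_continuous_on\<close>)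
  from has_integral_Re[OF this] show ?thesis by simp
qed

text \<open>\<open>1 - a * u\<close> has positive real part on the closed unit disc, so its
  principal logarithm is holomorphic inside and has as mean over the circle its value
  \<open>Ln 1 = 0\<close> at the centre.\<close>

lemma has_integral_circle_log_aux:
  assumes "cmod a < 1"
  shows "((\<lambda>t. ln (cmod (1 - a * cis t))) has_integral 0) {0..2*pi}"
proof -
  have pos: "Re (1 - a * u) > 0" if "cmod u \<le> 1" for u
  proof -
    have "Re (a * u) \<le> cmod (a * u)" by (rule complex_Re_le_cmod)
    also have "\<dots> = cmod a * cmod u" by (simp add: norm_mult)
    also have "\<dots> \<le> cmod a" using that by (simp add: mult_left_le)
    finally show ?thesis using assms by simp
  qed
  have nz: "1 - a * u \<notin> \<real>\<^sub>\<le>\<^sub>0" if "cmod u \<le> 1" for u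
    using pos[OF that] by (auto simp: complex_nonpos_Reals_iff)
  have "((\<lambda>t. Ln (1 - a * cis t)) has_integral 2 * pi * Ln (1 - a * 0)) {0..2*pi}"
    by (rule has_integral_circle_holomorphic[where F="\<lambda>u. Ln (1 - a * u)"])
       (auto intro!: continuous_intros holomorphic_intros simp: nz)
  from has_integral_Re[OF this]
  have "((\<lambda>t. Re (Ln (1 - a * cis t))) has_integral 0) {0..2*pi}" by simp
  then show ?thesis
  proof (rule has_integral_eq[rotated])
    fix t
    have "1 - a * cis t \<noteq> 0" using pos[of "cis t"] by (metis less_irrefl norm_cis order_refl zero_complex.simps(1))
    then show "Re (Ln (1 - a * cis t)) = ln (cmod (1 - a * cis t))" by (rule Re_Ln)
  qed
qed

text \<open>Jensen's formula for one zero: the larger of \<open>z\<close> and \<open>x\<close> is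
  factored out, leaving a mean that vanishes by the previous lemma. For equal moduli the integrand
  has a singularity on the circle; this case is later met only on a null set.\<close>

lemma has_integral_circle_log:
  assumes "cmod z \<noteq> cmod x"
  shows "((\<lambda>t. ln (cmod (z - cis t * x))) has_integral 2 * pi * ln (max (cmod z) (cmod x))) {0..2*pi}"
proof (cases "cmod x < cmod z")
  case True
  then have z: "z \<noteq> 0" by auto
  have lt: "cmod (x / z) < 1" using True by (simp add: norm_divide divide_less_eq)
  have "((\<lambda>t. ln (cmod z) + ln (cmod (1 - x / z * cis t))) has_integral (2 * pi * ln (cmod z) + 0)) {0..2*pi}"
    using has_integral_const_real[of "ln (cmod z)" 0 "2*pi"]
    by (intro has_integral_add has_integral_circle_log_aux[OF lt]) simp
  then have "((\<lambda>t. ln (cmod (z - cis t * x))) has_integral (2 * pi * ln (cmod z) + 0)) {0..2*pi}"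
  proof (rule has_integral_eq[rotated])
    fix t
    have eq: "z - cis t * x = z * (1 - x / z * cis t)" using z by (simp add: field_simps)
    have "1 - x / z * cis t \<noteq> 0"
    proof
      assume "1 - x / z * cis t = 0"
      then have "x / z * cis t = 1" by simp
      then have "cmod (x / z * cis t) = 1" by simp
      then show False using lt by (simp only: norm_mult norm_cis)
    qed
    then show "ln (cmod z) + ln (cmod (1 - x / z * cis t)) = ln (cmod (z - cis t * x))"
      using z unfolding eq by (simp add: norm_mult ln_mult)
  qed
  then show ?thesis using True by (simp add: max_def)
next
  case False
  then have lt': "cmod z < cmod x" using assms by simp
  then have x: "x \<noteq> 0" by auto
  \<comment> \<open>Factoring out \<open>cis t * x\<close> leaves \<open>cis (- t)\<close>;
    conjugation restores \<open>cis t\<close> without changing the modulus.\<close>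
  define a where "a = cnj (z / x)"
  have lt: "cmod a < 1" unfolding a_def using lt' by (simp add: norm_divide divide_less_eq)
  have "((\<lambda>t. ln (cmod x) + ln (cmod (1 - a * cis t))) has_integral (2 * pi * ln (cmod x) + 0)) {0..2*pi}"
    using has_integral_const_real[of "ln (cmod x)" 0 "2*pi"]
    by (intro has_integral_add has_integral_circle_log_aux[OF lt]) simp
  then have "((\<lambda>t. ln (cmod (z - cis t * x))) has_integral (2 * pi * ln (cmod x) + 0)) {0..2*pi}"
  proof (rule has_integral_eq[rotated])
    fix t
    have "z - cis t * x = - (cis t * x) * (1 - z / x * cis (- t))"
    proof -
      have "cis t * cis (- t) = 1" by (simp add: cis_mult)
      then have "cis t * x * (z / x * cis (-t)) = z" using x by (simp add: field_simps)
      then show ?thesis by (simp add: algebra_simps)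
    qed
    then have eq: "cmod (z - cis t * x) = cmod x * cmod (1 - z / x * cis (- t))" by (simp add: norm_mult)
    also have "1 - z / x * cis (- t) = cnj (1 - a * cis t)" unfolding a_def by (simp add: cis_cnj)
    finally have eq: "cmod (z - cis t * x) = cmod x * cmod (1 - a * cis t)" by (simp only: complex_mod_cnj)
    have "1 - a * cis t \<noteq> 0"
    proof
      assume "1 - a * cis t = 0"
      then have "a * cis t = 1" by simp
      then have "cmod (a * cis t) = 1" by simp
      then show False using lt by (simp add: norm_mult)
    qed
    then show "ln (cmod x) + ln (cmod (1 - a * cis t)) = ln (cmod (z - cis t * x))"
      using x unfolding eq by (simp add: ln_mult)
  qed
  then show ?thesis using lt' by (simp add: max_def)
qed

section \<open>Circle means and upper semicontinuity\<close>

lemma nn_integral_Icc_has_integral: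
  fixes f :: "real \<Rightarrow> real"
  assumes "continuous_on {a..b} f" "\<And>t. t \<in> {a..b} \<Longrightarrow> 0 \<le> f t" "(f has_integral I) {a..b}"
  shows "(\<integral>\<^sup>+t\<in>{a..b}. ennreal (f t) \<partial>lborel) = ennreal I"
proof -
  have "(\<integral>\<^sup>+t. ennreal (indicator {a..b} t * f t) \<partial>lborel) = ennreal I"
  proof (rule nn_integral_has_integral_lborel)
    show "(\<lambda>t. indicator {a..b} t * f t) \<in> borel_measurable borel"
      using borel_measurable_continuous_on_indicator[OF _ assms(1)] by simp
    have "((\<lambda>t. if t \<in> {a..b} then f t else 0) has_integral I) UNIV"
      using assms(3) by (simp only: has_integral_restrict_UNIV)
    then show "((\<lambda>t. indicator {a..b} t * f t) has_integral I) UNIV"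
      by (rule has_integral_eq[rotated]) (auto simp: indicator_def)
  qed (use assms(2) in \<open>auto simp: indicator_def\<close>)
  moreover have "(\<integral>\<^sup>+t\<in>{a..b}. ennreal (f t) \<partial>lborel) = (\<integral>\<^sup>+t. ennreal (indicator {a..b} t * f t) \<partial>lborel)"
    by (intro nn_integral_cong) (auto simp: indicator_def)
  ultimately show ?thesis by simp
qed

text \<open>Continuity makes both parts in the definition of \<open>circle_mean\<close> finite, so
  their difference is the ordinary integral.\<close>

lemma circle_mean_continuous:
  assumes cont: "continuous_on UNIV Q" and I: "((\<lambda>t. Q (z + cis t * of_real r)) has_integral 2 * pi * J) {0..2*pi}"
  shows "circle_mean (\<lambda>w. ereal (Q w)) z r = ereal J"
proof -
  let ?q = "\<lambda>t. Q (z + of_real r * cis t)"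
  have cq: "continuous_on A ?q" for A
    by (rule continuous_on_compose2[OF cont]) (auto intro!: continuous_intros)
  have I': "(?q has_integral 2 * pi * J) {0..2*pi}" using I by (simp add: mult.commute)
  have cp: "continuous_on {0..2*pi} (\<lambda>t. max 0 (?q t))" "continuous_on {0..2*pi} (\<lambda>t. max 0 (- ?q t))"
    by (intro continuous_intros cq)+
  obtain A where A: "((\<lambda>t. max 0 (?q t)) has_integral A) {0..2*pi}" using integrable_continuous_real[OF cp(1)] by blast
  obtain B where B: "((\<lambda>t. max 0 (- ?q t)) has_integral B) {0..2*pi}" using integrable_continuous_real[OF cp(2)] by blast
  have "((\<lambda>t. max 0 (?q t) - max 0 (- ?q t)) has_integral A - B) {0..2*pi}" by (rule has_integral_diff[OF A B])
  moreover have "(\<lambda>t. max 0 (?q t) - max 0 (- ?q t)) = ?q" by (auto simp: max_def)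
  ultimately have AB: "A - B = 2 * pi * J" using I' has_integral_unique by metis
  have pos: "A \<ge> 0" "B \<ge> 0" using has_integral_nonneg[OF A] has_integral_nonneg[OF B] by auto
  have "(\<integral>\<^sup>+\<theta>\<in>{0..2*pi}. e2ennreal (ereal (?q \<theta>)) \<partial>lborel) = (\<integral>\<^sup>+\<theta>\<in>{0..2*pi}. ennreal (max 0 (?q \<theta>)) \<partial>lborel)"
    by (intro nn_integral_cong) (simp add: max_def ennreal_neg)
  also have "\<dots> = ennreal A" by (rule nn_integral_Icc_has_integral[OF cp(1) _ A]) simp
  finally have 1: "(\<integral>\<^sup>+\<theta>\<in>{0..2*pi}. e2ennreal (ereal (?q \<theta>)) \<partial>lborel) = ennreal A" .
  have "(\<integral>\<^sup>+\<theta>\<in>{0..2*pi}. e2ennreal (- ereal (?q \<theta>)) \<partial>lborel) = (\<integral>\<^sup>+\<theta>\<in>{0..2*pi}. ennreal (max 0 (- ?q \<theta>)) \<partial>lborel)"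
    by (intro nn_integral_cong) (simp add: max_def ennreal_neg)
  also have "\<dots> = ennreal B" by (rule nn_integral_Icc_has_integral[OF cp(2) _ B]) simp
  finally have 2: "(\<integral>\<^sup>+\<theta>\<in>{0..2*pi}. e2ennreal (- ereal (?q \<theta>)) \<partial>lborel) = ennreal B" .
  show ?thesis unfolding circle_mean_def 1 2 using pos AB
    by (simp add: enn2ereal_ennreal)
qed

lemma circle_mean_mono:
  assumes "\<And>t. \<phi> (z + of_real r * cis t) \<le> \<psi> (z + of_real r * cis t)"
  shows "circle_mean \<phi> z r \<le> circle_mean \<psi> z r"
  unfolding circle_mean_def
  by (intro ereal_divide_right_mono ereal_minus_mono)
     (auto simp: less_eq_ennreal.rep_eq[symmetric] assms intro!: nn_integral_mono mult_right_mono e2ennreal_mono)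

lemma usc_ereal_add_continuous:
  assumes "usc_ereal \<phi>" "continuous_on UNIV c"
  shows "usc_ereal (\<lambda>w. \<phi> w + ereal (c w))"
  unfolding usc_ereal_def
proof (intro allI impI)
  fix z d assume "\<phi> z + ereal (c z) < d"
  then have "\<phi> z < d - ereal (c z)" by (simp add: ereal_less_minus_iff)
  then obtain e where e: "\<phi> z < ereal e" "ereal e < d - ereal (c z)" using ereal_dense2 by blast
  have "eventually (\<lambda>w. \<phi> w < ereal e) (at z)" using assms(1) e(1) unfolding usc_ereal_def by blast
  moreover have "eventually (\<lambda>w. ereal (e + c w) < d) (at z)"
  proof (rule order_tendstoD(2))
    have "(c \<longlongrightarrow> c z) (at z)" using assms(2) by (simp add: continuous_on_def)
    then show "((\<lambda>w. ereal (e + c w)) \<longlongrightarrow> ereal (e + c z)) (at z)" by (intro tendsto_intros) 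
    show "ereal (e + c z) < d" using e(2) by (simp add: ereal_less_minus_iff)
  qed
  ultimately show "eventually (\<lambda>w. \<phi> w + ereal (c w) < d) (at z)"
  proof eventually_elim
    case (elim w)
    have "\<phi> w + ereal (c w) \<le> ereal e + ereal (c w)" using elim(1) by (intro add_right_mono) auto
    then show ?case using elim(2) by simp
  qed
qed

lemma usc_ereal_open_less:
  assumes "usc_ereal \<phi>"
  shows "open {w. \<phi> w < c}"
proof (subst open_subopen, safe)
  fix z assume z: "\<phi> z < c"
  then have "eventually (\<lambda>w. \<phi> w < c) (at z)" using assms by (auto simp: usc_ereal_def)
  then have "eventually (\<lambda>w. \<phi> w < c) (nhds z)" using z by (simp add: eventually_nhds_conv_at)
  then show "\<exists>T. open T \<and> z \<in> T \<and> T \<subseteq> {w. \<phi> w < c}" unfolding eventually_nhds by blast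
qed

lemma usc_ereal_borel [measurable_dest]:
  assumes "usc_ereal \<phi>"
  shows "\<phi> \<in> borel_measurable borel"
  by (rule borel_measurableI_less) (use usc_ereal_open_less[OF assms] in auto)

text \<open>Without a maximum the open sets \<open>{w. v w < v y}\<close> would cover
  \<open>K\<close>; among finitely many of them the largest \<open>v y\<close> would have to be
  exceeded by another.\<close>

lemma usc_ereal_attains_sup:
  assumes "usc_ereal v" "compact K" "K \<noteq> {}"
  shows "\<exists>x\<in>K. \<forall>y\<in>K. v y \<le> v x"
proof (rule ccontr)
  assume "\<not> ?thesis"
  then have *: "\<And>x. x \<in> K \<Longrightarrow> \<exists>y\<in>K. v x < v y" by (auto simp: not_le)
  obtain C where C: "C \<subseteq> K" "finite C" "K \<subseteq> (\<Union>y\<in>C. {w. v w < v y})"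
    by (rule compactE_image[OF assms(2), of K "\<lambda>y. {w. v w < v y}"])
       (use usc_ereal_open_less[OF assms(1)] * in auto)
  then have "C \<noteq> {}" using assms(3) by auto
  then have "Max (v ` C) \<in> v ` C" using C(2) by simp
  then obtain y where y: "y \<in> C" "v y = Max (v ` C)" by auto
  then obtain y' where "y' \<in> C" "v y < v y'" using C by blast
  then have "v y' \<le> Max (v ` C)" using C(2) by simp
  with y \<open>v y < v y'\<close> show False by simp
qed

lemma usc_ereal_bounded_above:
  assumes "usc_ereal v" "compact K" "\<And>z. v z < \<infinity>"
  obtains M :: real where "\<And>z. z \<in> K \<Longrightarrow> v z \<le> ereal M"
proof (cases "K = {}")
  case False
  then obtain x where x: "x \<in> K" "\<And>y. y \<in> K \<Longrightarrow> v y \<le> v x" using usc_ereal_attains_sup[OF assms(1,2)] by blast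
  obtain M where M: "v x < ereal M" using assms(3)[of x] ereal_dense2 by blast
  have "v z \<le> ereal M" if "z \<in> K" for z using x(2)[OF that] M by order
  then show ?thesis by (rule that)
qed (use that in auto)

text \<open>The mean value property stands in for Laplace's equation because the maximum principle
  uses just that. The complex \<open>x\<close> carries both the radius and the starting point of the
  circle.\<close>

definition harmonic :: "(complex \<Rightarrow> real) \<Rightarrow> bool" where
  "harmonic q \<longleftrightarrow> continuous_on UNIV q \<and> (\<forall>z x. ((\<lambda>t. q (z + cis t * x)) has_integral 2 * pi * q z) {0..2*pi})"

lemma harmonic_Re_holomorphic:
  assumes "F holomorphic_on UNIV"
  shows "harmonic (\<lambda>w. Re (F w))"
  unfolding harmonic_def
  using has_integral_circle_Re_holomorphic[OF assms] holomorphic_on_imp_continuous_on[OF assms]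
  by (auto intro!: continuous_intros)

lemma harmonic_add_const:
  assumes "harmonic q"
  shows "harmonic (\<lambda>w. q w + c)"
  unfolding harmonic_def
proof (intro conjI allI)
  show "continuous_on UNIV (\<lambda>w. q w + c)" using assms unfolding harmonic_def by (intro continuous_intros) auto
  fix z x
  have "((\<lambda>t. q (z + cis t * x)) has_integral 2 * pi * q z) {0..2*pi}" using assms by (simp add: harmonic_def)
  from has_integral_add[OF this has_integral_const_real[of c 0 "2*pi"]]
  show "((\<lambda>t. q (z + cis t * x) + c) has_integral 2 * pi * (q z + c)) {0..2*pi}" by (simp add: distrib_left)
qed

text \<open>Adding \<open>\<epsilon> |w - z|\<^sup>2\<close> makes the mean value inequality strict, which excludes interior maxima.\<close>
lemma subharmonic_le_harmonic:
  assumes sub: "subharmonic \<phi>" and q: "harmonic q" and r: "0 < r"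
    and bd: "\<And>w. w \<in> sphere z r \<Longrightarrow> \<phi> w \<le> ereal (q w)" and w: "w \<in> cball z r"
  shows "\<phi> w \<le> ereal (q w)"
proof (rule ccontr)
  assume "\<not> ?thesis"
  then have gt: "ereal (q w) < \<phi> w" by simp
  have fin: "\<phi> u < \<infinity>" for u using sub by (auto simp: subharmonic_def)
  obtain p where p: "ereal (q w) < ereal p" "ereal p < \<phi> w" using ereal_dense2[OF gt] by auto
  \<comment> \<open>Chosen so that \<open>v \<le> \<epsilon> * r^2 = p - q w < v w\<close> for
    \<open>v\<close> on the sphere: the maximum of \<open>v\<close> over the closed disc is then
    interior.\<close>
  define \<epsilon> where "\<epsilon> = (p - q w) / r^2"
  have eps: "\<epsilon> > 0" using p r by (simp add: \<epsilon>_def)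
  have er: "\<epsilon> * r^2 = p - q w" using r by (simp add: \<epsilon>_def)
  define v where "v u = \<phi> u + ereal (\<epsilon> * (cmod (u - z))^2 - q u)" for u
  have qc: "continuous_on UNIV q" using q by (simp add: harmonic_def)
  have "usc_ereal v" unfolding v_def
    by (rule usc_ereal_add_continuous) (use sub qc in \<open>auto simp: subharmonic_def intro!: continuous_intros\<close>)
  then obtain w0 where w0: "w0 \<in> cball z r" "\<And>u. u \<in> cball z r \<Longrightarrow> v u \<le> v w0"
    using usc_ereal_attains_sup[of v "cball z r"] r by fastforce
  have "ereal (\<epsilon> * r^2) < v w"
  proof -
    have "ereal (\<epsilon> * r^2) = ereal p + ereal (- q w)" by (simp add: er)
    also have "\<dots> < \<phi> w + ereal (- q w)" using p(2) by (cases "\<phi> w") auto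
    also have "\<dots> \<le> v w" unfolding v_def using eps by (intro add_left_mono) simp
    finally show ?thesis .
  qed
  also have "\<dots> \<le> v w0" using w0 w by blast
  finally have v0: "ereal (\<epsilon> * r^2) < v w0" .
  have "w0 \<notin> sphere z r"
  proof
    assume s: "w0 \<in> sphere z r"
    then have "cmod (w0 - z) = r" by (simp add: dist_norm norm_minus_commute)
    then have "v w0 \<le> ereal (q w0) + ereal (\<epsilon> * r^2 - q w0)"
      unfolding v_def using bd[OF s] by (intro add_mono) auto
    then show False using v0 by simp
  qed
  then have ball: "cmod (w0 - z) < r" using w0(1) by (auto simp: dist_norm norm_minus_commute)
  have "\<phi> w0 \<noteq> -\<infinity>" using v0 unfolding v_def by auto
  then obtain f0 where f0: "\<phi> w0 = ereal f0" using fin[of w0] by (cases "\<phi> w0") auto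
  \<comment> \<open>With this constant, maximality of \<open>v\<close> at \<open>w0\<close> reads
    \<open>\<phi> \<le> Q\<close> on the disc with equality at \<open>w0\<close>, while the circle
    mean of \<open>Q\<close> about \<open>w0\<close> is \<open>f0 - \<epsilon> * s^2\<close>,
    strictly less than \<open>f0\<close>.\<close>
  define C where "C = f0 - q w0 + \<epsilon> * (cmod (w0 - z))^2"
  define Q where "Q u = q u - \<epsilon> * (cmod (u - z))^2 + C" for u
  have leQ: "\<phi> u \<le> ereal (Q u)" if "u \<in> cball z r" for u
    using w0(2)[OF that] unfolding v_def f0 Q_def C_def by (cases "\<phi> u") auto
  obtain R where R: "R > 0" "\<And>s. 0 < s \<Longrightarrow> s < R \<Longrightarrow> \<phi> w0 \<le> circle_mean \<phi> w0 s"
    using sub unfolding subharmonic_def by blast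
  define s where "s = min (R/2) ((r - cmod (w0 - z)) / 2)"
  have "s \<le> (r - cmod (w0 - z)) / 2" "s \<le> R / 2" unfolding s_def by (rule min.cobounded2, rule min.cobounded1)
  moreover have "0 < s" using R(1) ball unfolding s_def by simp
  moreover have "s' + c < r" if "s' \<le> (r - c) / 2" "c < r" for s' c :: real using that by (simp add: field_simps)
  ultimately have s: "0 < s" "s < R" "s + cmod (w0 - z) < r" using R(1) ball by auto
  have "\<phi> w0 \<le> circle_mean \<phi> w0 s" using R s by blast
  also have "\<dots> \<le> circle_mean (\<lambda>u. ereal (Q u)) w0 s"
  proof (rule circle_mean_mono, rule leQ)
    fix t
    have "cmod (w0 + of_real s * cis t - z) \<le> cmod (w0 - z) + cmod (of_real s * cis t)"
      by (metis add.commute add_diff_eq norm_triangle_ineq)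
    also have "\<dots> \<le> r" using s by (simp add: norm_mult)
    finally show "w0 + of_real s * cis t \<in> cball z r" by (simp add: dist_norm norm_minus_commute)
  qed
  also have "\<dots> = ereal (q w0 - \<epsilon> * ((cmod (w0 - z))^2 + s^2) + C)"
  proof (rule circle_mean_continuous)
    show "continuous_on UNIV Q" unfolding Q_def by (intro continuous_intros qc)
    \<comment> \<open>Expanding the square of the distance to \<open>z\<close> leaves the cross term
      \<open>Re (?c * cis t)\<close>, whose mean over the circle is zero.\<close>
    let ?c = "2 * of_real s * cnj (w0 - z)"
    have i1: "((\<lambda>t. q (w0 + cis t * of_real s)) has_integral 2 * pi * q w0) {0..2*pi}" using q by (simp add: harmonic_def)
    have "((\<lambda>t. Re (?c * (0 + cis t * 1))) has_integral 2 * pi * Re (?c * 0)) {0..2*pi}"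
      by (rule has_integral_circle_Re_holomorphic) (auto intro!: holomorphic_intros)
    then have i2: "((\<lambda>t. Re (?c * cis t)) has_integral 0) {0..2*pi}" by simp
    have i3: "((\<lambda>t. C - \<epsilon> * ((cmod (w0 - z))^2 + s^2)) has_integral 2 * pi * (C - \<epsilon> * ((cmod (w0 - z))^2 + s^2))) {0..2*pi}"
      using has_integral_const_real[of "C - \<epsilon> * ((cmod (w0 - z))^2 + s^2)" 0 "2*pi"] by simp
    have H1: "((\<lambda>t. q (w0 + cis t * of_real s) + (-\<epsilon>) * Re (?c * cis t) + (C - \<epsilon> * ((cmod (w0 - z))^2 + s^2))) has_integral
       2 * pi * q w0 + (-\<epsilon>) * 0 + 2 * pi * (C - \<epsilon> * ((cmod (w0 - z))^2 + s^2))) {0..2*pi}"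
      by (intro has_integral_add i1 i3 has_integral_mult_right i2)
    have HQ: "Q (w0 + cis t * of_real s) = q (w0 + cis t * of_real s) + (-\<epsilon>) * Re (?c * cis t) + (C - \<epsilon> * ((cmod (w0 - z))^2 + s^2))" for t
    proof -
      have *: "(cmod (w0 + cis t * of_real s - z))^2 = (cmod (w0 - z))^2 + Re (?c * cis t) + s^2"
      proof -
        have "(cmod ((w0 - z) + cis t * of_real s))^2 = (cmod (w0 - z))^2 + 2 * ((w0 - z) \<bullet> (cis t * of_real s)) + (cmod (cis t * of_real s))^2"
          unfolding power2_norm_eq_inner by (simp add: inner_add_left inner_add_right inner_commute)
        then show ?thesis by (simp add: inner_complex_def norm_mult algebra_simps)
      qed
      show ?thesis unfolding Q_def * by (simp only: algebra_simps)
    qed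
    show "((\<lambda>t. Q (w0 + cis t * of_real s)) has_integral 2 * pi * (q w0 - \<epsilon> * ((cmod (w0 - z))^2 + s^2) + C)) {0..2*pi}"
      unfolding HQ by (rule has_integral_eq_rhs[OF H1]) (simp add: algebra_simps)
  qed
  finally have "f0 \<le> q w0 - \<epsilon> * ((cmod (w0 - z))^2 + s^2) + C" unfolding f0 by simp
  then have "\<epsilon> * s^2 \<le> 0" unfolding C_def by (simp add: algebra_simps)
  then show False using eps s(1) by (simp add: mult_le_0_iff)
qed

section \<open>The global mean value inequality\<close>

text \<open>Since \<open>1 / u = cnj u\<close> on the unit circle, the real parts of polynomials form a ring of functions there.\<close>
lemma circle_Re_poly_mult:
  fixes p q :: "complex poly"
  shows "\<exists>s :: complex poly. \<forall>u. cmod u = 1 \<longrightarrow> Re (poly p u) * Re (poly q u) = Re (poly s u)"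
proof -
  define T where "T = {g. \<exists>s :: complex poly. \<forall>u. cmod u = 1 \<longrightarrow> g u = Re (poly s u)}"
  have add: "(\<lambda>u. g u + h u) \<in> T" if gh: "g \<in> T" "h \<in> T" for g h
  proof -
    obtain a b where "\<forall>u. cmod u = 1 \<longrightarrow> g u = Re (poly a u)" "\<forall>u. cmod u = 1 \<longrightarrow> h u = Re (poly b u)"
      using gh unfolding T_def by auto
    then show ?thesis unfolding T_def by (auto intro!: exI[of _ "a + b"])
  qed
  have sum: "finite A \<Longrightarrow> (\<And>i. i \<in> A \<Longrightarrow> g i \<in> T) \<Longrightarrow> (\<lambda>u. \<Sum>i\<in>A. g i u) \<in> T" for A and g :: "nat \<Rightarrow> complex \<Rightarrow> real"
  proof (induction A rule: finite_induct)
    case empty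
    show ?case unfolding T_def by (auto intro!: exI[of _ 0])
  next
    case (insert x F)
    then show ?case by (simp add: add)
  qed
  \<comment> \<open>The conjugate is put on the lower power, so that
    \<open>cnj u ^ i * u ^ j = u ^ (j - i)\<close> is again a monomial.\<close>
  have mono: "(\<lambda>u. Re (a * u^i) * Re (b * u^j)) \<in> T" if "i \<le> j" for a b i j
  proof -
    have "Re (a * u^i) * Re (b * u^j) = Re (poly (monom (a * b / 2) (i + j) + monom (cnj a * b / 2) (j - i)) u)"
      if u: "cmod u = 1" for u
    proof -
      have "cnj u * u = 1" using u by (metis complex_norm_square mult.commute of_real_1 one_power2)
      then have "cnj u ^ i * u ^ i = 1" by (metis power_mult_distrib power_one)
      moreover have "u ^ j = u ^ i * u ^ (j - i)" using \<open>i \<le> j\<close> by (metis le_add_diff_inverse power_add)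
      ultimately have 1: "cnj (a * u^i) * (b * u^j) = cnj a * b * u^(j - i)" by simp
      have 2: "(a * u^i) * (b * u^j) = a * b * u^(i + j)" by (simp add: power_add)
      have "Re X * Re Y = (Re (X * Y) + Re (cnj X * Y)) / 2" for X Y by simp
      from this[of "a * u^i" "b * u^j"]
      have "Re (a * u^i) * Re (b * u^j) = (Re (a * b * u^(i + j)) + Re (cnj a * b * u^(j - i))) / 2"
        unfolding 1 2 .
      also have "\<dots> = Re ((a * b * u^(i + j) + cnj a * b * u^(j - i)) / 2)"
        by (simp only: Re_divide_numeral plus_complex.sel)
      also have "(a * b * u^(i + j) + cnj a * b * u^(j - i)) / 2
          = poly (monom (a * b / 2) (i + j) + monom (cnj a * b / 2) (j - i)) u"
        by (simp add: poly_monom add_divide_distrib)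
      finally show ?thesis .
    qed
    then show ?thesis unfolding T_def by blast
  qed
  have mono': "(\<lambda>u. Re (a * u^i) * Re (b * u^j)) \<in> T" for a b i j
  proof (cases "i \<le> j")
    case False
    then have "(\<lambda>u. Re (b * u^j) * Re (a * u^i)) \<in> T" by (intro mono) auto
    then show ?thesis by (simp add: mult.commute)
  qed (rule mono)
  have "(\<lambda>u. \<Sum>i\<le>degree p. \<Sum>j\<le>degree q. Re (coeff p i * u^i) * Re (coeff q j * u^j)) \<in> T"
    by (intro sum mono') auto
  then have "(\<lambda>u. Re (poly p u) * Re (poly q u)) \<in> T" by (simp add: poly_altdef sum_product)
  then show ?thesis unfolding T_def by simp
qed

text \<open>Stone-Weierstrass on the unit circle, with the real parts of polynomials as separating
  ring; each of them extends harmonically to the plane through \<open>(w - z) / x\<close>. This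
  takes the place of the Poisson integral.\<close>

lemma circle_harmonic_approximation:
  fixes f :: "complex \<Rightarrow> real"
  assumes f: "continuous_on (sphere z (cmod x)) f" and x: "x \<noteq> 0" and e: "0 < e"
  shows "\<exists>q. harmonic q \<and> (\<forall>w\<in>sphere z (cmod x). \<bar>f w - q w\<bar> < e)"
proof -
  let ?P = "\<lambda>g. \<exists>s :: complex poly. \<forall>u. cmod u = 1 \<longrightarrow> g u = Re (poly s u)"
  have sph: "z + u * x \<in> sphere z (cmod x)" if "cmod u = 1" for u
    using that by (simp add: dist_norm norm_mult)
  have "\<exists>g. ?P g \<and> (\<forall>u\<in>sphere 0 1. \<bar>f (z + u * x) - g u\<bar> < e)"
  proof (rule Stone_Weierstrass_HOL)
    show "?P (\<lambda>x. c)" for c :: real by (auto intro!: exI[of _ "[:of_real c:]"])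
    show "continuous_on (sphere 0 1) g" if g: "?P g" for g
    proof -
      obtain s :: "complex poly" where s: "\<forall>u. cmod u = 1 \<longrightarrow> g u = Re (poly s u)" using g by auto
      have "continuous_on (sphere 0 1) (\<lambda>u. Re (poly s u))" by (intro continuous_intros)
      then show ?thesis by (rule continuous_on_eq) (simp add: s)
    qed
    show "?P (\<lambda>x. g x + h x)" if "?P g \<and> ?P h" for g h
    proof -
      obtain a b where "\<forall>u. cmod u = 1 \<longrightarrow> g u = Re (poly a u)" "\<forall>u. cmod u = 1 \<longrightarrow> h u = Re (poly b u)"
        using \<open>?P g \<and> ?P h\<close> by auto
      then show ?thesis by (auto intro!: exI[of _ "a + b"])
    qed
    show "?P (\<lambda>x. g x * h x)" if "?P g \<and> ?P h" for g h
    proof -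
      obtain a b where "\<forall>u. cmod u = 1 \<longrightarrow> g u = Re (poly a u)" "\<forall>u. cmod u = 1 \<longrightarrow> h u = Re (poly b u)"
        using \<open>?P g \<and> ?P h\<close> by auto
      moreover obtain s where "\<forall>u. cmod u = 1 \<longrightarrow> Re (poly a u) * Re (poly b u) = Re (poly s u)"
        using circle_Re_poly_mult by blast
      ultimately show ?thesis by auto
    qed
    show "\<exists>f. ?P f \<and> f x \<noteq> f y" if "x \<in> sphere 0 1 \<and> y \<in> sphere 0 1 \<and> x \<noteq> y" for x y
    proof (cases "Re x = Re y")
      case False
      then show ?thesis by (intro exI[of _ Re]) (auto intro!: exI[of _ "[:0, 1:]"])
    next
      case True
      then have "Im x \<noteq> Im y" using that complex_eqI by blast
      then show ?thesis by (intro exI[of _ Im]) (auto intro!: exI[of _ "[:0, -\<i>:]"])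
    qed
    show "continuous_on (sphere 0 1) (\<lambda>u. f (z + u * x))"
      by (rule continuous_on_compose2[OF f]) (use sph in \<open>auto intro!: continuous_intros\<close>)
  qed (use e in auto)
  then obtain s :: "complex poly" where s: "\<And>u. cmod u = 1 \<Longrightarrow> \<bar>f (z + u * x) - Re (poly s u)\<bar> < e"
    by (metis (mono_tags, lifting) dist_0_norm mem_sphere)
  show ?thesis
  proof (intro exI conjI ballI)
    show "harmonic (\<lambda>w. Re (poly s ((w - z) / x)))"
      by (rule harmonic_Re_holomorphic) (auto intro!: holomorphic_intros x)
    fix w assume "w \<in> sphere z (cmod x)"
    then have "cmod ((w - z) / x) = 1" using x by (simp add: dist_norm norm_minus_commute norm_divide)
    from s[OF this] show "\<bar>f w - Re (poly s ((w - z) / x))\<bar> < e" using x by simp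
  qed
qed

text \<open>Here the radius is arbitrary, unlike in the definition of subharmonicity. On the circle
  \<phi> is compared with a harmonic function close to \<open>f\<close>, and the maximum principle
  carries the comparison to the centre, where that function takes its own circle mean.\<close>

lemma subharmonic_le_continuous_circle_mean:
  assumes sub: "subharmonic \<phi>" and x: "x \<noteq> 0"
    and f: "continuous_on (sphere z (cmod x)) f" and le: "\<And>w. w \<in> sphere z (cmod x) \<Longrightarrow> \<phi> w \<le> ereal (f w)"
    and I: "((\<lambda>t. f (z + cis t * x)) has_integral 2 * pi * J) {0..2*pi}"
  shows "\<phi> z \<le> ereal J"
proof (rule ereal_le_epsilon2)
  fix e :: real assume "0 < e"
  obtain q where q: "harmonic q" "\<And>w. w \<in> sphere z (cmod x) \<Longrightarrow> \<bar>f w - q w\<bar> < e/2"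
    using circle_harmonic_approximation[OF f x, of "e/2"] \<open>0 < e\<close> by auto
  have h: "harmonic (\<lambda>w. q w + e/2)" by (rule harmonic_add_const[OF q(1)])
  have "\<phi> z \<le> ereal (q z + e/2)"
  proof (rule subharmonic_le_harmonic[OF sub h])
    fix w assume w: "w \<in> sphere z (cmod x)"
    have "\<phi> w \<le> ereal (f w)" by (rule le[OF w])
    also have "f w \<le> q w + e/2" using q(2)[OF w] by linarith
    finally show "\<phi> w \<le> ereal (q w + e/2)" by simp
  qed (use x in auto)
  also have "q z \<le> J + e/2"
  proof -
    have 1: "((\<lambda>t. q (z + cis t * x)) has_integral 2 * pi * q z) {0..2*pi}" using q(1) by (simp add: harmonic_def)
    have 2: "((\<lambda>t. f (z + cis t * x) + e/2) has_integral 2 * pi * (J + e/2)) {0..2*pi}"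
      using has_integral_add[OF I has_integral_const_real[of "e/2" 0 "2*pi"]] by (simp add: algebra_simps)
    have "2 * pi * q z \<le> 2 * pi * (J + e/2)"
    proof (rule has_integral_le[OF 1 2])
      fix t
      have "z + cis t * x \<in> sphere z (cmod x)" by (simp add: dist_norm norm_mult)
      from q(2)[OF this] show "q (z + cis t * x) \<le> f (z + cis t * x) + e/2" by linarith
    qed
    then show ?thesis by simp
  qed
  finally show "\<phi> z \<le> ereal J + ereal e" by (simp add: add.commute)
qed

text \<open>\<open>g n\<close> is the infimal convolution of the truncation of \<psi> at
  \<open>n\<close> with \<open>n * dist\<close>, hence \<open>n\<close>-Lipschitz. Lower
  semicontinuity yields the last clause: near \<open>w\<close> the values of \<psi> exceed
  \<open>c\<close>, and far from \<open>w\<close> the distance term reaches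
  \<open>c\<close>.\<close>

lemma lipschitz_lower_approximation:
  fixes \<psi> :: "complex \<Rightarrow> ereal"
  assumes S: "S \<noteq> {}" and pos: "\<And>w. w \<in> S \<Longrightarrow> 0 \<le> \<psi> w"
    and lsc: "\<And>w c. w \<in> S \<Longrightarrow> ereal c < \<psi> w \<Longrightarrow> \<exists>d>0. \<forall>v\<in>S. dist w v < d \<longrightarrow> ereal c < \<psi> v"
  shows "\<exists>g :: nat \<Rightarrow> complex \<Rightarrow> real. (\<forall>n. continuous_on UNIV (g n)) \<and> (\<forall>n w. 0 \<le> g n w) \<and>
    (\<forall>n. \<forall>w\<in>S. ereal (g n w) \<le> \<psi> w) \<and>
    (\<forall>w\<in>S. \<forall>c. ereal c < \<psi> w \<longrightarrow> eventually (\<lambda>n. c \<le> g n w) sequentially)"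
proof -
  define m where "m n w = real_of_ereal (min (ereal (real n)) (\<psi> w))" for n w
  have m: "0 \<le> m n w" "ereal (m n w) = min (ereal (real n)) (\<psi> w)" if "w \<in> S" for n w
    using pos[OF that] unfolding m_def by (cases "\<psi> w"; auto simp: min_def)+
  define g where "g n w = (INF v\<in>S. m n v + real n * dist w v)" for n w
  have bdd: "bdd_below ((\<lambda>v. m n v + real n * dist w v) ` S)" for n w
    using m by (intro bdd_belowI2[of _ 0]) (auto intro!: add_nonneg_nonneg)
  have le: "g n w \<le> m n v + real n * dist w v" if "v \<in> S" for n v w
    unfolding g_def by (rule cINF_lower[OF bdd that])
  have ge: "c \<le> g n w" if "\<And>v. v \<in> S \<Longrightarrow> c \<le> m n v + real n * dist w v" for c n w
    unfolding g_def by (rule cINF_greatest[OF S that])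
  have tri: "g n w \<le> g n w' + real n * dist w w'" for n w w'
  proof -
    have "g n w - real n * dist w w' \<le> g n w'"
    proof (rule ge)
      fix v assume "v \<in> S"
      have "g n w \<le> m n v + real n * dist w v" by (rule le[OF \<open>v \<in> S\<close>])
      also have "real n * dist w v \<le> real n * (dist w w' + dist w' v)" by (intro mult_left_mono dist_triangle) auto
      finally show "g n w - real n * dist w w' \<le> m n v + real n * dist w' v" by (simp add: algebra_simps)
    qed
    then show ?thesis by simp
  qed
  show ?thesis
  proof (intro exI[of _ g] conjI allI ballI impI)
    show "continuous_on UNIV (g n)" for n
    proof (rule lipschitz_on_continuous_on)
      show "(real n)-lipschitz_on UNIV (g n)"
      proof (rule lipschitz_onI)
        fix w w' show "dist (g n w) (g n w') \<le> real n * dist w w'"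
          using tri[of n w w'] tri[of n w' w] by (simp add: dist_real_def dist_commute abs_le_iff)
      qed simp
    qed
    show "0 \<le> g n w" for n w by (rule ge) (use m in \<open>auto intro!: add_nonneg_nonneg\<close>)
    show "ereal (g n w) \<le> \<psi> w" if "w \<in> S" for n w
    proof -
      have "ereal (g n w) \<le> ereal (m n w)" using le[OF that, of n w] by simp
      also have "\<dots> \<le> \<psi> w" using m(2)[OF that] by simp
      finally show ?thesis .
    qed
    show "eventually (\<lambda>n. c \<le> g n w) sequentially" if w: "w \<in> S" "ereal c < \<psi> w" for w c
    proof -
      obtain d where d: "d > 0" "\<And>v. v \<in> S \<Longrightarrow> dist w v < d \<Longrightarrow> ereal c < \<psi> v" using lsc[OF w] by blast
      \<comment> \<open>\<open>N \<ge> c\<close> keeps the truncation from interfering near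
        \<open>w\<close>; \<open>N \<ge> c / d\<close> makes the distance term at least
        \<open>c\<close> from distance \<open>d\<close> on.\<close>
      obtain N where N: "max c (c / d) \<le> real N" using real_arch_simple by blast
      show ?thesis unfolding eventually_sequentially
      proof (intro exI allI impI)
        fix n assume "N \<le> n"
        then have n: "c \<le> real n" "c / d \<le> real n" using N by auto
        show "c \<le> g n w"
        proof (rule ge)
          fix v assume v: "v \<in> S"
          show "c \<le> m n v + real n * dist w v"
          proof (cases "dist w v < d")
            case True
            then have "ereal c < \<psi> v" using d v by auto
            then have "ereal c \<le> ereal (m n v)" using n m(2)[OF v] by auto
            then have "c \<le> m n v" by simp
            then show ?thesis by (simp add: add_increasing2)
          next
            case False
            have "c \<le> real n * d" using n(2) d(1) by (simp add: divide_le_eq)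
            also have "\<dots> \<le> real n * dist w v" using False by (intro mult_left_mono) auto
            finally show ?thesis using m(1)[OF v, of n] by linarith
          qed
        qed
      qed
    qed
  qed
qed

text \<open>\<open>M - \<phi>\<close> is nonnegative and lower semicontinuous on the circle, so its
  integral makes sense before \<phi> is known to be integrable. The inequality for continuous
  minorants passes to it by Fatou's lemma.\<close>

lemma subharmonic_circle_nn_integral:
  assumes sub: "subharmonic \<phi>" and M: "\<And>w. w \<in> cball z (cmod x) \<Longrightarrow> \<phi> w \<le> ereal M"
  shows "(\<integral>\<^sup>+t\<in>{0..2*pi}. e2ennreal (ereal M - \<phi> (z + cis t * x)) \<partial>lborel) \<le> ennreal (2 * pi) * e2ennreal (ereal M - \<phi> z)"
proof (cases "x = 0")
  case True
  then show ?thesis by (simp add: nn_integral_cmult_indicator mult.commute)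
next
  case x: False
  have usc: "usc_ereal \<phi>" using sub by (simp add: subharmonic_def)
  let ?S = "sphere z (cmod x)"
  have sph: "z + cis t * x \<in> ?S" for t by (simp add: dist_norm norm_mult)
  have p1: "?S \<noteq> {}" using sph by blast
  have p2: "0 \<le> ereal M - \<phi> w" if "w \<in> ?S" for w using M[of w] that by (auto simp: ereal_diff_positive)
  have p3: "\<exists>d>0. \<forall>v\<in>?S. dist w v < d \<longrightarrow> ereal c < ereal M - \<phi> v" if w: "w \<in> ?S" "ereal c < ereal M - \<phi> w" for w c
  proof -
    have "\<phi> w < ereal (M - c)" using w(2) by (cases "\<phi> w") auto
    then obtain d where "d > 0" "ball w d \<subseteq> {v. \<phi> v < ereal (M - c)}"
      using usc_ereal_open_less[OF usc, of "ereal (M - c)"] by (metis (no_types, lifting) mem_Collect_eq openE)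
    moreover have "ereal c < ereal M - \<phi> v" if "\<phi> v < ereal (M - c)" for v using that by (cases "\<phi> v") auto
    ultimately show ?thesis by (intro exI[of _ d]) (auto simp: subset_eq)
  qed
  obtain g :: "nat \<Rightarrow> complex \<Rightarrow> real" where g: "\<And>n. continuous_on UNIV (g n)" "\<And>n w. 0 \<le> g n w"
    "\<And>n w. w \<in> ?S \<Longrightarrow> ereal (g n w) \<le> ereal M - \<phi> w"
    "\<And>w c. w \<in> ?S \<Longrightarrow> ereal c < ereal M - \<phi> w \<Longrightarrow> eventually (\<lambda>n. c \<le> g n w) sequentially"
    using lipschitz_lower_approximation[OF p1 p2 p3] by blast
  have cg: "continuous_on A (\<lambda>t. g n (z + cis t * x))" for A n
    by (rule continuous_on_compose2[OF g(1)]) (auto intro!: continuous_intros)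
  have bound: "(\<integral>\<^sup>+t\<in>{0..2*pi}. ennreal (g n (z + cis t * x)) \<partial>lborel) \<le> ennreal (2 * pi) * e2ennreal (ereal M - \<phi> z)" for n
  proof -
    obtain I where I: "((\<lambda>t. g n (z + cis t * x)) has_integral I) {0..2*pi}"
      using integrable_continuous_real[OF cg] by blast
    have "((\<lambda>t. M - g n (z + cis t * x)) has_integral 2 * pi * (M - I / (2 * pi))) {0..2*pi}"
      using has_integral_diff[OF has_integral_const_real[of M 0 "2*pi"] I] by (simp add: algebra_simps)
    then have "\<phi> z \<le> ereal (M - I / (2 * pi))"
    proof (rule subharmonic_le_continuous_circle_mean[OF sub x, rotated 2])
      show "continuous_on ?S (\<lambda>w. M - g n w)" using g(1) by (intro continuous_intros) (auto intro: continuous_on_subset)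
      show "\<phi> w \<le> ereal (M - g n w)" if "w \<in> ?S" for w using g(3)[OF that, of n] by (cases "\<phi> w") auto
    qed
    then have le: "ereal (I / (2 * pi)) \<le> ereal M - \<phi> z" by (cases "\<phi> z") auto
    have "(\<integral>\<^sup>+t\<in>{0..2*pi}. ennreal (g n (z + cis t * x)) \<partial>lborel) = ennreal I"
      by (rule nn_integral_Icc_has_integral[OF cg g(2) I])
    also have "\<dots> = ennreal (2 * pi) * e2ennreal (ereal (I / (2 * pi)))" by (simp add: ennreal_mult'[symmetric])
    also have "\<dots> \<le> ennreal (2 * pi) * e2ennreal (ereal M - \<phi> z)" using le by (intro mult_left_mono e2ennreal_mono) auto
    finally show ?thesis .
  qed
  have "(\<integral>\<^sup>+t\<in>{0..2*pi}. e2ennreal (ereal M - \<phi> (z + cis t * x)) \<partial>lborel)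
     \<le> (\<integral>\<^sup>+t. liminf (\<lambda>n. ennreal (g n (z + cis t * x)) * indicator {0..2*pi} t) \<partial>lborel)"
  proof (rule nn_integral_mono)
    fix t :: real
    let ?w = "z + cis t * x"
    have "e2ennreal (ereal M - \<phi> ?w) \<le> liminf (\<lambda>n. ennreal (g n ?w))"
      unfolding le_Liminf_iff
    proof (intro allI impI)
      fix y assume y: "y < e2ennreal (ereal M - \<phi> ?w)"
      then obtain y' where y': "y < y'" "y' < e2ennreal (ereal M - \<phi> ?w)" using dense by blast
      obtain c where c: "y' = ennreal c" "c \<ge> 0" using y'(2) by (cases y') (auto simp: top.not_eq_extremum)
      have "ereal c < ereal M - \<phi> ?w"
      proof (rule ccontr)
        assume "\<not> ?thesis"
        then have "e2ennreal (ereal M - \<phi> ?w) \<le> e2ennreal (ereal c)" by (intro e2ennreal_mono) auto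
        then show False using y' c by simp
      qed
      from g(4)[OF sph this] show "eventually (\<lambda>n. y < ennreal (g n ?w)) sequentially"
        by eventually_elim (use y' c in \<open>auto intro: order.strict_trans2 ennreal_leI\<close>)
    qed
    then show "e2ennreal (ereal M - \<phi> ?w) * indicator {0..2*pi} t \<le> liminf (\<lambda>n. ennreal (g n ?w) * indicator {0..2*pi} t)"
      by (auto simp: indicator_def)
  qed
  also have "\<dots> \<le> liminf (\<lambda>n. \<integral>\<^sup>+t. ennreal (g n (z + cis t * x)) * indicator {0..2*pi} t \<partial>lborel)"
  proof (rule nn_integral_liminf)
    fix n
    have "(\<lambda>t. g n (z + cis t * x)) \<in> borel_measurable borel"
      by (rule borel_measurable_continuous_onI[OF cg])
    then show "(\<lambda>t. ennreal (g n (z + cis t * x)) * indicator {0..2*pi} t) \<in> borel_measurable lborel" by measurable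
  qed
  also have "\<dots> \<le> liminf (\<lambda>n. ennreal (2 * pi) * e2ennreal (ereal M - \<phi> z))"
    by (rule Liminf_mono) (use bound in auto)
  also have "\<dots> = ennreal (2 * pi) * e2ennreal (ereal M - \<phi> z)" by (simp add: Liminf_const)
  finally show ?thesis .
qed

text \<open>Rotation invariance of the plane measure inserts an average over \<open>t\<close>; after
  Tonelli the inner integral is the circle integral at fixed \<open>x\<close>.\<close>

lemma subharmonic_disc_nn_integral:
  assumes sub: "subharmonic \<phi>" and M: "\<And>w. w \<in> cball z R \<Longrightarrow> \<phi> w \<le> ereal M" and R: "0 < R"
  shows "(\<integral>\<^sup>+x\<in>ball 0 R. e2ennreal (ereal M - \<phi> (z + x)) \<partial>lborel) \<le> ennreal (pi * R^2) * e2ennreal (ereal M - \<phi> z)"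
proof -
  have [measurable]: "\<phi> \<in> borel_measurable borel" using sub usc_ereal_borel by (auto simp: subharmonic_def)
  define F where "F x = e2ennreal (ereal M - \<phi> (z + x)) * indicator (ball 0 R) x" for x
  have Fm [measurable]: "F \<in> borel_measurable borel" unfolding F_def by measurable
  let ?I = "\<integral>\<^sup>+x. F x \<partial>lborel"
  have "ennreal (2 * pi) * ?I = (\<integral>\<^sup>+t\<in>{0..2*pi}. ?I \<partial>lborel)"
    by (simp add: nn_integral_cmult_indicator mult.commute)
  also have "\<dots> = (\<integral>\<^sup>+t. (\<integral>\<^sup>+x. F (cis t * x) * indicator {0..2*pi} t \<partial>lborel) \<partial>lborel)"
  proof (rule nn_integral_cong)
    fix t :: real
    have "(\<integral>\<^sup>+x. F (cis t * x) * indicator {0..2*pi} t \<partial>lborel) = (\<integral>\<^sup>+x. F (cis t * x) \<partial>lborel) * indicator {0..2*pi} t"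
      by (rule nn_integral_multc) measurable
    then show "?I * indicator {0..2*pi} t = (\<integral>\<^sup>+x. F (cis t * x) * indicator {0..2*pi} t \<partial>lborel)"
      using nn_integral_rotation[OF Fm, of "cis t"] by simp
  qed
  also have "\<dots> = (\<integral>\<^sup>+x. (\<integral>\<^sup>+t. F (cis t * x) * indicator {0..2*pi} t \<partial>lborel) \<partial>lborel)"
    by (rule lborel_pair.Fubini') measurable
  also have "\<dots> \<le> (\<integral>\<^sup>+x. ennreal (2 * pi) * e2ennreal (ereal M - \<phi> z) * indicator (ball (0::complex) R) x \<partial>lborel)"
  proof (rule nn_integral_mono)
    fix x :: complex
    show "(\<integral>\<^sup>+t. F (cis t * x) * indicator {0..2*pi} t \<partial>lborel) \<le> ennreal (2 * pi) * e2ennreal (ereal M - \<phi> z) * indicator (ball 0 R) x"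
    proof (cases "cmod x < R")
      case True
      have "(\<integral>\<^sup>+t. F (cis t * x) * indicator {0..2*pi} t \<partial>lborel) = (\<integral>\<^sup>+t\<in>{0..2*pi}. e2ennreal (ereal M - \<phi> (z + cis t * x)) \<partial>lborel)"
        using True unfolding F_def by (intro nn_integral_cong) (simp add: norm_mult)
      also have "\<dots> \<le> ennreal (2 * pi) * e2ennreal (ereal M - \<phi> z)"
        by (rule subharmonic_circle_nn_integral[OF sub]) (use M True in auto)
      finally show ?thesis using True by simp
    next
      case False
      then show ?thesis unfolding F_def by (simp add: norm_mult)
    qed
  qed
  also have "\<dots> = ennreal (2 * pi) * e2ennreal (ereal M - \<phi> z) * emeasure lborel (ball (0::complex) R)"
    by (rule nn_integral_cmult_indicator) simp
  also have "emeasure lborel (ball (0::complex) R) = ennreal (pi * R^2)"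
    using R by (simp add: emeasure_ball unit_ball_vol_2)
  finally have "ennreal (2 * pi) * ?I \<le> ennreal (2 * pi) * (ennreal (pi * R^2) * e2ennreal (ereal M - \<phi> z))"
    by (simp add: ac_simps)
  then have "?I \<le> ennreal (pi * R^2) * e2ennreal (ereal M - \<phi> z)"
    by (subst (asm) ennreal_mult_le_mult_iff) auto
  then show ?thesis unfolding F_def .
qed

section \<open>Convolution with compactly supported kernels\<close>

text \<open>Written with \<open>w + z\<close>, this is a correlation, the convolution with the
  reflected kernel. Such operators commute for all kernels of the class below; evenness matters when
  two of them are merged into one kernel, in \<open>conv_assoc\<close>.\<close>

definition conv :: "(complex \<Rightarrow> real) \<Rightarrow> (complex \<Rightarrow> real) \<Rightarrow> complex \<Rightarrow> real" where
  "conv k f w = (\<integral>z. k z * f (w + z) \<partial>lborel)"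

text \<open>Integrability rather than boundedness, since \<open>green_kernel\<close> has a
  logarithmic pole. The bounded support lets \<open>f\<close> be an arbitrary continuous
  function.\<close>

definition kernel :: "real \<Rightarrow> (complex \<Rightarrow> real) \<Rightarrow> bool" where
  "kernel R k \<longleftrightarrow> k \<in> borel_measurable borel \<and> (\<forall>z. 0 \<le> k z) \<and> integrable lborel k \<and> (\<forall>z. R < cmod z \<longrightarrow> k z = 0)"

lemma kernelD:
  assumes "kernel R k"
  shows "k \<in> borel_measurable borel" "0 \<le> k z" "integrable lborel k" "R < cmod z \<Longrightarrow> k z = 0"
  using assms by (auto simp: kernel_def)

lemma continuous_bounded_near:
  fixes f :: "complex \<Rightarrow> real"
  assumes "continuous_on UNIV f"
  obtains B where "0 \<le> B" "\<And>z. cmod z \<le> R \<Longrightarrow> \<bar>f (w + z)\<bar> \<le> B"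
proof -
  have "compact (f ` cball w R)" by (intro compact_continuous_image continuous_on_subset[OF assms]) auto
  then obtain B where B: "\<And>u. u \<in> cball w R \<Longrightarrow> \<bar>f u\<bar> \<le> B" using compact_imp_bounded[THEN bounded_iff[THEN iffD1]] by fastforce
  show ?thesis
  proof (rule that[of "max 0 B"])
    fix z assume "cmod z \<le> R"
    then have "w + z \<in> cball w R" by (simp add: dist_norm)
    from B[OF this] show "\<bar>f (w + z)\<bar> \<le> max 0 B" by simp
  qed simp
qed

lemma continuous_borel: "continuous_on UNIV (f :: complex \<Rightarrow> real) \<Longrightarrow> f \<in> borel_measurable borel"
  by (rule borel_measurable_continuous_onI)

lemma conv_integrable:
  assumes k: "kernel R k" and f: "continuous_on UNIV f"
  shows "integrable lborel (\<lambda>z. k z * f (w + z))"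
proof -
  note [measurable] = kernelD(1)[OF k] continuous_borel[OF f]
  obtain B where B: "0 \<le> B" "\<And>z. cmod z \<le> R \<Longrightarrow> \<bar>f (w + z)\<bar> \<le> B" using continuous_bounded_near[OF f] by blast
  have "norm (k z * f (w + z)) \<le> norm (k z * B)" for z
    using B(1) B(2)[of z] kernelD(2,4)[OF k, of z] by (cases "cmod z \<le> R") (auto simp: abs_mult intro!: mult_left_mono)
  then show ?thesis
    by (intro Bochner_Integration.integrable_bound[OF integrable_mult_left[OF kernelD(3)[OF k], of B]]) auto
qed

lemma conv_continuous:
  assumes k: "kernel R k" and f: "continuous_on UNIV f"
  shows "continuous_on UNIV (conv k f)"
proof (rule continuous_at_imp_continuous_on, intro ballI)
  fix w :: complex
  note [measurable] = kernelD(1)[OF k] continuous_borel[OF f]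
  show "isCont (conv k f) w"
    unfolding continuous_at_sequentially o_def
  proof (intro allI impI)
    fix u assume u: "u \<longlonglongrightarrow> w"
    obtain K where K: "\<And>n. cmod (u n - w) \<le> K"
      using LIM_zero[OF u] convergent_imp_Bseq[of "\<lambda>n. u n - w"] by (metis Bseq_def convergent_def)
    obtain B where B: "0 \<le> B" "\<And>z. cmod z \<le> K + R \<Longrightarrow> \<bar>f (w + z)\<bar> \<le> B" using continuous_bounded_near[OF f] by blast
    show "(\<lambda>n. conv k f (u n)) \<longlonglongrightarrow> conv k f w" unfolding conv_def
    proof (rule integral_dominated_convergence[where w="\<lambda>z. k z * B"])
      show "integrable lborel (\<lambda>z. k z * B)" using kernelD(3)[OF k] by simp
      show "AE z in lborel. (\<lambda>n. k z * f (u n + z)) \<longlonglongrightarrow> k z * f (w + z)"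
      proof (rule AE_I2)
        fix z
        have "isCont f (w + z)" using f by (simp add: continuous_on_eq_continuous_at)
        moreover have "(\<lambda>n. u n + z) \<longlonglongrightarrow> w + z" by (intro tendsto_intros u)
        ultimately have "(\<lambda>n. f (u n + z)) \<longlonglongrightarrow> f (w + z)" by (rule isCont_tendsto_compose)
        then show "(\<lambda>n. k z * f (u n + z)) \<longlonglongrightarrow> k z * f (w + z)" by (intro tendsto_intros)
      qed
      show "AE z in lborel. norm (k z * f (u n + z)) \<le> k z * B" for n
      proof (rule AE_I2)
        fix z
        show "norm (k z * f (u n + z)) \<le> k z * B"
        proof (cases "cmod z \<le> R")
          case True
          have "cmod ((u n - w) + z) \<le> K + R" by (rule norm_triangle_le) (use K[of n] True in auto)
          then have "\<bar>f (u n + z)\<bar> \<le> B" using B(2)[of "(u n - w) + z"] by (simp add: algebra_simps)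
          then show ?thesis using kernelD(2)[OF k, of z] by (simp add: abs_mult mult_left_mono)
        qed (use kernelD(4)[OF k, of z] in auto)
      qed
    qed measurable
  qed
qed

lemma conv_const: "conv k (\<lambda>_. c) w = c * (\<integral>z. k z \<partial>lborel)"
  unfolding conv_def by simp

lemma conv_diff:
  assumes "kernel R k" "continuous_on UNIV f" "continuous_on UNIV g"
  shows "conv k (\<lambda>w. f w - g w) w = conv k f w - conv k g w"
  unfolding conv_def right_diff_distrib
  by (rule Bochner_Integration.integral_diff) (use assms conv_integrable in auto)

lemma conv_divide: "conv k (\<lambda>w. f w / c) w = conv k f w / c"
  unfolding conv_def by simp

lemma conv_mono:
  assumes k: "kernel R k" and "continuous_on UNIV f" "continuous_on UNIV g"
    and le: "\<And>z. cmod z \<le> R \<Longrightarrow> f (w + z) \<le> g (w + z)"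
  shows "conv k f w \<le> conv k g w"
  unfolding conv_def
proof (rule integral_mono)
  fix z
  show "k z * f (w + z) \<le> k z * g (w + z)"
    using le[of z] kernelD(2,4)[OF k, of z] by (cases "cmod z \<le> R") (auto intro!: mult_left_mono)
qed (use assms conv_integrable in auto)

text \<open>Fubini, with hypotheses wide enough for two uses: continuous \<open>f\<close> with
  general kernels, and locally integrable \<open>f\<close> with disc kernels.\<close>

lemma conv_commute_aux:
  fixes k l f :: "complex \<Rightarrow> real"
  assumes [measurable]: "k \<in> borel_measurable borel" "l \<in> borel_measurable borel" "f \<in> borel_measurable borel"
    and k0: "\<And>z. 0 \<le> k z" and l0: "\<And>z. 0 \<le> l z" and l: "integrable lborel l"
    and int: "\<And>x. l x \<noteq> 0 \<Longrightarrow> integrable lborel (\<lambda>z. k z * f (w + z + x))"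
    and B: "\<And>x. l x \<noteq> 0 \<Longrightarrow> (\<integral>z. k z * \<bar>f (w + z + x)\<bar> \<partial>lborel) \<le> B"
  shows "conv k (conv l f) w = conv l (conv k f) w"
proof -
  have "integrable (lborel \<Otimes>\<^sub>M lborel) (\<lambda>(x, z). l x * (k z * f (w + z + x)))"
  proof (rule lborel_pair.Fubini_integrable)
    have meas: "(\<lambda>x. \<integral>z. norm (l x * (k z * f (w + z + x))) \<partial>lborel) \<in> borel_measurable lborel"
      by measurable
    show "integrable lborel (\<lambda>x. \<integral>z. norm (case (x, z) of (x, z) \<Rightarrow> l x * (k z * f (w + z + x))) \<partial>lborel)"
    proof (rule Bochner_Integration.integrable_bound[OF integrable_mult_left[OF l, of B]])
      show "AE x in lborel. norm (\<integral>z. norm (case (x, z) of (x, z) \<Rightarrow> l x * (k z * f (w + z + x))) \<partial>lborel) \<le> norm (l x * B)"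
      proof (rule AE_I2)
        fix x
        show "norm (\<integral>z. norm (case (x, z) of (x, z) \<Rightarrow> l x * (k z * f (w + z + x))) \<partial>lborel) \<le> norm (l x * B)"
        proof (cases "l x = 0")
          case False
          have eq: "(\<integral>z. norm (l x * (k z * f (w + z + x))) \<partial>lborel) = l x * (\<integral>z. k z * \<bar>f (w + z + x)\<bar> \<partial>lborel)"
            using k0 l0[of x] by (simp add: abs_mult)
          have nn: "0 \<le> (\<integral>z. k z * \<bar>f (w + z + x)\<bar> \<partial>lborel)" using k0 by (intro integral_nonneg_AE) auto
          then have "0 \<le> B" using B[OF False] by linarith
          then show ?thesis using nn B[OF False] l0[of x] unfolding prod.case eq by (simp add: abs_mult mult_left_mono)
        qed simp
      qed
    qed (use meas in simp)
    show "AE x in lborel. integrable lborel (\<lambda>z. case (x, z) of (x, z) \<Rightarrow> l x * (k z * f (w + z + x)))"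
    proof (rule AE_I2)
      fix x show "integrable lborel (\<lambda>z. case (x, z) of (x, z) \<Rightarrow> l x * (k z * f (w + z + x)))"
        using int[of x] by (cases "l x = 0") auto
    qed
  qed measurable
  then have "(\<integral>z. (\<integral>x. l x * (k z * f (w + z + x)) \<partial>lborel) \<partial>lborel) = (\<integral>x. (\<integral>z. l x * (k z * f (w + z + x)) \<partial>lborel) \<partial>lborel)"
    by (rule lborel_pair.Fubini_integral)
  moreover have "(\<integral>x. l x * (k z * f (w + z + x)) \<partial>lborel) = k z * (\<integral>x. l x * f (w + z + x) \<partial>lborel)" for z
    by (subst integral_mult_right_zero[symmetric]) (simp add: ac_simps)
  ultimately show ?thesis unfolding conv_def by (simp add: add.assoc add.commute[of _ "_::complex"] add.left_commute)
qed

lemma conv_commute: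
  assumes k: "kernel R k" and l: "kernel S l" and f: "continuous_on UNIV f"
  shows "conv k (conv l f) w = conv l (conv k f) w"
proof -
  obtain B where B: "0 \<le> B" "\<And>z. cmod z \<le> R + S \<Longrightarrow> \<bar>f (w + z)\<bar> \<le> B" using continuous_bounded_near[OF f] by blast
  have int: "integrable lborel (\<lambda>z. k z * f (w + z + x))" for x
    using conv_integrable[OF k f, of "w + x"] by (simp add: add.commute add.left_commute)
  have inta: "integrable lborel (\<lambda>z. k z * \<bar>f (w + z + x)\<bar>)" for x
    using integrable_abs[OF int[of x]] kernelD(2)[OF k] by (simp add: abs_mult)
  show ?thesis
  proof (rule conv_commute_aux[where B="B * (\<integral>z. k z \<partial>lborel)"])
    fix x assume "l x \<noteq> 0"
    then have x: "cmod x \<le> S" using kernelD(4)[OF l, of x] by force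
    have "(\<integral>z. k z * \<bar>f (w + z + x)\<bar> \<partial>lborel) \<le> (\<integral>z. k z * B \<partial>lborel)"
    proof (rule integral_mono[OF inta])
      fix z
      show "k z * \<bar>f (w + z + x)\<bar> \<le> k z * B"
      proof (cases "cmod z \<le> R")
        case True
        have "cmod (z + x) \<le> R + S" by (rule norm_triangle_le) (use True x in auto)
        then show ?thesis using B(2)[of "z + x"] kernelD(2)[OF k, of z] by (simp add: add.assoc mult_left_mono)
      qed (use kernelD(4)[OF k, of z] in auto)
    qed (use kernelD(3)[OF k] in simp)
    then show "(\<integral>z. k z * \<bar>f (w + z + x)\<bar> \<partial>lborel) \<le> B * (\<integral>z. k z \<partial>lborel)" by (simp add: mult.commute)
  qed (use kernelD[OF k] kernelD[OF l] continuous_borel[OF f] int in auto)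
qed

text \<open>Moves an operator from the function onto the kernel, by Fubini after the substitution
  \<open>y = x + z\<close>. Evenness of \<open>l\<close> identifies the resulting integral of
  \<open>l x * k (y - x)\<close> with \<open>conv l k y\<close>.\<close>

lemma conv_assoc:
  assumes k: "kernel R k" and l: "kernel S l" and f: "continuous_on UNIV f" and even: "\<And>x. l (- x) = l x"
  shows "conv l (conv k f) w = conv (conv l k) f w" "integrable lborel (\<lambda>z. conv l k z * f (w + z))"
proof -
  note [measurable] = kernelD(1)[OF k] kernelD(1)[OF l] continuous_borel[OF f]
  obtain B where B: "0 \<le> B" "\<And>z. cmod z \<le> R + S \<Longrightarrow> \<bar>f (w + z)\<bar> \<le> B" using continuous_bounded_near[OF f] by blast
  have intk: "integrable lborel (\<lambda>y. k (- x + y))" for x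
    using kernelD(3)[OF k] by (subst integrable_translation_iff) auto
  have bd: "norm (k (- x + y) * f (w + y)) \<le> k (- x + y) * B" if x: "cmod x \<le> S" for x y
  proof (cases "cmod (- x + y) \<le> R")
    case True
    have "cmod ((- x + y) + x) \<le> R + S" by (rule norm_triangle_le) (use True x in auto)
    then show ?thesis using B(2)[of y] kernelD(2)[OF k, of "-x + y"] by (simp add: abs_mult mult_left_mono)
  qed (use kernelD(4)[OF k, of "-x + y"] in auto)
  have int: "integrable lborel (\<lambda>y. k (- x + y) * f (w + y))" if "cmod x \<le> S" for x
    by (rule Bochner_Integration.integrable_bound[OF integrable_mult_left[OF intk[of x], of B]])
       (use order.trans[OF bd[OF that] abs_ge_self] in \<open>auto intro!: AE_I2\<close>)
  have prod: "integrable (lborel \<Otimes>\<^sub>M lborel) (\<lambda>(x, y). l x * (k (- x + y) * f (w + y)))"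
  proof (rule lborel_pair.Fubini_integrable)
    have meas: "(\<lambda>x. \<integral>y. norm (l x * (k (- x + y) * f (w + y))) \<partial>lborel) \<in> borel_measurable lborel"
      by measurable
    let ?K = "\<integral>y. k y \<partial>lborel"
    show "integrable lborel (\<lambda>x. \<integral>y. norm (case (x, y) of (x, y) \<Rightarrow> l x * (k (- x + y) * f (w + y))) \<partial>lborel)"
    proof (rule Bochner_Integration.integrable_bound[OF integrable_mult_left[OF kernelD(3)[OF l], of "?K * B"]])
      show "AE x in lborel. norm (\<integral>y. norm (case (x, y) of (x, y) \<Rightarrow> l x * (k (- x + y) * f (w + y))) \<partial>lborel) \<le> norm (l x * (?K * B))"
      proof (rule AE_I2)
        fix x
        show "norm (\<integral>y. norm (case (x, y) of (x, y) \<Rightarrow> l x * (k (- x + y) * f (w + y))) \<partial>lborel) \<le> norm (l x * (?K * B))"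
        proof (cases "l x = 0")
          case False
          then have x: "cmod x \<le> S" using kernelD(4)[OF l, of x] by force
          have eq: "(\<integral>y. norm (l x * (k (- x + y) * f (w + y))) \<partial>lborel) = l x * (\<integral>y. norm (k (- x + y) * f (w + y)) \<partial>lborel)"
            using kernelD(2)[OF l, of x] by (simp add: abs_mult)
          have nn: "0 \<le> (\<integral>y. norm (k (- x + y) * f (w + y)) \<partial>lborel)" by (intro integral_nonneg_AE) auto
          have "(\<integral>y. norm (k (- x + y) * f (w + y)) \<partial>lborel) \<le> (\<integral>y. k (- x + y) * B \<partial>lborel)"
            by (rule integral_mono) (use int[OF x] intk bd[OF x] in auto)
          also have "\<dots> = ?K * B" using integral_translation[of k "-x"] by simp
          finally have "l x * (\<integral>y. norm (k (- x + y) * f (w + y)) \<partial>lborel) \<le> l x * (?K * B)"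
            using kernelD(2)[OF l, of x] by (intro mult_left_mono)
          moreover have "0 \<le> l x * (\<integral>y. norm (k (- x + y) * f (w + y)) \<partial>lborel)"
            using nn kernelD(2)[OF l, of x] by (intro mult_nonneg_nonneg)
          ultimately show ?thesis unfolding prod.case eq by simp
        qed simp
      qed
    qed (use meas in simp)
    show "AE x in lborel. integrable lborel (\<lambda>y. case (x, y) of (x, y) \<Rightarrow> l x * (k (- x + y) * f (w + y)))"
    proof (rule AE_I2)
      fix x show "integrable lborel (\<lambda>y. case (x, y) of (x, y) \<Rightarrow> l x * (k (- x + y) * f (w + y)))"
        using int[of x] kernelD(4)[OF l, of x] by (cases "cmod x \<le> S") auto
    qed
  qed measurable
  have inner: "(\<integral>x. l x * (k (- x + y) * f (w + y)) \<partial>lborel) = conv l k y * f (w + y)" for y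
  proof -
    have "(\<integral>x. l x * (k (- x + y) * f (w + y)) \<partial>lborel) = (\<integral>x. l x * k (- x + y) \<partial>lborel) * f (w + y)"
      by (simp add: mult.assoc[symmetric])
    \<comment> \<open>The reflection \<open>x \<mapsto> - x\<close> is the rotation by -1.\<close>
    also have "(\<integral>x. l x * k (- x + y) \<partial>lborel) = (\<integral>x. l (-1 * x) * k (- (-1 * x) + y) \<partial>lborel)"
      by (rule integral_rotation[symmetric, where f="\<lambda>x. l x * k (- x + y)"]) auto
    also have "\<dots> = conv l k y" unfolding conv_def by (simp add: even add.commute)
    finally show ?thesis .
  qed
  have shift: "conv k f (w + x) = (\<integral>y. k (- x + y) * f (w + y) \<partial>lborel)" for x
  proof -
    have "(\<integral>z. k z * f (w + x + z) \<partial>lborel) = (\<integral>y. k (- x + y) * f (w + x + (- x + y)) \<partial>lborel)"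
      by (rule integral_translation[symmetric, where f="\<lambda>z. k z * f (w + x + z)"]) measurable
    then show ?thesis by (simp add: conv_def algebra_simps)
  qed
  have "conv l (conv k f) w = (\<integral>x. l x * (\<integral>y. k (- x + y) * f (w + y) \<partial>lborel) \<partial>lborel)"
    unfolding shift[symmetric] by (simp add: conv_def)
  also have "\<dots> = (\<integral>x. (\<integral>y. l x * (k (- x + y) * f (w + y)) \<partial>lborel) \<partial>lborel)" by simp
  also have "\<dots> = (\<integral>y. (\<integral>x. l x * (k (- x + y) * f (w + y)) \<partial>lborel) \<partial>lborel)"
    by (rule lborel_pair.Fubini_integral[symmetric]) (rule prod)
  also have "\<dots> = conv (conv l k) f w" unfolding inner by (simp add: conv_def)
  finally show "conv l (conv k f) w = conv (conv l k) f w" .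
  have "integrable lborel (\<lambda>y. \<integral>x. l x * (k (- x + y) * f (w + y)) \<partial>lborel)"
    using lborel_pair.integrable_snd[OF prod] by simp
  then show "integrable lborel (\<lambda>z. conv l k z * f (w + z))" unfolding inner .
qed

section \<open>Disc averages and the logarithmic kernel\<close>

definition disc_kernel :: "real \<Rightarrow> complex \<Rightarrow> real" where
  "disc_kernel r z = indicator (ball 0 r) z / (pi * r^2)"

text \<open>The mean, over the points \<open>x\<close> of the disc, of the Green function with pole
  0 of the disc of radius \<open>|x|\<close>. That this is \<open>L * a r - L\<close> away from 0 is
  shown in \<open>conv_disc_log\<close>; in this form its sign and support are evident.\<close>

definition green_kernel :: "real \<Rightarrow> complex \<Rightarrow> real" where
  "green_kernel r z = (\<integral>x. disc_kernel r x * max 0 (ln (cmod x / cmod z)) \<partial>lborel)"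

lemma disc_kernel_borel [measurable]: "disc_kernel r \<in> borel_measurable borel"
  unfolding disc_kernel_def[abs_def] by measurable

lemma disc_kernel_nonneg: "0 \<le> disc_kernel r z"
  by (simp add: disc_kernel_def)

lemma disc_kernel_minus: "disc_kernel r (- z) = disc_kernel r z"
  by (simp add: disc_kernel_def indicator_def)

lemma measure_ball_complex: "0 \<le> r \<Longrightarrow> measure lborel (ball (c::complex) r) = pi * r^2"
  by (simp add: content_ball unit_ball_vol_2)

lemma integrable_ball_indicator: "integrable lborel (indicator (ball (c::complex) r) :: complex \<Rightarrow> real)"
  by (intro integrable_real_indicator emeasure_bounded_finite bounded_ball) auto

lemma disc_kernel_integrable: "integrable lborel (disc_kernel r)"
  unfolding disc_kernel_def[abs_def] using integrable_ball_indicator by auto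

lemma disc_kernel_integral: "0 < r \<Longrightarrow> (\<integral>z. disc_kernel r z \<partial>lborel) = 1"
  unfolding disc_kernel_def[abs_def] using measure_ball_complex[of r 0] by simp

lemma kernel_disc: "kernel r (disc_kernel r)"
  unfolding kernel_def using disc_kernel_integrable disc_kernel_nonneg
  by (auto simp: disc_kernel_def)

lemma disc_kernel_scale:
  assumes "0 < r" and [measurable]: "F \<in> borel_measurable borel"
  shows "(\<integral>x. disc_kernel r x * F x \<partial>lborel) = (\<integral>x. disc_kernel 1 x * F (of_real r * x) \<partial>lborel)"
proof -
  have "(\<integral>x. disc_kernel r x * F x \<partial>lborel) = r^2 * (\<integral>x. disc_kernel r (of_real r * x) * F (of_real r * x) \<partial>lborel)"
    by (rule integral_scaling) (use assms in measurable)
  also have "\<dots> = (\<integral>x. r^2 * (disc_kernel r (of_real r * x) * F (of_real r * x)) \<partial>lborel)" by simp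
  also have "\<dots> = (\<integral>x. disc_kernel 1 x * F (of_real r * x) \<partial>lborel)"
    using assms(1) by (intro Bochner_Integration.integral_cong) (auto simp: disc_kernel_def indicator_def norm_mult)
  finally show ?thesis .
qed

lemma green_kernel_borel [measurable]: "green_kernel r \<in> borel_measurable borel"
  unfolding green_kernel_def[abs_def] by measurable

text \<open>After scaling, \<open>r\<close> occurs only in the logarithm, so monotonicity and
  convexity in \<open>ln r\<close> can be checked under the integral.\<close>

lemma green_kernel_scale:
  assumes "0 < r"
  shows "green_kernel r z = (\<integral>x. disc_kernel 1 x * max 0 (ln (r * cmod x / cmod z)) \<partial>lborel)"
  unfolding green_kernel_def using assms
  by (subst disc_kernel_scale) (auto simp: norm_mult)

lemma green_kernel_nonneg: "0 \<le> green_kernel r z"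
  unfolding green_kernel_def by (intro integral_nonneg_AE) (auto simp: disc_kernel_nonneg)

lemma green_integrand_le:
  assumes "0 < r"
  shows "disc_kernel 1 x * max 0 (ln (r * cmod x / cmod z)) \<le> disc_kernel 1 x * max 0 (ln (r / cmod z))"
proof (cases "cmod x < 1 \<and> x \<noteq> 0 \<and> z \<noteq> 0")
  case True
  then have "r * cmod x / cmod z \<le> r / cmod z" using assms by (intro divide_right_mono) (auto simp: mult_left_le)
  then have "ln (r * cmod x / cmod z) \<le> ln (r / cmod z)" using True assms by (subst ln_le_cancel_iff) auto
  then show ?thesis by (intro mult_left_mono disc_kernel_nonneg) auto
qed (auto simp: disc_kernel_def)

lemma green_integrand_integrable:
  assumes "0 < r"
  shows "integrable lborel (\<lambda>x. disc_kernel 1 x * max 0 (ln (r * cmod x / cmod z)))"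
proof (rule Bochner_Integration.integrable_bound)
  show "integrable lborel (\<lambda>x. disc_kernel 1 x * max 0 (ln (r / cmod z)))" using disc_kernel_integrable by simp
  show "AE x in lborel. norm (disc_kernel 1 x * max 0 (ln (r * cmod x / cmod z))) \<le> norm (disc_kernel 1 x * max 0 (ln (r / cmod z)))"
    using green_integrand_le[OF assms, of _ z] disc_kernel_nonneg by (auto intro!: AE_I2 simp: abs_mult)
qed measurable

lemma green_kernel_le:
  assumes "0 < r"
  shows "green_kernel r z \<le> max 0 (ln (r / cmod z))"
proof -
  have "green_kernel r z \<le> (\<integral>x. disc_kernel 1 x * max 0 (ln (r / cmod z)) \<partial>lborel)"
    unfolding green_kernel_scale[OF assms]
    by (rule integral_mono[OF green_integrand_integrable]) (use assms green_integrand_le disc_kernel_integrable in auto)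
  then show ?thesis using disc_kernel_integral[of 1] by simp
qed

lemma kernel_green:
  assumes "0 < r"
  shows "kernel r (green_kernel r)"
  unfolding kernel_def
proof (intro conjI allI impI)
  show "integrable lborel (green_kernel r)"
    by (rule Bochner_Integration.integrable_bound[OF integrable_log_plus[OF assms]])
       (use green_kernel_le[OF assms] green_kernel_nonneg in auto)
  fix z assume "r < cmod z"
  with assms have "0 < cmod z" "r \<le> cmod z" by linarith+
  with assms have "0 < r / cmod z" "r / cmod z \<le> 1" by simp_all
  then have "ln (r / cmod z) \<le> 0" by simp
  then show "green_kernel r z = 0" using green_kernel_le[OF assms, of z] green_kernel_nonneg[of r z] by simp
qed (auto simp: green_kernel_nonneg)

text \<open>Where \<open>|x| \<ge> d\<close>, both logarithms are nonnegative because
  \<open>|z| \<le> d * r\<close>, and they differ by exactly \<open>ln (s / r)\<close>. Such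
  \<open>x\<close> fill the share \<open>1 - d^2\<close> of the unit disc; on the rest monotonicity
  makes the difference nonnegative.\<close>

lemma green_kernel_diff_ge:
  assumes r: "0 < r" "r \<le> s" and d: "0 < d" "d \<le> 1" and z: "z \<noteq> 0" "cmod z \<le> d * r"
  shows "ln (s / r) * (1 - d^2) \<le> green_kernel s z - green_kernel r z"
proof -
  have s: "0 < s" using r by simp
  let ?h = "\<lambda>x. (disc_kernel 1 x - indicator (ball 0 d) x / pi) * ln (s / r)"
  have "ln (s / r) * (1 - d^2) = (\<integral>x. ?h x \<partial>lborel)"
  proof -
    have "(\<integral>x. ?h x \<partial>lborel) = (\<integral>x. disc_kernel 1 x - indicator (ball 0 d) x / pi \<partial>lborel) * ln (s / r)" by simp
    also have "(\<integral>x. disc_kernel 1 x - indicator (ball 0 d) x / pi \<partial>lborel) = 1 - d^2"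
      using disc_kernel_integral[of 1] measure_ball_complex[of d 0] d
      by (subst Bochner_Integration.integral_diff) (auto intro: disc_kernel_integrable integrable_ball_indicator)
    finally show ?thesis by (metis mult.commute)
  qed
  also have "\<dots> \<le> (\<integral>x. disc_kernel 1 x * max 0 (ln (s * cmod x / cmod z)) - disc_kernel 1 x * max 0 (ln (r * cmod x / cmod z)) \<partial>lborel)"
  proof (rule integral_mono)
    show "integrable lborel ?h"
      using disc_kernel_integrable integrable_ball_indicator by (intro integrable_mult_left Bochner_Integration.integrable_diff integrable_divide)
    show "integrable lborel (\<lambda>x. disc_kernel 1 x * max 0 (ln (s * cmod x / cmod z)) - disc_kernel 1 x * max 0 (ln (r * cmod x / cmod z)))"
      by (intro Bochner_Integration.integrable_diff green_integrand_integrable r s)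
    fix x :: complex
    have mono: "max 0 (ln (r * cmod x / cmod z)) \<le> max 0 (ln (s * cmod x / cmod z))"
    proof (cases "x = 0")
      case False
      have "r * cmod x / cmod z \<le> s * cmod x / cmod z" using r by (intro divide_right_mono mult_right_mono) auto
      then have "ln (r * cmod x / cmod z) \<le> ln (s * cmod x / cmod z)" using False r s z by (subst ln_le_cancel_iff) auto
      then show ?thesis by auto
    qed simp
    show "?h x \<le> disc_kernel 1 x * max 0 (ln (s * cmod x / cmod z)) - disc_kernel 1 x * max 0 (ln (r * cmod x / cmod z))"
    proof (cases "cmod x < d")
      case True
      then have "?h x = 0" using d by (simp add: disc_kernel_def)
      then show ?thesis using mult_left_mono[OF mono disc_kernel_nonneg[of 1 x]] by linarith
    next
      case False
      then have x0: "x \<noteq> 0" using d by auto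
      have "cmod z \<le> r * cmod x" using z(2) False r by (smt (verit) mult.commute mult_left_mono)
      then have ge: "1 \<le> r * cmod x / cmod z" using z(1) by (simp add: le_divide_eq)
      have "s * cmod x / cmod z = (s / r) * (r * cmod x / cmod z)" using r by simp
      then have "ln (s * cmod x / cmod z) = ln (s / r) + ln (r * cmod x / cmod z)"
        using r s x0 z(1) by (simp add: ln_mult ln_div)
      moreover have "0 \<le> ln (r * cmod x / cmod z)" using ge by simp
      moreover have "0 \<le> ln (s / r)" using r s by simp
      ultimately show ?thesis using False by (simp add: algebra_simps)
    qed
  qed
  also have "\<dots> = green_kernel s z - green_kernel r z"
    unfolding green_kernel_scale[OF r(1)] green_kernel_scale[OF s]
    by (rule Bochner_Integration.integral_diff) (intro green_integrand_integrable r s)+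
  finally show ?thesis .
qed

lemma green_kernel_integral_pos:
  assumes "0 < r"
  shows "0 < (\<integral>z. green_kernel r z \<partial>lborel)"
proof -
  \<comment> \<open>The bound of \<open>green_kernel_diff_ge\<close> for the radii
    \<open>r / 2\<close> and \<open>r\<close> with \<open>d = 1/2\<close>; it holds on the ball of
    radius \<open>d * (r / 2) = r / 4\<close>.\<close>
  let ?c = "ln 2 * (1 - (1/2)^2) :: real"
  have "0 < ?c * (pi * (r/4)^2)" using assms by (simp add: power2_eq_square)
  also have "\<dots> = (\<integral>z. ?c * indicator (ball 0 (r/4)) (z::complex) \<partial>lborel)"
    using measure_ball_complex[of "r/4" 0] assms by simp
  also have "\<dots> \<le> (\<integral>z. green_kernel r z \<partial>lborel)"
  proof (rule integral_mono_AE)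
    show "integrable lborel (\<lambda>z. ?c * indicator (ball 0 (r/4)) (z::complex))" using integrable_ball_indicator by simp
    show "integrable lborel (green_kernel r)" using kernel_green[OF assms] by (simp add: kernel_def)
    have "AE z in lborel. z \<noteq> (0::complex)" by (rule AE_lborel_singleton)
    then show "AE z in lborel. ?c * indicator (ball 0 (r/4)) z \<le> green_kernel r z"
    proof eventually_elim
      case (elim z)
      show ?case
      proof (cases "cmod z < r/4")
        case True
        have "ln (r / (r/2)) * (1 - (1/2)^2) \<le> green_kernel r z - green_kernel (r/2) z"
          by (rule green_kernel_diff_ge) (use assms True elim in auto)
        then show ?thesis using green_kernel_nonneg[of "r/2" z] True assms by simp
      qed (use green_kernel_nonneg in auto)
    qed
  qed
  finally show ?thesis .
qed

text \<open>Under the integral stands \<open>max 0 (ln r + c)\<close>, a convex function of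
  \<open>ln r\<close>.\<close>

lemma green_kernel_log_convex:
  assumes t: "0 \<le> t" "t \<le> 1" and z: "z \<noteq> 0"
  shows "green_kernel (exp ((1 - t) * x + t * y)) z \<le> (1 - t) * green_kernel (exp x) z + t * green_kernel (exp y) z"
proof -
  let ?F = "\<lambda>s u. disc_kernel 1 u * max 0 (ln (exp s * cmod u / cmod z))"
  have "green_kernel (exp ((1 - t) * x + t * y)) z = (\<integral>u. ?F ((1 - t) * x + t * y) u \<partial>lborel)"
    by (rule green_kernel_scale) simp
  also have "\<dots> \<le> (\<integral>u. (1 - t) * ?F x u + t * ?F y u \<partial>lborel)"
  proof (rule integral_mono)
    show "integrable lborel (?F ((1 - t) * x + t * y))" by (rule green_integrand_integrable) simp
    show "integrable lborel (\<lambda>u. (1 - t) * ?F x u + t * ?F y u)"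
      by (intro Bochner_Integration.integrable_add integrable_mult_right green_integrand_integrable) auto
    fix u
    show "?F ((1 - t) * x + t * y) u \<le> (1 - t) * ?F x u + t * ?F y u"
    proof (cases "u = 0")
      case False
      define c where "c = ln (cmod u / cmod z)"
      have ln: "ln (exp s * cmod u / cmod z) = s + c" for s
        using False z unfolding c_def by (simp add: ln_mult ln_div)
      have "max 0 (((1 - t) * x + t * y) + c) \<le> (1 - t) * max 0 (x + c) + t * max 0 (y + c)"
      proof -
        have 1: "(1 - t) * (x + c) \<le> (1 - t) * max 0 (x + c)" "t * (y + c) \<le> t * max 0 (y + c)" using t by (auto intro!: mult_left_mono)
        have 2: "0 \<le> (1 - t) * max 0 (x + c)" "0 \<le> t * max 0 (y + c)" using t by auto
        have "((1 - t) * x + t * y) + c = (1 - t) * (x + c) + t * (y + c)" by (simp add: algebra_simps)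
        then show ?thesis using 1 2 by simp
      qed
      from mult_left_mono[OF this disc_kernel_nonneg[of 1 u]] show ?thesis unfolding ln by (simp add: algebra_simps)
    qed simp
  qed
  also have "\<dots> = (1 - t) * green_kernel (exp x) z + t * green_kernel (exp y) z"
    unfolding green_kernel_scale[OF exp_gt_zero]
    by (subst Bochner_Integration.integral_add) (auto intro!: integrable_mult_right green_integrand_integrable)
  finally show ?thesis .
qed

lemma green_kernel_mono:
  assumes "0 < r" "r \<le> s" "z \<noteq> 0"
  shows "green_kernel r z \<le> green_kernel s z"
  unfolding green_kernel_scale[OF \<open>0 < r\<close>] green_kernel_scale[OF order.strict_trans2[OF \<open>0 < r\<close> \<open>r \<le> s\<close>]]
proof (rule integral_mono)
  fix x :: complex
  show "disc_kernel 1 x * max 0 (ln (r * cmod x / cmod z)) \<le> disc_kernel 1 x * max 0 (ln (s * cmod x / cmod z))"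
  proof (cases "x = 0")
    case False
    have "r * cmod x / cmod z \<le> s * cmod x / cmod z" using assms by (intro divide_right_mono mult_right_mono) auto
    then have "ln (r * cmod x / cmod z) \<le> ln (s * cmod x / cmod z)" using False assms by (subst ln_le_cancel_iff) auto
    then show ?thesis by (intro mult_left_mono disc_kernel_nonneg) auto
  qed simp
qed (use assms in \<open>auto intro!: green_integrand_integrable\<close>)

lemma log_norm_locally_integrable:
  assumes "0 < R"
  shows "integrable lborel (\<lambda>z. indicator (ball 0 R) z * ln (cmod z))"
proof (rule Bochner_Integration.integrable_bound)
  show "integrable lborel (\<lambda>z. max 0 (ln (R / cmod z)) + \<bar>ln R\<bar> * indicator (ball (0::complex) R) z)"
    using integrable_log_plus[OF assms] integrable_ball_indicator by (intro Bochner_Integration.integrable_add integrable_mult_right)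
  show "AE z in lborel. norm (indicator (ball 0 R) z * ln (cmod z)) \<le> norm (max 0 (ln (R / cmod z)) + \<bar>ln R\<bar> * indicator (ball 0 R) z)"
    using AE_lborel_singleton[of "0::complex"]
  proof eventually_elim
    case (elim z)
    have "ln (cmod z) \<le> ln R" if "cmod z < R" using that elim assms by (subst ln_le_cancel_iff) auto
    then have "\<bar>ln (cmod z)\<bar> \<le> ln R - ln (cmod z) + \<bar>ln R\<bar>" if "cmod z < R" using that by fastforce
    then show ?case using assms elim by (auto simp: indicator_def ln_div)
  qed
qed measurable

text \<open>By rotation invariance, averaging \<open>ln |w + x|\<close> over a disc amounts to averaging it over circles first.\<close>
lemma conv_disc_log:
  assumes r: "0 < r" and w: "w \<noteq> 0"
  shows "integrable lborel (\<lambda>x. disc_kernel r x * ln (cmod (w + x)))"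
    and "conv (disc_kernel r) (\<lambda>z. ln (cmod z)) w = ln (cmod w) + green_kernel r w"
proof -
  define F where "F x = disc_kernel r x * ln (cmod (w + x))" for x
  have Fm [measurable]: "F \<in> borel_measurable borel" unfolding F_def by measurable
  have "integrable lborel (\<lambda>x. indicator (ball 0 (cmod w + r)) (w + x) * ln (cmod (w + x)))"
    using log_norm_locally_integrable[of "cmod w + r"] r by (subst integrable_translation_iff) (auto simp: add_nonneg_pos)
  then have "integrable lborel (\<lambda>x. disc_kernel r x * (indicator (ball 0 (cmod w + r)) (w + x) * ln (cmod (w + x))))"
    by (rule Bochner_Integration.integrable_bound[OF integrable_mult_right[where c="1 / (pi * r^2)"]])
       (use r in \<open>auto intro!: AE_I2 simp: disc_kernel_def indicator_def\<close>)
  also have "(\<lambda>x. disc_kernel r x * (indicator (ball 0 (cmod w + r)) (w + x) * ln (cmod (w + x)))) = F"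
  proof
    fix x
    have "w + x \<in> ball 0 (cmod w + r)" if "cmod x < r" using that norm_triangle_ineq[of w x] by simp
    then show "disc_kernel r x * (indicator (ball 0 (cmod w + r)) (w + x) * ln (cmod (w + x))) = F x"
      unfolding F_def disc_kernel_def by (auto simp: indicator_def)
  qed
  finally have Fi: "integrable lborel F" .
  then show "integrable lborel (\<lambda>x. disc_kernel r x * ln (cmod (w + x)))" unfolding F_def .
  let ?J = "indicator {0..2*pi} :: real \<Rightarrow> real"
  have Jint: "integrable lborel ?J" by (intro integrable_real_indicator) auto
  have rotF: "integrable lborel (\<lambda>x. F (cis t * x))" for t
  proof -
    have "integrable (distr lborel borel (\<lambda>x. cis t * x)) F" using Fi by (simp add: lborel_distr_rotation)
    then show ?thesis by (subst (asm) integrable_distr_eq) auto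
  qed
  have prod: "integrable (lborel \<Otimes>\<^sub>M lborel) (\<lambda>(t, x). ?J t * F (cis t * x))"
  proof (rule lborel_pair.Fubini_integrable)
    have "(\<integral>x. norm (?J t * F (cis t * x)) \<partial>lborel) = ?J t * (\<integral>x. \<bar>F x\<bar> \<partial>lborel)" for t
      using integral_rotation[of "\<lambda>x. \<bar>F x\<bar>" "cis t"] by (simp add: abs_mult)
    then show "integrable lborel (\<lambda>t. \<integral>x. norm (case (t, x) of (t, x) \<Rightarrow> ?J t * F (cis t * x)) \<partial>lborel)"
      using Jint by simp
    show "AE t in lborel. integrable lborel (\<lambda>x. case (t, x) of (t, x) \<Rightarrow> ?J t * F (cis t * x))"
      using rotF by (auto intro!: AE_I2)
  qed measurable
  have "2 * pi * (\<integral>x. F x \<partial>lborel) = (\<integral>t. ?J t * (\<integral>x. F x \<partial>lborel) \<partial>lborel)" by simp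
  also have "\<dots> = (\<integral>t. (\<integral>x. ?J t * F (cis t * x) \<partial>lborel) \<partial>lborel)"
    using integral_rotation[OF Fm] by simp
  also have "\<dots> = (\<integral>x. (\<integral>t. ?J t * F (cis t * x) \<partial>lborel) \<partial>lborel)"
    by (rule lborel_pair.Fubini_integral[symmetric]) (rule prod)
  also have "\<dots> = (\<integral>x. 2 * pi * (disc_kernel r x * (ln (cmod w) + max 0 (ln (cmod x / cmod w)))) \<partial>lborel)"
  proof (rule integral_cong_AE)
    \<comment> \<open>The circle formula for the logarithm is stated for different moduli; the
      circle \<open>|x| = |w|\<close> that it leaves out is a null set.\<close>
    have "AE x in lborel. x \<notin> sphere (0::complex) (cmod w)"
      using negligible_sphere[of "0::complex" "cmod w"] 
      by (intro AE_not_in) (simp add: negligible_iff_null_sets null_sets_completion_iff)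
    moreover have "AE x in lborel. x \<noteq> (0::complex)" by (rule AE_lborel_singleton)
    ultimately show "AE x in lborel. (\<integral>t. ?J t * F (cis t * x) \<partial>lborel) = 2 * pi * (disc_kernel r x * (ln (cmod w) + max 0 (ln (cmod x / cmod w))))"
    proof eventually_elim
      case (elim x)
      then have ne: "cmod w \<noteq> cmod (- x)" "x \<noteq> 0" by auto
      have hi: "((\<lambda>t. ln (cmod (w - cis t * (- x)))) has_integral 2 * pi * ln (max (cmod w) (cmod (-x)))) {0..2*pi}"
        by (rule has_integral_circle_log[OF ne(1)])
      have nz: "w - cis t * (- x) \<noteq> 0" for t
      proof
        assume "w - cis t * (- x) = 0"
        then have "cmod w = cmod (cis t * (- x))" by (simp only: right_minus_eq)
        then show False using ne by (simp add: norm_mult)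
      qed
      have cont: "continuous_on {0..2*pi} (\<lambda>t. ln (cmod (w - cis t * (- x))))"
        using nz by (intro continuous_intros) auto
      have "(\<integral>t. ?J t * ln (cmod (w - cis t * (- x))) \<partial>lborel) = 2 * pi * ln (max (cmod w) (cmod (-x)))"
        using set_borel_integral_eq_integral(2)[OF borel_integrable_atLeastAtMost'[OF cont]] integral_unique[OF hi]
        by (simp add: set_lebesgue_integral_def)
      moreover have "ln (max (cmod w) (cmod (-x))) = ln (cmod w) + max 0 (ln (cmod x / cmod w))"
        using ne w by (auto simp: max_def ln_div)
      moreover have "?J t * F (cis t * x) = disc_kernel r x * (?J t * ln (cmod (w - cis t * (- x))))" for t
        unfolding F_def disc_kernel_def by (simp add: indicator_def norm_mult)
      ultimately show ?case by (simp only: integral_mult_right_zero ac_simps)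
    qed
  qed measurable
  also have "\<dots> = 2 * pi * (ln (cmod w) + green_kernel r w)"
  proof -
    have gi: "integrable lborel (\<lambda>x. disc_kernel r x * max 0 (ln (cmod x / cmod w)))"
    proof (rule Bochner_Integration.integrable_bound)
      show "integrable lborel (\<lambda>x. disc_kernel r x * max 0 (ln (r / cmod w)))" using disc_kernel_integrable by simp
      show "AE x in lborel. norm (disc_kernel r x * max 0 (ln (cmod x / cmod w))) \<le> norm (disc_kernel r x * max 0 (ln (r / cmod w)))"
      proof (rule AE_I2)
        fix x :: complex
        show "norm (disc_kernel r x * max 0 (ln (cmod x / cmod w))) \<le> norm (disc_kernel r x * max 0 (ln (r / cmod w)))"
        proof (cases "cmod x < r \<and> x \<noteq> 0")
          case True
          then have "ln (cmod x / cmod w) \<le> ln (r / cmod w)" using w r by (subst ln_le_cancel_iff) (auto intro!: divide_right_mono)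
          then show ?thesis using disc_kernel_nonneg by (auto simp: abs_mult intro!: mult_left_mono)
        qed (auto simp: disc_kernel_def)
      qed
    qed measurable
    have "(\<integral>x. disc_kernel r x * (ln (cmod w) + max 0 (ln (cmod x / cmod w))) \<partial>lborel) = ln (cmod w) + green_kernel r w"
      unfolding distrib_left green_kernel_def
      using disc_kernel_integral[OF r] disc_kernel_integrable[of r] gi by (subst Bochner_Integration.integral_add) auto
    then show ?thesis by simp
  qed
  finally show "conv (disc_kernel r) (\<lambda>z. ln (cmod z)) w = ln (cmod w) + green_kernel r w"
    unfolding conv_def F_def by simp
qed

section \<open>Disc means of locally integrable functions\<close>

definition locally_integrable :: "(complex \<Rightarrow> real) \<Rightarrow> bool" where
  "locally_integrable f \<longleftrightarrow> f \<in> borel_measurable borel \<and> (\<forall>R>0. integrable lborel (\<lambda>z. indicator (ball 0 R) z * f z))"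

lemma disc_kernel_locally_integrable:
  assumes f: "locally_integrable f" and r: "0 < r"
  shows "integrable lborel (\<lambda>x. disc_kernel r x * f (w + x))"
    and "cmod w + r \<le> R \<Longrightarrow> (\<integral>x. disc_kernel r x * \<bar>f (w + x)\<bar> \<partial>lborel) \<le> (\<integral>z. indicator (ball 0 R) z * \<bar>f z\<bar> \<partial>lborel) / (pi * r^2)"
proof -
  have [measurable]: "f \<in> borel_measurable borel" using f by (simp add: locally_integrable_def)
  have sub: "indicator (ball 0 r) x \<le> (indicator (ball 0 R) (w + x) :: real)" if "cmod w + r \<le> R" for x R
    using that norm_triangle_ineq[of w x] by (auto simp: indicator_def)
  have int: "integrable lborel (\<lambda>x. indicator (ball 0 R) (w + x) * f (w + x))" if "0 < R" for R
    using f that by (subst integrable_translation_iff) (auto simp: locally_integrable_def)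
  have bd: "norm (disc_kernel r x * f (w + x)) \<le> norm (1 / (pi * r^2) * (indicator (ball 0 R) (w + x) * f (w + x)))"
    if "cmod w + r \<le> R" for x R
    using sub[OF that, of x] r by (auto simp: disc_kernel_def indicator_def)
  show intd: "integrable lborel (\<lambda>x. disc_kernel r x * f (w + x))"
    by (rule Bochner_Integration.integrable_bound[OF integrable_mult_right[OF int[of "cmod w + r"], of "1 / (pi * r^2)"]])
       (use r bd in \<open>auto simp: add_nonneg_pos\<close>)
  assume R: "cmod w + r \<le> R"
  then have R0: "0 < R" using r norm_ge_zero[of w] by linarith
  have "(\<integral>x. disc_kernel r x * \<bar>f (w + x)\<bar> \<partial>lborel) = (\<integral>x. norm (disc_kernel r x * f (w + x)) \<partial>lborel)"
    using disc_kernel_nonneg by (simp add: abs_mult)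
  also have "\<dots> \<le> (\<integral>x. norm (1 / (pi * r^2) * (indicator (ball 0 R) (w + x) * f (w + x))) \<partial>lborel)"
    using intd int[OF R0] bd[OF R] by (intro integral_mono integrable_norm integrable_mult_right)
  also have "\<dots> = (\<integral>x. indicator (ball 0 R) (w + x) * \<bar>f (w + x)\<bar> \<partial>lborel) / (pi * r^2)"
    by (simp add: abs_mult)
  also have "(\<integral>x. indicator (ball 0 R) (w + x) * \<bar>f (w + x)\<bar> \<partial>lborel) = (\<integral>z. indicator (ball 0 R) z * \<bar>f z\<bar> \<partial>lborel)"
    by (rule integral_translation[where f="\<lambda>z. indicator (ball 0 R) z * \<bar>f z\<bar>"]) measurable
  finally show "(\<integral>x. disc_kernel r x * \<bar>f (w + x)\<bar> \<partial>lborel) \<le> (\<integral>z. indicator (ball 0 R) z * \<bar>f z\<bar> \<partial>lborel) / (pi * r^2)" .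
qed

lemma conv_disc_commute:
  assumes f: "locally_integrable f" and r: "0 < r" and s: "0 < s"
  shows "conv (disc_kernel r) (conv (disc_kernel s) f) w = conv (disc_kernel s) (conv (disc_kernel r) f) w"
proof (rule conv_commute_aux)
  fix x assume "disc_kernel s x \<noteq> 0"
  then have x: "cmod x < s" by (auto simp: disc_kernel_def indicator_def split: if_splits)
  have eq: "w + z + x = (w + x) + z" for z by simp
  show "integrable lborel (\<lambda>z. disc_kernel r z * f (w + z + x))"
    unfolding eq by (rule disc_kernel_locally_integrable(1)[OF f r])
  show "(\<integral>z. disc_kernel r z * \<bar>f (w + z + x)\<bar> \<partial>lborel) \<le> (\<integral>z. indicator (ball 0 (cmod w + s + r)) z * \<bar>f z\<bar> \<partial>lborel) / (pi * r^2)"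
    unfolding eq using norm_triangle_ineq[of w x] x by (intro disc_kernel_locally_integrable(2)[OF f r]) simp
qed (use f disc_kernel_nonneg disc_kernel_integrable in \<open>auto simp: locally_integrable_def\<close>)

text \<open>Continuity comes from the kernel: when the centres converge to \<open>w\<close>, the
  disc indicators converge off the circle \<open>sphere w r\<close>, a null set, and a larger ball
  dominates.\<close>

lemma conv_disc_continuous:
  assumes f: "locally_integrable f" and r: "0 < r"
  shows "continuous_on UNIV (conv (disc_kernel r) f)"
proof (rule continuous_at_imp_continuous_on, intro ballI)
  fix w :: complex
  have [measurable]: "f \<in> borel_measurable borel" using f by (simp add: locally_integrable_def)
  have eq: "conv (disc_kernel r) f w = (\<integral>z. disc_kernel r (- w + z) * f z \<partial>lborel)" for w
    unfolding conv_def using integral_translation[of "\<lambda>x. disc_kernel r x * f (w + x)" "-w"] by simp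
  show "isCont (conv (disc_kernel r) f) w"
    unfolding continuous_at_sequentially o_def
  proof (intro allI impI)
    fix u assume u: "u \<longlonglongrightarrow> w"
    obtain K where K: "\<And>n. cmod (u n) \<le> K"
      using convergent_imp_Bseq[of u] u by (metis Bseq_def convergent_def)
    have K0: "0 \<le> K" using K[of 0] norm_ge_zero order.trans by blast
    show "(\<lambda>n. conv (disc_kernel r) f (u n)) \<longlonglongrightarrow> conv (disc_kernel r) f w" unfolding eq
    proof (rule integral_dominated_convergence[where w="\<lambda>z. (indicator (ball 0 (K + r)) z * \<bar>f z\<bar>) / (pi * r^2)"])
      have "integrable lborel (\<lambda>z. \<bar>indicator (ball 0 (K + r)) z * f z\<bar>)"
        using f r K0 by (intro integrable_abs) (auto simp: locally_integrable_def)
      then show "integrable lborel (\<lambda>z. (indicator (ball 0 (K + r)) z * \<bar>f z\<bar>) / (pi * r^2))"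
        by (simp add: abs_mult)
      have "AE z in lborel. z \<notin> sphere w r"
        using negligible_sphere[of w r]
        by (intro AE_not_in) (simp add: negligible_iff_null_sets null_sets_completion_iff)
      then show "AE z in lborel. (\<lambda>n. disc_kernel r (- u n + z) * f z) \<longlonglongrightarrow> disc_kernel r (- w + z) * f z"
      proof eventually_elim
        case (elim z)
        have lim: "(\<lambda>n. cmod (- u n + z)) \<longlonglongrightarrow> cmod (- w + z)" by (intro tendsto_intros u)
        have "cmod (- w + z) \<noteq> r" using elim by (simp add: dist_norm norm_minus_commute)
        then consider "cmod (- w + z) < r" | "cmod (- w + z) > r" by linarith
        then have "eventually (\<lambda>n. disc_kernel r (- u n + z) = disc_kernel r (- w + z)) sequentially"
        proof cases
          case 1
          then show ?thesis by (intro eventually_mono[OF order_tendstoD(2)[OF lim 1]]) (simp add: disc_kernel_def)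
        next
          case 2
          then show ?thesis by (intro eventually_mono[OF order_tendstoD(1)[OF lim 2]]) (simp add: disc_kernel_def)
        qed
        then show ?case by (intro tendsto_mult_right tendsto_eventually)
      qed
      show "AE z in lborel. norm (disc_kernel r (- u n + z) * f z) \<le> (indicator (ball 0 (K + r)) z * \<bar>f z\<bar>) / (pi * r^2)" for n
      proof (rule AE_I2)
        fix z
        show "norm (disc_kernel r (- u n + z) * f z) \<le> (indicator (ball 0 (K + r)) z * \<bar>f z\<bar>) / (pi * r^2)"
        proof (cases "cmod (- u n + z) < r")
          case True
          have "cmod z \<le> cmod (u n) + cmod (- u n + z)" using norm_triangle_ineq[of "u n" "- u n + z"] by simp
          then show ?thesis using True K[of n] r by (simp add: disc_kernel_def abs_mult)
        qed (auto simp: disc_kernel_def)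
      qed
    qed measurable
  qed
qed

lemma locally_integrable_log_norm: "locally_integrable (\<lambda>z. ln (cmod z))"
  using log_norm_locally_integrable by (simp add: locally_integrable_def)

text \<open>Expand \<open>a r * a h * L\<close> in both orders with
  \<open>a h * L = L + g h\<close>: since disc means commute,
  \<open>g r + a r * g h = g h + a h * g r\<close>. The point 0 is left out because the expansion
  holds off the pole of \<open>L\<close>.\<close>

lemma green_kernel_conv_identity:
  assumes r: "0 < r" and h: "0 < h" and z: "z \<noteq> 0"
  shows "conv (disc_kernel r) (green_kernel h) z - green_kernel h z = conv (disc_kernel h) (green_kernel r) z - green_kernel r z"
proof -
  let ?L = "\<lambda>z. ln (cmod z)"
  have *: "conv (disc_kernel r) (conv (disc_kernel h) ?L) z = conv (disc_kernel r) (green_kernel h) z + ln (cmod z) + green_kernel r z"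
    if r: "0 < r" and h: "0 < h" for r h
  proof -
    have gi: "integrable lborel (\<lambda>x. disc_kernel r x * green_kernel h (z + x))"
    proof (rule Bochner_Integration.integrable_bound)
      show "integrable lborel (\<lambda>x. 1 / (pi * r^2) * green_kernel h (z + x))"
        using kernel_green[OF h] by (intro integrable_mult_right) (subst integrable_translation_iff, auto simp: kernel_def)
      show "AE x in lborel. norm (disc_kernel r x * green_kernel h (z + x)) \<le> norm (1 / (pi * r^2) * green_kernel h (z + x))"
        using r green_kernel_nonneg by (auto intro!: AE_I2 simp: disc_kernel_def indicator_def)
    qed measurable
    have "AE x in lborel. x \<noteq> - z" by (rule AE_lborel_singleton)
    then have "AE x in lborel. conv (disc_kernel h) ?L (z + x) = ln (cmod (z + x)) + green_kernel h (z + x)"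
      by eventually_elim (rule conv_disc_log(2)[OF h], simp add: add_eq_0_iff)
    then have ae: "AE x in lborel. disc_kernel r x * conv (disc_kernel h) ?L (z + x) = disc_kernel r x * ln (cmod (z + x)) + disc_kernel r x * green_kernel h (z + x)"
      by eventually_elim (simp add: distrib_left)
    have [measurable]: "conv (disc_kernel h) ?L \<in> borel_measurable borel"
      by (rule continuous_borel[OF conv_disc_continuous[OF locally_integrable_log_norm h]])
    have "conv (disc_kernel r) (conv (disc_kernel h) ?L) z = (\<integral>x. disc_kernel r x * ln (cmod (z + x)) + disc_kernel r x * green_kernel h (z + x) \<partial>lborel)"
      unfolding conv_def[of "disc_kernel r"] by (rule integral_cong_AE[OF _ _ ae]) measurable
    also have "\<dots> = conv (disc_kernel r) ?L z + conv (disc_kernel r) (green_kernel h) z"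
      unfolding conv_def by (rule Bochner_Integration.integral_add[OF conv_disc_log(1)[OF r z] gi])
    finally show ?thesis using conv_disc_log(2)[OF r z] by simp
  qed
  show ?thesis using *[OF r h] *[OF h r] conv_disc_commute[OF locally_integrable_log_norm r h, of z] by simp
qed

text \<open>Both sides are \<open>f\<close> integrated against one kernel, up to a null set. The
  logarithm, whose support is unbounded, has cancelled from the kernel identity, so \<open>f\<close>
  may grow arbitrarily.\<close>

theorem green_identity:
  assumes f: "continuous_on UNIV f" and r: "0 < r" and h: "0 < h"
  shows "conv (green_kernel h) (\<lambda>x. conv (disc_kernel r) f x - f x) w = conv (green_kernel r) (\<lambda>x. conv (disc_kernel h) f x - f x) w"
proof -
  have cd: "continuous_on UNIV (conv (disc_kernel s) f)" for s by (rule conv_continuous[OF kernel_disc f])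
  have *: "conv (green_kernel h) (\<lambda>x. conv (disc_kernel r) f x - f x) w
      = (\<integral>y. (conv (disc_kernel r) (green_kernel h) y - green_kernel h y) * f (w + y) \<partial>lborel)"
    if h: "0 < h" for h r
  proof -
    note k = kernel_green[OF h]
    have "conv (green_kernel h) (\<lambda>x. conv (disc_kernel r) f x - f x) w
       = conv (green_kernel h) (conv (disc_kernel r) f) w - conv (green_kernel h) f w"
      by (rule conv_diff[OF k cd f])
    also have "conv (green_kernel h) (conv (disc_kernel r) f) w = conv (disc_kernel r) (conv (green_kernel h) f) w"
      by (rule conv_commute[OF k kernel_disc f])
    also have "\<dots> = conv (conv (disc_kernel r) (green_kernel h)) f w"
      by (rule conv_assoc(1)[OF k kernel_disc f disc_kernel_minus])
    also have "\<dots> - conv (green_kernel h) f w = (\<integral>y. conv (disc_kernel r) (green_kernel h) y * f (w + y) - green_kernel h y * f (w + y) \<partial>lborel)"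
      unfolding conv_def[of "green_kernel h"] conv_def[of "conv (disc_kernel r) (green_kernel h)"]
      by (rule Bochner_Integration.integral_diff[symmetric, OF conv_assoc(2)[OF k kernel_disc f disc_kernel_minus] conv_integrable[OF k f]])
    finally show ?thesis by (simp add: left_diff_distrib)
  qed
  have meas: "conv (disc_kernel r) (green_kernel h) \<in> borel_measurable borel" for r h
    unfolding conv_def[abs_def] by measurable
  note [measurable] = continuous_borel[OF f] meas
  show ?thesis unfolding *[OF h] *[OF r]
  proof (rule integral_cong_AE)
    have "AE y in lborel. y \<noteq> (0::complex)" by (rule AE_lborel_singleton)
    then show "AE y in lborel. (conv (disc_kernel r) (green_kernel h) y - green_kernel h y) * f (w + y)
        = (conv (disc_kernel h) (green_kernel r) y - green_kernel r y) * f (w + y)"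
      by eventually_elim (simp add: green_kernel_conv_identity[OF r h])
  qed measurable
qed

section \<open>Smoothing and approximate Riesz densities\<close>

definition green_mass :: "real \<Rightarrow> real" where
  "green_mass h = (\<integral>z. green_kernel h z \<partial>lborel)"

definition smoothing :: "real \<Rightarrow> (complex \<Rightarrow> real) \<Rightarrow> complex \<Rightarrow> real" where
  "smoothing h f w = conv (green_kernel h) f w / green_mass h"

text \<open>For smooth \<open>f\<close> the disc mean exceeds \<open>f\<close> by about
  \<open>h^2 / 8\<close> times the Laplacian, and the mass of the Green kernel is
  \<open>pi * h^2 / 4\<close>; the quotient thus approximates the Laplacian divided by
  \<open>2 * pi\<close>.\<close>

definition riesz_density :: "real \<Rightarrow> (complex \<Rightarrow> real) \<Rightarrow> complex \<Rightarrow> real" where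
  "riesz_density h f w = (conv (disc_kernel h) f w - f w) / green_mass h"

lemma green_mass_pos: "0 < h \<Longrightarrow> 0 < green_mass h"
  unfolding green_mass_def by (rule green_kernel_integral_pos)

lemma smoothing_continuous:
  assumes "continuous_on UNIV f" "0 < h"
  shows "continuous_on UNIV (smoothing h f)"
  unfolding smoothing_def[abs_def] using green_mass_pos[OF assms(2)]
  by (intro continuous_intros conv_continuous[OF kernel_green] assms) auto

lemma riesz_density_continuous:
  assumes "continuous_on UNIV f" "0 < h"
  shows "continuous_on UNIV (riesz_density h f)"
  unfolding riesz_density_def[abs_def] using green_mass_pos[OF assms(2)]
  by (intro continuous_intros conv_continuous[OF kernel_disc] assms) auto

lemma smoothing_ge:
  assumes f: "continuous_on UNIV f" and h: "0 < h" and b: "\<And>z. cmod z \<le> h \<Longrightarrow> a \<le> f (w + z)"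
  shows "a \<le> smoothing h f w"
proof -
  have "conv (green_kernel h) (\<lambda>_. a) w \<le> conv (green_kernel h) f w"
    by (rule conv_mono[OF kernel_green[OF h] _ f]) (use b in auto)
  then show "a \<le> smoothing h f w"
    using green_mass_pos[OF h] by (simp add: smoothing_def conv_const green_mass_def pos_le_divide_eq)
qed

lemma conv_normalized_tendsto:
  assumes f: "continuous_on UNIV f" and k: "\<And>h. 0 < h \<Longrightarrow> kernel h (k h)"
    and pos: "\<And>h. 0 < h \<Longrightarrow> 0 < (\<integral>z. k h z \<partial>lborel)"
  shows "((\<lambda>h. conv (k h) f w / (\<integral>z. k h z \<partial>lborel)) \<longlongrightarrow> f w) (at_right 0)"
proof (rule tendstoI)
  fix e :: real assume "0 < e"
  have "isCont f w" using f by (simp add: continuous_on_eq_continuous_at)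
  then obtain d where d: "d > 0" "\<And>u. dist u w < d \<Longrightarrow> dist (f u) (f w) < e/2"
    unfolding continuous_at_eps_delta using \<open>0 < e\<close> by (meson half_gt_zero)
  have "eventually (\<lambda>h. 0 < h \<and> h < d) (at_right 0)" using d(1) by (auto simp: eventually_at_right_field intro!: exI[of _ d])
  then show "eventually (\<lambda>h. dist (conv (k h) f w / (\<integral>z. k h z \<partial>lborel)) (f w) < e) (at_right 0)"
  proof eventually_elim
    case (elim h)
    let ?K = "\<integral>z. k h z \<partial>lborel"
    have near: "\<bar>f (w + z) - f w\<bar> < e/2" if "cmod z \<le> h" for z
      using d(2)[of "w + z"] that elim by (simp add: dist_norm)
    have b: "f w - e/2 \<le> f (w + z)" "f (w + z) \<le> f w + e/2" if "cmod z \<le> h" for z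
      using near[OF that] by linarith+
    have kh: "kernel h (k h)" "0 < ?K" using k pos elim by auto
    have "(f w - e/2) * ?K \<le> conv (k h) f w"
      using conv_mono[OF kh(1) continuous_on_const f b(1)] by (simp only: conv_const)
    then have "f w - e/2 \<le> conv (k h) f w / ?K" using kh(2) by (simp add: pos_le_divide_eq)
    moreover have "conv (k h) f w \<le> (f w + e/2) * ?K"
      using conv_mono[OF kh(1) f continuous_on_const b(2)] by (simp only: conv_const)
    then have "conv (k h) f w / ?K \<le> f w + e/2" using kh(2) by (simp add: pos_divide_le_eq)
    ultimately show ?case using \<open>0 < e\<close> unfolding dist_real_def by linarith
  qed
qed

lemma smoothing_tendsto:
  assumes "continuous_on UNIV f"
  shows "((\<lambda>h. smoothing h f w) \<longlongrightarrow> f w) (at_right 0)"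
  unfolding smoothing_def green_mass_def
  by (rule conv_normalized_tendsto[OF assms kernel_green green_kernel_integral_pos])

lemma conv_disc_tendsto:
  assumes "continuous_on UNIV f"
  shows "((\<lambda>h. conv (disc_kernel h) f w) \<longlongrightarrow> f w) (at_right 0)"
proof (rule Lim_transform_eventually)
  show "((\<lambda>h. conv (disc_kernel h) f w / (\<integral>z. disc_kernel h z \<partial>lborel)) \<longlongrightarrow> f w) (at_right 0)"
    by (rule conv_normalized_tendsto[OF assms kernel_disc]) (simp add: disc_kernel_integral)
  show "eventually (\<lambda>h. conv (disc_kernel h) f w / (\<integral>z. disc_kernel h z \<partial>lborel) = conv (disc_kernel h) f w) (at_right 0)"
    using eventually_at_right_less[of 0] by eventually_elim (simp add: disc_kernel_integral)
qed

lemma conv_disc_smoothing: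
  assumes f: "continuous_on UNIV f" and h: "0 < h"
  shows "conv (disc_kernel r) (smoothing h f) w = smoothing h (conv (disc_kernel r) f) w"
  unfolding smoothing_def[abs_def] conv_divide
  using conv_commute[OF kernel_disc kernel_green[OF h] f] by simp

text \<open>The Riesz-Jensen formula on a disc for the smoothed function. The disc mean is moved
  past the smoothing, and \<open>green_identity\<close> exchanges the roles of \<open>r\<close> and
  \<open>h\<close>.\<close>

theorem smoothing_representation:
  assumes f: "continuous_on UNIV f" and r: "0 < r" and h: "0 < h"
  shows "conv (disc_kernel r) (smoothing h f) w - smoothing h f w = conv (green_kernel r) (riesz_density h f) w"
proof -
  have cd: "continuous_on UNIV (conv (disc_kernel s) f)" for s by (rule conv_continuous[OF kernel_disc f])
  have "conv (disc_kernel r) (smoothing h f) w - smoothing h f w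
     = conv (green_kernel h) (\<lambda>x. conv (disc_kernel r) f x - f x) w / green_mass h"
    unfolding conv_disc_smoothing[OF f h] conv_diff[OF kernel_green[OF h] cd f] by (simp add: smoothing_def diff_divide_distrib)
  also have "\<dots> = conv (green_kernel r) (riesz_density h f) w"
    unfolding green_identity[OF f r h] riesz_density_def[abs_def] conv_divide by simp
  finally show ?thesis .
qed

section \<open>Exponential integrability of continuous subharmonic functions\<close>

definition submean :: "(complex \<Rightarrow> real) \<Rightarrow> bool" where
  "submean u \<longleftrightarrow> continuous_on UNIV u \<and> (\<forall>w. \<forall>r>0. u w \<le> conv (disc_kernel r) u w)"

lemma riesz_density_nonneg: "submean u \<Longrightarrow> 0 < h \<Longrightarrow> 0 \<le> riesz_density h u w"
  unfolding riesz_density_def submean_def using green_mass_pos[of h] by (intro divide_nonneg_nonneg) auto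

lemma conv_disc_smoothing_tendsto:
  assumes "continuous_on UNIV u"
  shows "((\<lambda>h. conv (disc_kernel r) (smoothing h u) w) \<longlongrightarrow> conv (disc_kernel r) u w) (at_right 0)"
proof (rule Lim_transform_eventually)
  show "((\<lambda>h. smoothing h (conv (disc_kernel r) u) w) \<longlongrightarrow> conv (disc_kernel r) u w) (at_right 0)"
    by (rule smoothing_tendsto[OF conv_continuous[OF kernel_disc assms]])
  show "eventually (\<lambda>h. smoothing h (conv (disc_kernel r) u) w = conv (disc_kernel r) (smoothing h u) w) (at_right 0)"
    using eventually_at_right_less[of 0] by eventually_elim (simp add: conv_disc_smoothing[OF assms])
qed

text \<open>By \<open>smoothing_representation\<close> the radius occurs only in the Green kernel,
  which is convex in \<open>ln r\<close> and is integrated against a nonnegative density. Letting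
  \<open>h\<close> tend to 0 removes the smoothing.\<close>

lemma disc_mean_log_convex:
  assumes u: "submean u" and t: "0 \<le> t" "t \<le> 1"
  shows "conv (disc_kernel (exp ((1 - t) * x + t * y))) u w \<le> (1 - t) * conv (disc_kernel (exp x)) u w + t * conv (disc_kernel (exp y)) u w"
proof -
  have c: "continuous_on UNIV u" using u by (simp add: submean_def)
  show ?thesis
  proof (rule tendsto_le)
    show "((\<lambda>h. conv (disc_kernel (exp ((1 - t) * x + t * y))) (smoothing h u) w) \<longlongrightarrow> conv (disc_kernel (exp ((1 - t) * x + t * y))) u w) (at_right 0)"
      by (rule conv_disc_smoothing_tendsto[OF c])
    show "((\<lambda>h. (1 - t) * conv (disc_kernel (exp x)) (smoothing h u) w + t * conv (disc_kernel (exp y)) (smoothing h u) w) \<longlongrightarrow>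
       (1 - t) * conv (disc_kernel (exp x)) u w + t * conv (disc_kernel (exp y)) u w) (at_right 0)"
      by (intro tendsto_intros conv_disc_smoothing_tendsto[OF c])
    show "eventually (\<lambda>h. conv (disc_kernel (exp ((1 - t) * x + t * y))) (smoothing h u) w \<le>
       (1 - t) * conv (disc_kernel (exp x)) (smoothing h u) w + t * conv (disc_kernel (exp y)) (smoothing h u) w) (at_right 0)"
      using eventually_at_right_less[of 0]
    proof eventually_elim
      case (elim h)
      let ?m = "riesz_density h u"
      have rep: "conv (disc_kernel (exp s)) (smoothing h u) w = smoothing h u w + conv (green_kernel (exp s)) ?m w" for s
        using smoothing_representation[OF c exp_gt_zero[of s] elim, of w] by simp
      have ci: "integrable lborel (\<lambda>z. green_kernel (exp s) z * ?m (w + z))" for s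
        by (rule conv_integrable[OF kernel_green riesz_density_continuous[OF c elim]]) simp
      have "conv (green_kernel (exp ((1 - t) * x + t * y))) ?m w \<le> (\<integral>z. (1 - t) * (green_kernel (exp x) z * ?m (w + z)) + t * (green_kernel (exp y) z * ?m (w + z)) \<partial>lborel)"
        unfolding conv_def
      proof (rule integral_mono_AE)
        show "integrable lborel (\<lambda>z. (1 - t) * (green_kernel (exp x) z * ?m (w + z)) + t * (green_kernel (exp y) z * ?m (w + z)))"
          by (intro Bochner_Integration.integrable_add integrable_mult_right ci)
        have "AE z in lborel. z \<noteq> (0::complex)" by (rule AE_lborel_singleton)
        then show "AE z in lborel. green_kernel (exp ((1 - t) * x + t * y)) z * ?m (w + z) \<le> (1 - t) * (green_kernel (exp x) z * ?m (w + z)) + t * (green_kernel (exp y) z * ?m (w + z))"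
        proof eventually_elim
          case (elim z)
          from mult_right_mono[OF green_kernel_log_convex[OF t this, of x y] riesz_density_nonneg[OF u \<open>0 < h\<close>, of "w + z"]]
          show ?case by (simp add: algebra_simps)
        qed
      qed (rule ci)
      also have "\<dots> = (1 - t) * conv (green_kernel (exp x)) ?m w + t * conv (green_kernel (exp y)) ?m w"
        unfolding conv_def by (subst Bochner_Integration.integral_add) (auto intro!: integrable_mult_right ci)
      finally show ?case unfolding rep by (simp add: algebra_simps)
    qed
  qed simp
qed

lemma disc_mean_mono:
  assumes u: "submean u" and r: "0 < r" "r \<le> s"
  shows "conv (disc_kernel r) u w \<le> conv (disc_kernel s) u w"
proof -
  have c: "continuous_on UNIV u" using u by (simp add: submean_def)
  have s: "0 < s" using r by simp
  show ?thesis
  proof (rule tendsto_le[OF _ conv_disc_smoothing_tendsto[OF c] conv_disc_smoothing_tendsto[OF c]])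
    show "eventually (\<lambda>h. conv (disc_kernel r) (smoothing h u) w \<le> conv (disc_kernel s) (smoothing h u) w) (at_right 0)"
      using eventually_at_right_less[of 0]
    proof eventually_elim
      case (elim h)
      let ?m = "riesz_density h u"
      have "conv (green_kernel r) ?m w \<le> conv (green_kernel s) ?m w"
        unfolding conv_def
      proof (rule integral_mono_AE)
        have "AE z in lborel. z \<noteq> (0::complex)" by (rule AE_lborel_singleton)
        then show "AE z in lborel. green_kernel r z * ?m (w + z) \<le> green_kernel s z * ?m (w + z)"
          by eventually_elim (intro mult_right_mono green_kernel_mono r riesz_density_nonneg[OF u elim])
      qed (intro conv_integrable[OF kernel_green riesz_density_continuous[OF c elim]] r s)+
      then show ?case
        using smoothing_representation[OF c r(1) elim, of w] smoothing_representation[OF c s elim, of w] by simp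
    qed
  qed simp
qed

text \<open>The difference of the means is the integral of the difference of two Green kernels
  against the density. That difference is nonnegative, and \<open>green_kernel_diff_ge\<close>
  bounds it from below on the disc of radius \<open>d * r\<close>.\<close>

lemma riesz_mass_bound:
  assumes u: "submean u" and h: "0 < h" and r: "0 < r" "r < s" and d: "0 < d" "d \<le> 1"
  shows "ln (s / r) * (1 - d^2) * (\<integral>z. indicator (ball 0 (d * r)) z * riesz_density h u (w + z) \<partial>lborel)
    \<le> conv (disc_kernel s) (smoothing h u) w - conv (disc_kernel r) (smoothing h u) w"
proof -
  have c: "continuous_on UNIV u" using u by (simp add: submean_def)
  have s: "0 < s" using r by simp
  let ?m = "riesz_density h u"
  note cm = riesz_density_continuous[OF c h]
  have k: "kernel (d * r) (indicator (ball 0 (d * r)))"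
    unfolding kernel_def using integrable_ball_indicator by auto
  have i0: "integrable lborel (\<lambda>z. indicator (ball 0 (d * r)) z * ?m (w + z))" by (rule conv_integrable[OF k cm])
  have i1: "integrable lborel (\<lambda>z. green_kernel p z * ?m (w + z))" if "0 < p" for p
    by (rule conv_integrable[OF kernel_green[OF that] cm])
  have "ln (s / r) * (1 - d^2) * (\<integral>z. indicator (ball 0 (d * r)) z * ?m (w + z) \<partial>lborel)
     = (\<integral>z. ln (s / r) * (1 - d^2) * (indicator (ball 0 (d * r)) z * ?m (w + z)) \<partial>lborel)" by simp
  also have "\<dots> \<le> (\<integral>z. green_kernel s z * ?m (w + z) - green_kernel r z * ?m (w + z) \<partial>lborel)"
  proof (rule integral_mono_AE)
    have "AE z in lborel. z \<noteq> (0::complex)" by (rule AE_lborel_singleton)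
    then show "AE z in lborel. ln (s / r) * (1 - d^2) * (indicator (ball 0 (d * r)) z * ?m (w + z)) \<le> green_kernel s z * ?m (w + z) - green_kernel r z * ?m (w + z)"
    proof eventually_elim
      case (elim z)
      have m0: "0 \<le> ?m (w + z)" by (rule riesz_density_nonneg[OF u h])
      have "ln (s / r) * (1 - d^2) * indicator (ball 0 (d * r)) z \<le> green_kernel s z - green_kernel r z"
      proof (cases "cmod z < d * r")
        case True
        then show ?thesis using green_kernel_diff_ge[of r s d z] r d elim by simp
      next
        case False
        then show ?thesis using green_kernel_mono[of r s z] r elim by simp
      qed
      from mult_right_mono[OF this m0] show ?case by (simp add: algebra_simps)
    qed
  qed (intro integrable_mult_right Bochner_Integration.integrable_diff i0 i1 r s)+
  also have "\<dots> = conv (green_kernel s) ?m w - conv (green_kernel r) ?m w"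
    unfolding conv_def by (rule Bochner_Integration.integral_diff) (intro i1 r s)+
  also have "\<dots> = conv (disc_kernel s) (smoothing h u) w - conv (disc_kernel r) (smoothing h u) w"
    using smoothing_representation[OF c r(1) h, of w] smoothing_representation[OF c s h, of w] by simp
  finally show ?thesis .
qed

section \<open>Jensen's inequality and the exponential estimate\<close>

lemma ennreal_integral_le_nn_integral:
  assumes "integrable M g" "\<And>x. g x \<le> h x"
  shows "ennreal (\<integral>x. g x \<partial>M) \<le> (\<integral>\<^sup>+x. ennreal (h x) \<partial>M)"
proof -
  have i: "integrable M (\<lambda>x. max 0 (g x))" using assms(1) by (intro integrable_max) auto
  have "ennreal (\<integral>x. g x \<partial>M) \<le> ennreal (\<integral>x. max 0 (g x) \<partial>M)"
    by (intro ennreal_leI integral_mono assms i) auto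
  also have "\<dots> = (\<integral>\<^sup>+x. ennreal (max 0 (g x)) \<partial>M)"
    by (rule nn_integral_eq_integral[symmetric, OF i]) auto
  also have "\<dots> \<le> (\<integral>\<^sup>+x. ennreal (h x) \<partial>M)"
    by (intro nn_integral_mono) (metis assms(2) ennreal_leI ennreal_max_0)
  finally show ?thesis .
qed

text \<open>Jensen's inequality, by integrating the tangent line of \<open>exp\<close> at \<open>c\<close>.\<close>
lemma exp_integral_le:
  fixes \<kappa> F :: "complex \<Rightarrow> real"
  assumes k0: "\<And>z. 0 \<le> \<kappa> z" and ki: "integrable lborel \<kappa>" and kF: "integrable lborel (\<lambda>z. \<kappa> z * F z)"
    and k: "k = (\<integral>z. \<kappa> z \<partial>lborel)" and c: "c = (\<integral>z. \<kappa> z * F z \<partial>lborel)"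
  shows "ennreal (k * exp c) \<le> (\<integral>\<^sup>+z. ennreal (\<kappa> z * exp (k * F z)) \<partial>lborel)"
proof -
  \<comment> \<open>For the probability density \<open>\<kappa> / k\<close> the mean of
    \<open>k * F\<close> is \<open>c\<close>. The tangent inequality is kept multiplied by
    \<open>k\<close>, which avoids the division.\<close>
  let ?g = "\<lambda>z. exp c * ((1 - c) * \<kappa> z + k * (\<kappa> z * F z))"
  have "(\<integral>z. ?g z \<partial>lborel) = exp c * ((1 - c) * k + k * c)"
    using ki kF unfolding k c by (subst integral_mult_right_zero, subst Bochner_Integration.integral_add) auto
  also have "\<dots> = k * exp c" by (simp add: algebra_simps)
  finally have eq: "(\<integral>z. ?g z \<partial>lborel) = k * exp c" .
  have "ennreal (\<integral>z. ?g z \<partial>lborel) \<le> (\<integral>\<^sup>+z. ennreal (\<kappa> z * exp (k * F z)) \<partial>lborel)"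
  proof (rule ennreal_integral_le_nn_integral)
    show "integrable lborel ?g" using ki kF by (intro integrable_mult_right Bochner_Integration.integrable_add)
    fix z
    have "1 + (k * F z - c) \<le> exp (k * F z - c)" by (rule exp_ge_add_one_self)
    then have "exp c * (1 + (k * F z - c)) \<le> exp c * exp (k * F z - c)" by (intro mult_left_mono) auto
    also have "\<dots> = exp (k * F z)" by (simp add: exp_add[symmetric])
    finally have "\<kappa> z * (exp c * (1 + (k * F z - c))) \<le> \<kappa> z * exp (k * F z)" using k0 by (intro mult_left_mono)
    then show "?g z \<le> \<kappa> z * exp (k * F z)" by (simp add: algebra_simps)
  qed
  then show ?thesis unfolding eq .
qed

text \<open>A bound for the integral of \<open>1 + (r / |s - a|) powr m\<close> over a set of length
  at most \<open>A\<close>, the same for all \<open>a\<close>: the part where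
  \<open>|s - a| \<le> 1\<close> gives the singular integral, and elsewhere
  \<open>|s - a| powr (-m)\<close> is at most 1.\<close>

definition exp_bound :: "real \<Rightarrow> real \<Rightarrow> real \<Rightarrow> ennreal" where
  "exp_bound m r A = ennreal A + ennreal (r powr m) * ((\<integral>\<^sup>+s\<in>{-1..1}. ennreal (\<bar>s\<bar> powr (-m)) \<partial>lborel) + ennreal A)"

lemma exp_bound_finite: "0 < m \<Longrightarrow> m < 1 \<Longrightarrow> exp_bound m r A < \<infinity>"
  unfolding exp_bound_def using nn_integral_abs_powr_finite[of m 1] by (auto simp: ennreal_mult_less_top)

lemma nn_integral_powr_le_exp_bound:
  assumes m: "0 < m" and I [measurable]: "I \<in> sets borel" and A: "emeasure lborel I \<le> ennreal A" "0 \<le> A"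
  shows "(\<integral>\<^sup>+s\<in>I. ennreal (1 + r powr m * \<bar>s - a\<bar> powr (-m)) \<partial>lborel) \<le> exp_bound m r A"
proof -
  have "(\<integral>\<^sup>+s\<in>I. ennreal (1 + r powr m * \<bar>s - a\<bar> powr (-m)) \<partial>lborel)
     \<le> (\<integral>\<^sup>+s. indicator I s + ennreal (r powr m) * (ennreal (\<bar>s - a\<bar> powr (-m)) * indicator {-1..1} (s - a) + indicator I s) \<partial>lborel)"
  proof (rule nn_integral_mono)
    fix s :: real
    have "ennreal (\<bar>s - a\<bar> powr (-m)) \<le> ennreal (\<bar>s - a\<bar> powr (-m)) * indicator {-1..1} (s - a) + 1"
    proof (cases "\<bar>s - a\<bar> \<le> 1")
      case True
      then have "s - a \<in> {-1..1}" by auto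
      then show ?thesis by simp
    next
      case False
      then have "\<bar>s - a\<bar> powr (-m) \<le> 1" using m powr_mono2'[of "-m" 1 "\<bar>s - a\<bar>"] by simp
      then show ?thesis by (metis add.commute add_increasing2 ennreal_1 ennreal_leI zero_le)
    qed
    then have le: "ennreal (r powr m) * ennreal (\<bar>s - a\<bar> powr (-m)) \<le> ennreal (r powr m) * (ennreal (\<bar>s - a\<bar> powr (-m)) * indicator {-1..1} (s - a) + 1)"
      by (intro mult_left_mono) auto
    show "ennreal (1 + r powr m * \<bar>s - a\<bar> powr (-m)) * indicator I s \<le> indicator I s + ennreal (r powr m) * (ennreal (\<bar>s - a\<bar> powr (-m)) * indicator {-1..1} (s - a) + indicator I s)"
    proof (cases "s \<in> I")
      case True
      have "ennreal (1 + r powr m * \<bar>s - a\<bar> powr (-m)) = 1 + ennreal (r powr m) * ennreal (\<bar>s - a\<bar> powr (-m))"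
        by (simp add: ennreal_mult')
      then show ?thesis using add_left_mono[OF le, of 1] True by simp
    qed simp
  qed
  also have "\<dots> = emeasure lborel I + ennreal (r powr m) * ((\<integral>\<^sup>+s. ennreal (\<bar>s - a\<bar> powr (-m)) * indicator {-1..1} (s - a) \<partial>lborel) + emeasure lborel I)"
    by (simp add: nn_integral_add nn_integral_cmult)
  also have "(\<integral>\<^sup>+s. ennreal (\<bar>s - a\<bar> powr (-m)) * indicator {-1..1} (s - a) \<partial>lborel) = (\<integral>\<^sup>+s\<in>{-1..1}. ennreal (\<bar>s\<bar> powr (-m)) \<partial>lborel)"
    using nn_integral_real_shift[of "\<lambda>s. ennreal (\<bar>s\<bar> powr (-m)) * indicator {-1..1} s" "-a"] by simp
  also have "emeasure lborel I + ennreal (r powr m) * ((\<integral>\<^sup>+s\<in>{-1..1}. ennreal (\<bar>s\<bar> powr (-m)) \<partial>lborel) + emeasure lborel I) \<le> exp_bound m r A"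
    unfolding exp_bound_def using A by (intro add_mono mult_left_mono) auto
  finally show ?thesis .
qed

text \<open>By \<open>smoothing_representation\<close> the value at \<open>w\<close> is a disc mean
  minus a Green potential. For \<open>w\<close> within \<open>\<rho> / 2\<close> of
  \<open>z0\<close>, the potential of radius \<open>\<rho> / 2\<close> sees only the mass in the
  disc of radius \<rho> about \<open>z0\<close>, of total \<open>k \<le> m\<close>. Jensen turns its
  exponential into an average, bounded through \<open>|s - Re \<zeta>|\<close>, and Tonelli
  integrates over \<open>s\<close> first. The bound does not contain \<open>h\<close>.\<close>

lemma smoothing_exp_integral:
  assumes u: "submean u" and h: "0 < h" and m: "0 < m" "m < 1" and \<rho>: "0 < \<rho>"
    and mass: "(\<integral>z. indicator (ball 0 \<rho>) z * riesz_density h u (z0 + z) \<partial>lborel) \<le> m"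
    and lower: "\<And>w. cmod (w - z0) \<le> \<rho> / 2 \<Longrightarrow> - C \<le> conv (disc_kernel (\<rho> / 2)) (smoothing h u) w"
    and I [measurable]: "I \<in> sets borel" and A: "emeasure lborel I \<le> ennreal A" "0 \<le> A"
    and \<gamma>: "\<And>s. s \<in> I \<Longrightarrow> cmod (\<gamma> s - z0) \<le> \<rho> / 2" "\<And>s. Re (\<gamma> s) = s"
  shows "(\<integral>\<^sup>+s\<in>I. ennreal (exp (- smoothing h u (\<gamma> s))) \<partial>lborel) \<le> ennreal (exp C) * exp_bound m (\<rho> / 2) A"
proof -
  define r where "r = \<rho> / 2"
  have r: "0 < r" using \<rho> by (simp add: r_def)
  have cu: "continuous_on UNIV u" using u by (simp add: submean_def)
  define \<mu> where "\<mu> = riesz_density h u"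
  have mu0: "0 \<le> \<mu> z" for z unfolding \<mu>_def by (rule riesz_density_nonneg[OF u h])
  have cmu: "continuous_on UNIV \<mu>" unfolding \<mu>_def by (rule riesz_density_continuous[OF cu h])
  note [measurable] = continuous_borel[OF cmu]
  define \<kappa> where "\<kappa> z = indicator (ball 0 \<rho>) z * \<mu> (z0 + z)" for z
  have km [measurable]: "\<kappa> \<in> borel_measurable borel" unfolding \<kappa>_def by measurable
  have k0: "0 \<le> \<kappa> z" for z unfolding \<kappa>_def using mu0 by simp
  obtain B where B: "0 \<le> B" "\<And>z. cmod z \<le> \<rho> \<Longrightarrow> \<bar>\<mu> (z0 + z)\<bar> \<le> B" using continuous_bounded_near[OF cmu] by blast
  have kB: "\<kappa> z \<le> B" for z using B(1) B(2)[of z] unfolding \<kappa>_def by (auto simp: indicator_def)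
  have kker: "kernel \<rho> (indicator (ball 0 \<rho>))" unfolding kernel_def using integrable_ball_indicator by auto
  have ki: "integrable lborel \<kappa>" unfolding \<kappa>_def by (rule conv_integrable[OF kker cmu])
  define k where "k = (\<integral>z. \<kappa> z \<partial>lborel)"
  have km': "0 \<le> k" "k \<le> m" using mass k0 unfolding k_def \<kappa>_def \<mu>_def by (auto intro!: integral_nonneg_AE)
  define F where "F v z = max 0 (ln (r / cmod (z - v)))" for v z
  have Fm [measurable]: "F v \<in> borel_measurable borel" for v unfolding F_def[abs_def] by measurable
  have F0: "0 \<le> F v z" for v z by (simp add: F_def)
  have Fi: "integrable lborel (F v)" for v
    using integrable_log_plus[OF r] integrable_translation_iff[of "\<lambda>z. max 0 (ln (r / cmod z))" "-v"]
    unfolding F_def[abs_def] by simp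
  have kF: "integrable lborel (\<lambda>z. \<kappa> z * F v z)" for v
    by (rule Bochner_Integration.integrable_bound[OF integrable_mult_right[OF Fi, of B]])
       (use k0 kB F0 B in \<open>auto intro!: AE_I2 mult_right_mono simp: abs_mult\<close>)
  define c where "c v = (\<integral>z. \<kappa> z * F v z \<partial>lborel)" for v
  have lowbound: "- smoothing h u w \<le> C + c (w - z0)" if w: "cmod (w - z0) \<le> \<rho> / 2" for w
  proof -
    let ?v = "w - z0"
    have "conv (green_kernel r) \<mu> w = (\<integral>z. green_kernel r (- ?v + z) * \<mu> (w + (- ?v + z)) \<partial>lborel)"
      unfolding conv_def
      by (rule integral_translation[symmetric, where f="\<lambda>z. green_kernel r z * \<mu> (w + z)"]) measurable
    also have "\<dots> = (\<integral>z. green_kernel r (z - ?v) * \<mu> (z0 + z) \<partial>lborel)" by (simp add: algebra_simps)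
    also have "\<dots> \<le> (\<integral>z. \<kappa> z * F ?v z \<partial>lborel)"
    proof (rule integral_mono)
      show "integrable lborel (\<lambda>z. green_kernel r (z - ?v) * \<mu> (z0 + z))"
        using conv_integrable[OF kernel_green[OF r] cmu, of w]
              integrable_translation_iff[of "\<lambda>z. green_kernel r z * \<mu> (w + z)" "- ?v"] by (simp add: algebra_simps)
      show "integrable lborel (\<lambda>z. \<kappa> z * F ?v z)" by (rule kF)
      fix z
      show "green_kernel r (z - ?v) * \<mu> (z0 + z) \<le> \<kappa> z * F ?v z"
      proof (cases "cmod z < \<rho>")
        case True
        then show ?thesis using green_kernel_le[OF r, of "z - ?v"] mu0[of "z0 + z"]
          unfolding \<kappa>_def F_def by (simp add: mult.commute mult_left_mono)
      next
        case False
        have "cmod z \<le> cmod (z - ?v) + cmod ?v" using norm_triangle_ineq[of "z - ?v" ?v] by simp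
        then have "r \<le> cmod (z - ?v)" using False w unfolding r_def by linarith
        then have "0 < r / cmod (z - ?v)" "r / cmod (z - ?v) \<le> 1" using r by (auto simp: divide_simps)
        then have "max 0 (ln (r / cmod (z - ?v))) = 0" by simp
        then have "green_kernel r (z - ?v) = 0" using green_kernel_le[OF r, of "z - ?v"] green_kernel_nonneg[of r "z - ?v"] by linarith
        then show ?thesis using k0 F0 by simp
      qed
    qed
    finally have "conv (green_kernel r) \<mu> w \<le> c ?v" unfolding c_def .
    moreover have "conv (disc_kernel r) (smoothing h u) w - smoothing h u w = conv (green_kernel r) \<mu> w"
      unfolding \<mu>_def by (rule smoothing_representation[OF cu r h])
    moreover have "- C \<le> conv (disc_kernel r) (smoothing h u) w" using lower[OF w] unfolding r_def .
    ultimately show ?thesis by linarith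
  qed
  \<comment> \<open>The majorant \<open>H\<close> is measurable in \<open>s\<close> whatever
    \<gamma> is, so that Tonelli applies and constants can be pulled out.\<close>
  have "\<exists>H. H \<in> borel_measurable borel \<and> (\<forall>s\<in>I. ennreal (exp (c (\<gamma> s - z0))) \<le> H s) \<and> (\<integral>\<^sup>+s\<in>I. H s \<partial>lborel) \<le> exp_bound m r A"
  \<comment> \<open>Normalising \<kappa> requires \<open>k > 0\<close>; without mass the potential
    \<open>c\<close> vanishes.\<close>
  proof (cases "k = 0")
    case True
    have "AE z in lborel. \<kappa> z = 0"
      using True integral_nonneg_eq_0_iff_AE[OF ki] k0 unfolding k_def by auto
    then have "c v = 0" for v
      unfolding c_def by (intro integral_eq_zero_AE) (auto elim!: eventually_mono)
    moreover have "(\<integral>\<^sup>+s\<in>I. 1 \<partial>lborel) \<le> exp_bound m r A" unfolding exp_bound_def using A by (simp add: add_increasing2)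
    ultimately show ?thesis by (intro exI[of _ "\<lambda>_. 1"]) auto
  next
    case False
    then have kpos: "0 < k" using km' by simp
    define G where "G s = (\<integral>\<^sup>+z. ennreal (\<kappa> z) * ennreal (1 + r powr m * \<bar>s - Re (z0 + z)\<bar> powr (-m)) \<partial>lborel)" for s
    have Gm [measurable]: "G \<in> borel_measurable borel" unfolding G_def by measurable
    have le: "ennreal (exp (c (\<gamma> s - z0))) \<le> ennreal (1 / k) * G s" if True: "s \<in> I" for s
    proof -
        let ?v = "\<gamma> s - z0"
        have "ennreal (k * exp (c ?v)) \<le> (\<integral>\<^sup>+z. ennreal (\<kappa> z * exp (k * F ?v z)) \<partial>lborel)"
          by (rule exp_integral_le[OF k0 ki kF k_def c_def])
        also have "\<dots> \<le> G s" unfolding G_def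
        proof (rule nn_integral_mono_AE)
          \<comment> \<open>On this line the majorant is worthless, since \<open>0 powr (-m)\<close>
            is 0 by convention; the line is null.\<close>
          have "AE z in lborel. Re z \<noteq> s - Re z0"
          proof -
            have "{z::complex. Re z = s - Re z0} = {z. 1 \<bullet> z = s - Re z0}" by (simp add: inner_complex_def)
            then have "negligible {z::complex. Re z = s - Re z0}"
              using negligible_hyperplane[of "1::complex" "s - Re z0"] by simp
            moreover have "{z::complex. Re z = s - Re z0} \<in> sets borel" by measurable
            ultimately have "{z::complex. Re z = s - Re z0} \<in> null_sets lborel"
              by (simp add: negligible_iff_null_sets null_sets_completion_iff)
            from AE_not_in[OF this] show ?thesis by simp
          qed
          then show "AE z in lborel. ennreal (\<kappa> z * exp (k * F ?v z)) \<le> ennreal (\<kappa> z) * ennreal (1 + r powr m * \<bar>s - Re (z0 + z)\<bar> powr (-m))"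
          proof eventually_elim
            case (elim z)
            define D where "D = \<bar>s - Re (z0 + z)\<bar>"
            have D: "0 < D" using elim unfolding D_def by auto
            have "D \<le> cmod (z - ?v)"
              using abs_Re_le_cmod[of "z - ?v"] \<gamma>(2)[of s] unfolding D_def by (simp add: abs_minus_commute algebra_simps)
            then have cz: "0 < cmod (z - ?v)" "D \<le> cmod (z - ?v)" using D by auto
            have "exp (k * F ?v z) \<le> exp (m * F ?v z)" using km' F0 by (simp add: mult_right_mono)
            also have "\<dots> \<le> 1 + (r / cmod (z - ?v)) powr m"
            proof (cases "ln (r / cmod (z - ?v)) \<le> 0")
              case True
              then show ?thesis unfolding F_def by simp
            next
              case False
              then have "exp (m * F ?v z) = (r / cmod (z - ?v)) powr m"
                unfolding F_def powr_def using r cz by simp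
              then show ?thesis by simp
            qed
            also have "(r / cmod (z - ?v)) powr m \<le> (r / D) powr m"
              using r D cz m by (intro powr_mono2 divide_left_mono) auto
            also have "(r / D) powr m = r powr m * D powr (-m)"
              using r D by (simp add: powr_divide powr_minus_divide)
            finally have "exp (k * F ?v z) \<le> 1 + r powr m * D powr (-m)" by simp
            then show ?case unfolding D_def[symmetric] using k0[of z]
              by (subst ennreal_mult'[symmetric]) (auto intro!: ennreal_leI mult_left_mono)
          qed
        qed
        finally have "ennreal (1 / k) * ennreal (k * exp (c ?v)) \<le> ennreal (1 / k) * G s" by (intro mult_left_mono) auto
        then show ?thesis using True kpos by (simp add: ennreal_mult'[symmetric])
    qed
    have "(\<integral>\<^sup>+s\<in>I. ennreal (1 / k) * G s \<partial>lborel) = ennreal (1 / k) * (\<integral>\<^sup>+s. G s * indicator I s \<partial>lborel)"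
      unfolding mult.assoc by (rule nn_integral_cmult) measurable
    also have "(\<integral>\<^sup>+s. G s * indicator I s \<partial>lborel) = (\<integral>\<^sup>+s. (\<integral>\<^sup>+z. ennreal (\<kappa> z) * (ennreal (1 + r powr m * \<bar>s - Re (z0 + z)\<bar> powr (-m)) * indicator I s) \<partial>lborel) \<partial>lborel)"
      unfolding G_def by (subst nn_integral_multc[symmetric]) (auto simp: mult.assoc)
    also have "\<dots> = (\<integral>\<^sup>+z. (\<integral>\<^sup>+s. ennreal (\<kappa> z) * (ennreal (1 + r powr m * \<bar>s - Re (z0 + z)\<bar> powr (-m)) * indicator I s) \<partial>lborel) \<partial>lborel)"
      by (rule lborel_pair.Fubini') measurable
    also have "\<dots> = (\<integral>\<^sup>+z. ennreal (\<kappa> z) * (\<integral>\<^sup>+s\<in>I. ennreal (1 + r powr m * \<bar>s - Re (z0 + z)\<bar> powr (-m)) \<partial>lborel) \<partial>lborel)"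
      by (subst nn_integral_cmult) auto
    also have "\<dots> \<le> (\<integral>\<^sup>+z. ennreal (\<kappa> z) * exp_bound m r A \<partial>lborel)"
      by (intro nn_integral_mono mult_left_mono nn_integral_powr_le_exp_bound m I A) auto
    also have "\<dots> = ennreal k * exp_bound m r A"
      using nn_integral_eq_integral[OF ki] k0 by (subst nn_integral_multc) (auto simp: k_def)
    also have "ennreal (1 / k) * (ennreal k * exp_bound m r A) = exp_bound m r A"
      using kpos by (simp add: mult.assoc[symmetric] ennreal_mult'[symmetric])
    finally have "(\<integral>\<^sup>+s\<in>I. ennreal (1 / k) * G s \<partial>lborel) \<le> exp_bound m r A" by (simp add: mult_left_mono)
    then show ?thesis using le by (intro exI[of _ "\<lambda>s. ennreal (1 / k) * G s"]) auto
  qed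
  then obtain H where H [measurable]: "H \<in> borel_measurable borel" and Hc: "\<And>s. s \<in> I \<Longrightarrow> ennreal (exp (c (\<gamma> s - z0))) \<le> H s"
    and HI: "(\<integral>\<^sup>+s\<in>I. H s \<partial>lborel) \<le> exp_bound m r A" by blast
  have "(\<integral>\<^sup>+s\<in>I. ennreal (exp (- smoothing h u (\<gamma> s))) \<partial>lborel) \<le> (\<integral>\<^sup>+s. ennreal (exp C) * (H s * indicator I s) \<partial>lborel)"
  proof (rule nn_integral_mono)
    fix s :: real
    show "ennreal (exp (- smoothing h u (\<gamma> s))) * indicator I s \<le> ennreal (exp C) * (H s * indicator I s)"
    proof (cases "s \<in> I")
      case True
      have "ennreal (exp (- smoothing h u (\<gamma> s))) \<le> ennreal (exp C * exp (c (\<gamma> s - z0)))"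
        using lowbound[OF \<gamma>(1)[OF True]] by (intro ennreal_leI) (simp add: exp_add[symmetric])
      also have "\<dots> \<le> ennreal (exp C) * H s"
        using Hc[OF True] by (subst ennreal_mult') (auto intro!: mult_left_mono)
      finally show ?thesis using True by simp
    qed simp
  qed
  also have "\<dots> = ennreal (exp C) * (\<integral>\<^sup>+s\<in>I. H s \<partial>lborel)" by (rule nn_integral_cmult) measurable
  also have "\<dots> \<le> ennreal (exp C) * exp_bound m r A" using HI by (intro mult_left_mono) auto
  finally show ?thesis unfolding r_def .
qed

text \<open>The hypothesis on the slope is strict, hence passes to the smoothed function once
  \<open>h\<close> is small; \<open>riesz_mass_bound\<close> then leaves mass at most
  \<open>m\<close> in the disc of radius \<open>d * R\<close>. As the bound is free of
  \<open>h\<close>, Fatou's lemma transfers it to \<open>u\<close>.\<close>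

lemma exp_integral_bound:
  assumes u: "submean u" and m: "0 < m" "m < 1" and R: "0 < R" "R < R'" and d: "0 < d" "d < 1"
    and slope: "conv (disc_kernel R') u z0 - conv (disc_kernel R) u z0 < m * (ln (R' / R) * (1 - d^2))"
    and lower: "\<And>w. cmod (w - z0) \<le> d * R \<Longrightarrow> - C \<le> conv (disc_kernel (d * R / 2)) u w"
    and I [measurable]: "I \<in> sets borel" and A: "emeasure lborel I \<le> ennreal A" "0 \<le> A"
    and \<gamma>: "\<And>s. s \<in> I \<Longrightarrow> cmod (\<gamma> s - z0) \<le> d * R / 2" "\<And>s. Re (\<gamma> s) = s"
    and \<gamma>m [measurable]: "\<gamma> \<in> borel_measurable borel"
  shows "(\<integral>\<^sup>+s\<in>I. ennreal (exp (- u (\<gamma> s))) \<partial>lborel) \<le> ennreal (exp C) * exp_bound m (d * R / 2) A"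
proof -
  have cu: "continuous_on UNIV u" using u by (simp add: submean_def)
  let ?\<rho> = "d * R"
  have \<rho>: "0 < ?\<rho>" using d R by simp
  have lnpos: "0 < ln (R' / R) * (1 - d^2)"
    using R d by (intro mult_pos_pos) (auto simp: power_less_one_iff abs_square_less_1)
  have ev: "eventually (\<lambda>h. (\<integral>\<^sup>+s\<in>I. ennreal (exp (- smoothing h u (\<gamma> s))) \<partial>lborel) \<le> ennreal (exp C) * exp_bound m (?\<rho> / 2) A) (at_right 0)"
  proof -
    have "((\<lambda>h. conv (disc_kernel R') (smoothing h u) z0 - conv (disc_kernel R) (smoothing h u) z0) \<longlongrightarrow>
      conv (disc_kernel R') u z0 - conv (disc_kernel R) u z0) (at_right 0)"
      by (intro tendsto_intros conv_disc_smoothing_tendsto[OF cu])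
    from order_tendstoD(2)[OF this slope]
    have "eventually (\<lambda>h. conv (disc_kernel R') (smoothing h u) z0 - conv (disc_kernel R) (smoothing h u) z0 < m * (ln (R' / R) * (1 - d^2))) (at_right 0)" .
    \<comment> \<open>The smoothing at a point within \<open>\<rho> / 2\<close> of \<open>z0\<close>
      then involves only points within \<rho>, where \<open>lower\<close> holds.\<close>
    moreover have "eventually (\<lambda>h. 0 < h \<and> h < ?\<rho> / 2) (at_right 0)" using \<rho> by (auto simp: eventually_at_right_field intro!: exI[of _ "?\<rho> / 2"])
    ultimately show ?thesis
    proof eventually_elim
      case (elim h)
      then have h: "0 < h" "h < ?\<rho> / 2" by auto
      show ?case
      proof (rule smoothing_exp_integral[OF u h(1) m \<rho> _ _ I A \<gamma>])
        have "ln (R' / R) * (1 - d^2) * (\<integral>z. indicator (ball 0 ?\<rho>) z * riesz_density h u (z0 + z) \<partial>lborel) \<le> m * (ln (R' / R) * (1 - d^2))"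
          using riesz_mass_bound[OF u h(1) R d(1), of z0] elim d by linarith
        then show "(\<integral>z. indicator (ball 0 ?\<rho>) z * riesz_density h u (z0 + z) \<partial>lborel) \<le> m"
          using lnpos by (subst (asm) mult.commute) (auto dest: mult_right_le_imp_le)
        fix w assume w: "cmod (w - z0) \<le> ?\<rho> / 2"
        show "- C \<le> conv (disc_kernel (?\<rho> / 2)) (smoothing h u) w"
          unfolding conv_disc_smoothing[OF cu h(1)]
        proof (rule smoothing_ge[OF conv_continuous[OF kernel_disc cu] h(1)])
          fix z assume "cmod z \<le> h"
          then have "cmod ((w - z0) + z) \<le> ?\<rho>" using w h by (intro norm_triangle_le) auto
          then show "- C \<le> conv (disc_kernel (?\<rho> / 2)) u (w + z)" by (intro lower) (simp add: algebra_simps)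
        qed
      qed
    qed
  qed
  have sq: "filterlim (\<lambda>n. 1 / real (Suc n)) (at_right 0) sequentially"
    unfolding filterlim_at using LIMSEQ_inverse_real_of_nat by (auto simp: divide_inverse)
  have ev': "eventually (\<lambda>n. (\<integral>\<^sup>+s\<in>I. ennreal (exp (- smoothing (1 / real (Suc n)) u (\<gamma> s))) \<partial>lborel) \<le> ennreal (exp C) * exp_bound m (?\<rho> / 2) A) sequentially"
    by (rule eventually_compose_filterlim[OF ev sq])
  have lim: "(\<lambda>n. smoothing (1 / real (Suc n)) u w) \<longlonglongrightarrow> u w" for w
    by (rule filterlim_compose[OF smoothing_tendsto[OF cu] sq])
  have "(\<integral>\<^sup>+s\<in>I. ennreal (exp (- u (\<gamma> s))) \<partial>lborel) = (\<integral>\<^sup>+s. liminf (\<lambda>n. ennreal (exp (- smoothing (1 / real (Suc n)) u (\<gamma> s))) * indicator I s) \<partial>lborel)"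
  proof (rule nn_integral_cong)
    fix s :: real
    have "(\<lambda>n. ennreal (exp (- smoothing (1 / real (Suc n)) u (\<gamma> s))) * indicator I s) \<longlonglongrightarrow> ennreal (exp (- u (\<gamma> s))) * indicator I s"
      using lim[of "\<gamma> s"] by (cases "s \<in> I") (auto intro!: tendsto_intros)
    then show "ennreal (exp (- u (\<gamma> s))) * indicator I s = liminf (\<lambda>n. ennreal (exp (- smoothing (1 / real (Suc n)) u (\<gamma> s))) * indicator I s)"
      by (metis lim_imp_Liminf sequentially_bot)
  qed
  also have "\<dots> \<le> liminf (\<lambda>n. \<integral>\<^sup>+s. ennreal (exp (- smoothing (1 / real (Suc n)) u (\<gamma> s))) * indicator I s \<partial>lborel)"
  proof (rule nn_integral_liminf)
    fix n
    note [measurable] = continuous_borel[OF smoothing_continuous[OF cu, of "1 / real (Suc n)"]]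
    show "(\<lambda>s. ennreal (exp (- smoothing (1 / real (Suc n)) u (\<gamma> s))) * indicator I s) \<in> borel_measurable lborel" by measurable
  qed
  also have "\<dots> \<le> liminf (\<lambda>n::nat. ennreal (exp C) * exp_bound m (?\<rho> / 2) A)"
    by (rule Liminf_mono[OF ev'])
  finally show ?thesis by (simp add: Liminf_const)
qed

section \<open>Disc means of a subharmonic function\<close>

lemma subharmonic_borel: "subharmonic \<phi> \<Longrightarrow> \<phi> \<in> borel_measurable borel"
  using usc_ereal_borel by (auto simp: subharmonic_def)

lemma subharmonic_bounded_above:
  assumes "subharmonic \<phi>"
  obtains M :: real where "\<And>w. w \<in> cball z R \<Longrightarrow> \<phi> w \<le> ereal M"
  using usc_ereal_bounded_above[of \<phi> "cball z R"] assms by (auto simp: subharmonic_def)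

text \<open>At one point where \<phi> is finite, the disc inequality bounds the integral of
  \<open>M - \<phi>\<close> for every radius, and the discs about that point exhaust the
  plane.\<close>

lemma subharmonic_integrable_aux:
  assumes sub: "subharmonic \<phi>" and z1: "\<phi> z1 \<noteq> -\<infinity>" and R: "0 < R"
  shows "AE z in lborel. z \<in> ball z1 R \<longrightarrow> \<phi> z \<noteq> -\<infinity>"
    and "integrable lborel (\<lambda>z. indicator (ball z1 R) z * real_of_ereal (\<phi> z))"
proof -
  note [measurable] = subharmonic_borel[OF sub]
  obtain M where M: "\<And>w. w \<in> cball z1 R \<Longrightarrow> \<phi> w \<le> ereal M" using subharmonic_bounded_above[OF sub] by blast
  have fin: "\<phi> z < \<infinity>" for z using sub by (simp add: subharmonic_def)
  define G where "G z = e2ennreal (ereal M - \<phi> z) * indicator (ball z1 R) z" for z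
  have Gm [measurable]: "G \<in> borel_measurable borel" unfolding G_def by measurable
  have "(\<integral>\<^sup>+z. G z \<partial>lborel) = (\<integral>\<^sup>+z. G (z1 + z) \<partial>lborel)" by (rule nn_integral_translation[symmetric]) measurable
  also have "\<dots> = (\<integral>\<^sup>+x\<in>ball 0 R. e2ennreal (ereal M - \<phi> (z1 + x)) \<partial>lborel)"
    unfolding G_def by (intro nn_integral_cong) (simp add: indicator_def dist_norm)
  also have "\<dots> \<le> ennreal (pi * R^2) * e2ennreal (ereal M - \<phi> z1)"
    by (rule subharmonic_disc_nn_integral[OF sub M R])
  also have "\<dots> < \<infinity>"
    using z1 fin[of z1] by (cases "\<phi> z1") (auto simp: ennreal_mult_less_top)
  finally have Gfin: "(\<integral>\<^sup>+z. G z \<partial>lborel) < \<infinity>" .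
  have "AE z in lborel. G z \<noteq> \<infinity>" by (rule nn_integral_PInf_AE) (use Gfin in auto)
  then show ae: "AE z in lborel. z \<in> ball z1 R \<longrightarrow> \<phi> z \<noteq> -\<infinity>"
    by eventually_elim (auto simp: G_def)
  have i1: "integrable lborel (\<lambda>z. indicator (ball z1 R) z * (M - real_of_ereal (\<phi> z)))"
  proof (rule integrableI_bounded)
    have "(\<integral>\<^sup>+z. ennreal (norm (indicator (ball z1 R) z * (M - real_of_ereal (\<phi> z)))) \<partial>lborel) = (\<integral>\<^sup>+z. G z \<partial>lborel)"
    proof (rule nn_integral_cong_AE)
      show "AE z in lborel. ennreal (norm (indicator (ball z1 R) z * (M - real_of_ereal (\<phi> z)))) = G z"
        using ae
      proof eventually_elim
        case (elim z)
        show ?case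
        proof (cases "z \<in> ball z1 R")
          case True
          then obtain p where p: "\<phi> z = ereal p" using elim fin[of z] by (cases "\<phi> z") auto
          have "z \<in> cball z1 R" using True by simp
          then have "p \<le> M" using M[of z] p by simp
          then show ?thesis using True p by (simp add: G_def)
        qed (simp add: G_def)
      qed
    qed
    then show "(\<integral>\<^sup>+z. ennreal (norm (indicator (ball z1 R) z * (M - real_of_ereal (\<phi> z)))) \<partial>lborel) < \<infinity>"
      using Gfin by simp
  qed measurable
  have "integrable lborel (\<lambda>z. M * indicator (ball z1 R) z - indicator (ball z1 R) z * (M - real_of_ereal (\<phi> z)))"
    by (intro Bochner_Integration.integrable_diff integrable_mult_right integrable_ball_indicator i1)
  then show "integrable lborel (\<lambda>z. indicator (ball z1 R) z * real_of_ereal (\<phi> z))"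
    by (simp add: algebra_simps)
qed

locale subharmonic_function =
  fixes \<phi> :: "complex \<Rightarrow> ereal"
  assumes sub: "subharmonic \<phi>" and proper: "\<exists>z. \<phi> z \<noteq> - \<infinity>"
begin

text \<open>\<open>real_of_ereal\<close> sends \<open>-\<infinity>\<close> to 0, a value without
  meaning here; by \<open>AE_phi_eq_real_phi\<close> this happens only on a null set.\<close>

definition real_phi :: "complex \<Rightarrow> real" where "real_phi z = real_of_ereal (\<phi> z)"

definition U :: "real \<Rightarrow> complex \<Rightarrow> real" where "U r = conv (disc_kernel r) real_phi"

lemma phi_borel [measurable]: "\<phi> \<in> borel_measurable borel" by (rule subharmonic_borel[OF sub])

lemma real_phi_borel [measurable]: "real_phi \<in> borel_measurable borel" unfolding real_phi_def[abs_def] by measurable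

lemma phi_less_infinity: "\<phi> z < \<infinity>" using sub by (simp add: subharmonic_def)

lemma phi_eq_real_phi: "\<phi> z \<noteq> -\<infinity> \<Longrightarrow> \<phi> z = ereal (real_phi z)"
  unfolding real_phi_def using phi_less_infinity[of z] by (cases "\<phi> z") auto

lemma AE_phi_eq_real_phi: "AE z in lborel. \<phi> z = ereal (real_phi z)"
proof -
  obtain z1 where z1: "\<phi> z1 \<noteq> -\<infinity>" using proper by blast
  have "AE z in lborel. \<forall>n::nat. z \<in> ball z1 (real (Suc n)) \<longrightarrow> \<phi> z \<noteq> -\<infinity>"
    unfolding AE_all_countable using subharmonic_integrable_aux(1)[OF sub z1] by auto
  then show ?thesis
  proof eventually_elim
    case (elim z)
    obtain n where "dist z1 z < real n" using reals_Archimedean2 by blast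
    then have "z \<in> ball z1 (real (Suc n))" by simp
    then show ?case using elim phi_eq_real_phi by blast
  qed
qed

lemma AE_phi_eq_real_phi_shift: "AE z in lborel. \<phi> (w + z) = ereal (real_phi (w + z))"
proof -
  have "AE z in distr lborel borel ((+) w). \<phi> z = ereal (real_phi z)" unfolding lborel_distr_plus by (rule AE_phi_eq_real_phi)
  then show ?thesis by (subst (asm) AE_distr_iff) auto
qed

lemma real_phi_locally_integrable: "locally_integrable real_phi"
  unfolding locally_integrable_def
proof (intro conjI allI impI real_phi_borel)
  fix R :: real assume R: "0 < R"
  obtain z1 where z1: "\<phi> z1 \<noteq> -\<infinity>" using proper by blast
  have i: "integrable lborel (\<lambda>z. indicator (ball z1 (R + cmod z1)) z * real_phi z)"
    unfolding real_phi_def by (rule subharmonic_integrable_aux(2)[OF sub z1]) (use R in \<open>simp add: add_pos_nonneg\<close>)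
  show "integrable lborel (\<lambda>z. indicator (ball 0 R) z * real_phi z)"
  proof (rule Bochner_Integration.integrable_bound[OF i])
    show "AE z in lborel. norm (indicator (ball 0 R) z * real_phi z) \<le> norm (indicator (ball z1 (R + cmod z1)) z * real_phi z)"
    proof (rule AE_I2)
      fix z :: complex
      have "z \<in> ball z1 (R + cmod z1)" if "cmod z < R"
        using that norm_triangle_ineq4[of z1 z] by (simp add: dist_norm)
      then show "norm (indicator (ball 0 R) z * real_phi z) \<le> norm (indicator (ball z1 (R + cmod z1)) z * real_phi z)"
        by (auto simp: indicator_def)
    qed
  qed measurable
qed

lemma U_continuous: "0 < r \<Longrightarrow> continuous_on UNIV (U r)"
  unfolding U_def by (rule conv_disc_continuous[OF real_phi_locally_integrable])

lemma real_phi_disc_integrable: "0 < r \<Longrightarrow> integrable lborel (\<lambda>x. disc_kernel r x * real_phi (w + x))"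
  by (rule disc_kernel_locally_integrable(1)[OF real_phi_locally_integrable])

lemma disc_const_minus_real_phi:
  assumes r: "0 < r"
  shows "integrable lborel (\<lambda>x. disc_kernel r x * (M - real_phi (w + x)))"
    and "(\<integral>x. disc_kernel r x * (M - real_phi (w + x)) \<partial>lborel) = M - U r w"
  using disc_kernel_integral[OF r] disc_kernel_integrable[of r] real_phi_disc_integrable[OF r, of w]
  unfolding U_def conv_def right_diff_distrib by auto

lemma phi_le_U:
  assumes r: "0 < r"
  shows "\<phi> w \<le> ereal (U r w)"
proof (cases "\<phi> w = -\<infinity>")
  case False
  obtain M where M: "\<And>u. u \<in> cball w r \<Longrightarrow> \<phi> u \<le> ereal M" using subharmonic_bounded_above[OF sub] by blast
  obtain p where p: "\<phi> w = ereal p" using False phi_less_infinity[of w] by (cases "\<phi> w") auto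
  have pM: "p \<le> M" using M[of w] p r by simp
  have "ennreal (M - U r w) = ennreal (\<integral>x. disc_kernel r x * (M - real_phi (w + x)) \<partial>lborel)"
    using disc_const_minus_real_phi(2)[OF r] by simp
  also have "\<dots> \<le> (\<integral>\<^sup>+x. ennreal (disc_kernel r x * (M - real_phi (w + x))) \<partial>lborel)"
    by (rule ennreal_integral_le_nn_integral[OF disc_const_minus_real_phi(1)[OF r]]) simp
  also have "\<dots> = (\<integral>\<^sup>+x. ennreal (1 / (pi * r^2)) * (e2ennreal (ereal M - \<phi> (w + x)) * indicator (ball 0 r) x) \<partial>lborel)"
  proof (rule nn_integral_cong_AE)
    show "AE x in lborel. ennreal (disc_kernel r x * (M - real_phi (w + x))) = ennreal (1 / (pi * r^2)) * (e2ennreal (ereal M - \<phi> (w + x)) * indicator (ball 0 r) x)"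
      using AE_phi_eq_real_phi_shift[of w]
      by eventually_elim (use r in \<open>auto simp: disc_kernel_def indicator_def ennreal_mult'[symmetric]\<close>)
  qed
  also have "\<dots> = ennreal (1 / (pi * r^2)) * (\<integral>\<^sup>+x\<in>ball 0 r. e2ennreal (ereal M - \<phi> (w + x)) \<partial>lborel)"
    by (rule nn_integral_cmult) measurable
  also have "\<dots> \<le> ennreal (1 / (pi * r^2)) * (ennreal (pi * r^2) * e2ennreal (ereal M - \<phi> w))"
    by (intro mult_left_mono subharmonic_disc_nn_integral[OF sub M r]) auto
  also have "\<dots> = ennreal (M - p)" using r by (simp add: p mult.assoc[symmetric] ennreal_mult'[symmetric])
  finally have "M - U r w \<le> M - p" using pM by (simp add: ennreal_le_iff)
  then show ?thesis using p by simp
qed simp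

text \<open>The inequality \<open>\<phi> \<le> U r\<close>, averaged over discs of radius
  \<open>s\<close>, becomes the claim after the two disc means are interchanged.\<close>

lemma U_submean:
  assumes s: "0 < s"
  shows "submean (U s)"
  unfolding submean_def
proof (intro conjI allI impI U_continuous s)
  fix w and r :: real assume r: "0 < r"
  have "U s w \<le> conv (disc_kernel s) (U r) w"
    unfolding U_def[of s] conv_def
  proof (rule integral_mono_AE[OF real_phi_disc_integrable[OF s] conv_integrable[OF kernel_disc U_continuous[OF r]]])
    show "AE z in lborel. disc_kernel s z * real_phi (w + z) \<le> disc_kernel s z * U r (w + z)"
      using AE_phi_eq_real_phi_shift[of w]
    proof eventually_elim
      case (elim z)
      then have "real_phi (w + z) \<le> U r (w + z)" using phi_le_U[OF r, of "w + z"] by simp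
      then show ?case by (intro mult_left_mono disc_kernel_nonneg)
    qed
  qed
  also have "\<dots> = conv (disc_kernel r) (U s) w"
    unfolding U_def by (rule conv_disc_commute[OF real_phi_locally_integrable s r])
  finally show "U s w \<le> conv (disc_kernel r) (U s) w" .
qed

lemma conv_disc_U: "0 < r \<Longrightarrow> 0 < s \<Longrightarrow> conv (disc_kernel r) (U s) w = conv (disc_kernel s) (U r) w"
  unfolding U_def by (rule conv_disc_commute[OF real_phi_locally_integrable])

text \<open>Interchanging the disc means turns the limit in the function into an approximate
  identity applied to the continuous \<open>U r\<close>.\<close>

lemma conv_disc_U_tendsto:
  assumes "0 < r"
  shows "((\<lambda>s. conv (disc_kernel r) (U s) w) \<longlongrightarrow> U r w) (at_right 0)"
proof (rule Lim_transform_eventually[OF conv_disc_tendsto[OF U_continuous[OF assms]]])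
  show "eventually (\<lambda>s. conv (disc_kernel s) (U r) w = conv (disc_kernel r) (U s) w) (at_right 0)"
    using eventually_at_right_less[of 0] by eventually_elim (simp add: conv_disc_U assms)
qed

lemma U_log_convex:
  assumes t: "0 \<le> t" "t \<le> 1"
  shows "U (exp ((1 - t) * x + t * y)) w \<le> (1 - t) * U (exp x) w + t * U (exp y) w"
proof (rule tendsto_le)
  show "((\<lambda>s. conv (disc_kernel (exp ((1 - t) * x + t * y))) (U s) w) \<longlongrightarrow> U (exp ((1 - t) * x + t * y)) w) (at_right 0)"
    by (intro conv_disc_U_tendsto) simp
  show "((\<lambda>s. (1 - t) * conv (disc_kernel (exp x)) (U s) w + t * conv (disc_kernel (exp y)) (U s) w) \<longlongrightarrow> (1 - t) * U (exp x) w + t * U (exp y) w) (at_right 0)"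
    by (intro tendsto_intros conv_disc_U_tendsto) auto
  show "eventually (\<lambda>s. conv (disc_kernel (exp ((1 - t) * x + t * y))) (U s) w \<le> (1 - t) * conv (disc_kernel (exp x)) (U s) w + t * conv (disc_kernel (exp y)) (U s) w) (at_right 0)"
    using eventually_at_right_less[of 0] by eventually_elim (intro disc_mean_log_convex U_submean t)
qed simp

lemma U_mono:
  assumes r: "0 < r" "r \<le> s"
  shows "U r w \<le> U s w"
proof (rule tendsto_le[OF _ conv_disc_U_tendsto conv_disc_U_tendsto])
  show "eventually (\<lambda>h. conv (disc_kernel r) (U h) w \<le> conv (disc_kernel s) (U h) w) (at_right 0)"
    using eventually_at_right_less[of 0] by eventually_elim (intro disc_mean_mono U_submean r)
qed (use r in auto)

lemma U_le_const:
  assumes s: "0 < s" and le: "\<And>z. cmod z < s \<Longrightarrow> \<phi> (w + z) \<le> ereal c"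
  shows "U s w \<le> c"
proof -
  have "U s w \<le> (\<integral>z. disc_kernel s z * c \<partial>lborel)"
    unfolding U_def conv_def
  proof (rule integral_mono_AE[OF real_phi_disc_integrable[OF s]])
    show "integrable lborel (\<lambda>z. disc_kernel s z * c)" using disc_kernel_integrable by simp
    show "AE z in lborel. disc_kernel s z * real_phi (w + z) \<le> disc_kernel s z * c"
      using AE_phi_eq_real_phi_shift[of w]
    proof eventually_elim
      case (elim z)
      show ?case
      proof (cases "cmod z < s")
        case True
        then have "real_phi (w + z) \<le> c" using le[OF True] elim by simp
        then show ?thesis by (intro mult_left_mono disc_kernel_nonneg)
      qed (simp add: disc_kernel_def)
    qed
  qed
  then show ?thesis using disc_kernel_integral[OF s] by simp
qed

lemma U_limsup:
  assumes "\<phi> w < ereal c"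
  shows "eventually (\<lambda>s. U s w \<le> c) (at_right 0)"
proof -
  have "open {v. \<phi> v < ereal c}" using usc_ereal_open_less sub by (auto simp: subharmonic_def)
  then obtain d where d: "d > 0" "ball w d \<subseteq> {v. \<phi> v < ereal c}" using assms by (metis mem_Collect_eq openE)
  have "eventually (\<lambda>h. 0 < h \<and> h < d) (at_right 0)" using d(1) by (auto simp: eventually_at_right_field intro!: exI[of _ d])
  then show ?thesis
  proof eventually_elim
    case (elim s)
    show ?case
    proof (rule U_le_const)
      fix z assume "cmod z < s"
      then have "w + z \<in> ball w d" using elim by (simp add: dist_norm)
      then show "\<phi> (w + z) \<le> ereal c" using d(2) by force
    qed (use elim in simp)
  qed
qed

text \<open>A Harnack-type estimate: the disc of radius \<open>R1\<close> about \<open>w\<close>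
  contains the disc of radius \<open>R2\<close> about \<open>z0\<close> and lies where
  \<open>M - \<phi> \<ge> 0\<close>, so enlarging the domain of integration costs just the ratio of
  the areas. Means centred at \<open>z0\<close> thereby bound \<phi> at nearby points.\<close>

lemma phi_le_concentric:
  assumes M: "\<And>u. u \<in> cball z0 R \<Longrightarrow> \<phi> u \<le> ereal M"
    and R2: "0 < R2" and R1: "cmod (w - z0) + R2 \<le> R1" "cmod (w - z0) + R1 \<le> R"
  shows "\<phi> w \<le> ereal (M + (R2 / R1)^2 * (U R2 z0 - M))"
proof -
  have R1p: "0 < R1" using R1 R2 norm_ge_zero[of "w - z0"] by linarith
  define D where "D = w - z0"
  have tr: "(\<integral>x. disc_kernel R1 (- D + x) * (M - real_phi (w + (- D + x))) \<partial>lborel) = M - U R1 w"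
    using integral_translation[of "\<lambda>x. disc_kernel R1 x * (M - real_phi (w + x))" "- D"] disc_const_minus_real_phi(2)[OF R1p] by simp
  have tri: "integrable lborel (\<lambda>x. disc_kernel R1 (- D + x) * (M - real_phi (w + (- D + x))))"
    using disc_const_minus_real_phi(1)[OF R1p, of M w] by (subst integrable_translation_iff) auto
  have eq: "w + (- D + x) = z0 + x" for x by (simp add: D_def)
  have "(R2 / R1)^2 * (M - U R2 z0) = (\<integral>x. (R2 / R1)^2 * (disc_kernel R2 x * (M - real_phi (z0 + x))) \<partial>lborel)"
    using disc_const_minus_real_phi(2)[OF R2, of M z0] by simp
  also have "\<dots> \<le> (\<integral>x. disc_kernel R1 (- D + x) * (M - real_phi (z0 + x)) \<partial>lborel)"
  proof (rule integral_mono_AE)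
    show "integrable lborel (\<lambda>x. (R2 / R1)^2 * (disc_kernel R2 x * (M - real_phi (z0 + x))))"
      by (intro integrable_mult_right disc_const_minus_real_phi(1) R2)
    show "integrable lborel (\<lambda>x. disc_kernel R1 (- D + x) * (M - real_phi (z0 + x)))" using tri unfolding eq .
    show "AE x in lborel. (R2 / R1)^2 * (disc_kernel R2 x * (M - real_phi (z0 + x))) \<le> disc_kernel R1 (- D + x) * (M - real_phi (z0 + x))"
      using AE_phi_eq_real_phi_shift[of z0]
    proof eventually_elim
      case (elim x)
      show ?case
      proof (cases "cmod (- D + x) < R1")
        case True
        have "cmod x \<le> cmod D + cmod (- D + x)" using norm_triangle_ineq[of D "- D + x"] by simp
        then have "z0 + x \<in> cball z0 R" using True R1(2) unfolding D_def by (simp add: dist_norm)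
        then have "0 \<le> M - real_phi (z0 + x)" using M[of "z0 + x"] elim by simp
        moreover have "(R2 / R1)^2 * disc_kernel R2 x \<le> disc_kernel R1 (- D + x)"
          using True R1p R2 by (auto simp: disc_kernel_def indicator_def power_divide mult.commute)
        ultimately show ?thesis by (simp only: mult.assoc[symmetric] mult_right_mono)
      next
        case False
        have "cmod (- D + x) \<le> cmod D + cmod x" using norm_triangle_ineq[of "- D" x] by simp
        then have "\<not> cmod x < R2" using False R1(1) unfolding D_def by linarith
        then show ?thesis using False by (simp add: disc_kernel_def)
      qed
    qed
  qed
  also have "\<dots> = M - U R1 w" using tr unfolding eq .
  finally have "U R1 w \<le> M + (R2 / R1)^2 * (U R2 z0 - M)" by (simp add: algebra_simps)
  then show ?thesis using phi_le_U[OF R1p, of w] by (meson ereal_less_eq(3) order.trans)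
qed

lemma U_le_Sup_sphere:
  assumes r: "0 < r"
  shows "ereal (U r z0) \<le> (SUP \<zeta>\<in>sphere z0 r. \<phi> \<zeta>)"
proof (rule ccontr)
  assume "\<not> ?thesis"
  then have "(SUP \<zeta>\<in>sphere z0 r. \<phi> \<zeta>) < ereal (U r z0)" by simp
  then obtain c where c: "(SUP \<zeta>\<in>sphere z0 r. \<phi> \<zeta>) < ereal c" "ereal c < ereal (U r z0)" using ereal_dense2 by blast
  have "harmonic (\<lambda>_. c)" using harmonic_Re_holomorphic[of "\<lambda>_. of_real c"] by simp
  have "U r z0 \<le> c"
  proof (rule U_le_const[OF r])
    fix z assume "cmod z < r"
    show "\<phi> (z0 + z) \<le> ereal c"
    proof (rule subharmonic_le_harmonic[OF sub \<open>harmonic (\<lambda>_. c)\<close> r])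
      fix v assume "v \<in> sphere z0 r"
      then have "\<phi> v \<le> (SUP \<zeta>\<in>sphere z0 r. \<phi> \<zeta>)" by (rule SUP_upper)
      then show "\<phi> v \<le> ereal c" using c(1) by (meson less_imp_le order.trans)
    qed (use \<open>cmod z < r\<close> in \<open>simp add: dist_norm\<close>)
  qed
  then show False using c(2) by simp
qed

section \<open>Logarithmic growth of the disc means\<close>

definition slope :: "complex \<Rightarrow> real \<Rightarrow> real" where
  "slope z0 x = (U 1 z0 - U (exp x) z0) / (- x)"

text \<open>By \<open>slope_mono\<close> the chord slopes of \<open>U r z0\<close> as a function of
  \<open>ln r\<close> decrease as the left end goes to minus infinity, so the infimum is their
  limit. As an infimum it bounds every single slope from below.\<close>

definition growth :: "complex \<Rightarrow> real" where
  "growth z0 = (INF x\<in>{..<0}. slope z0 x)"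

lemma slope_nonneg: "x < 0 \<Longrightarrow> 0 \<le> slope z0 x"
  unfolding slope_def using U_mono[of "exp x" 1 z0] by (intro divide_nonneg_pos) auto

lemma slope_bdd: "bdd_below (slope z0 ` {..<0})"
  using slope_nonneg by (intro bdd_belowI2[of _ 0]) auto

lemma growth_le_slope: "x < 0 \<Longrightarrow> growth z0 \<le> slope z0 x"
  unfolding growth_def by (rule cINF_lower[OF slope_bdd]) simp

lemma growth_nonneg: "0 \<le> growth z0"
  unfolding growth_def by (rule cINF_greatest) (auto simp: slope_nonneg intro!: exI[of _ "-1"])

lemma slope_less: "growth z0 < c \<Longrightarrow> \<exists>x<0. slope z0 x < c"
  unfolding growth_def by (subst (asm) cINF_less_iff[OF _ slope_bdd]) auto

lemma slope_mono:
  assumes "x \<le> y" "y < 0"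
  shows "slope z0 x \<le> slope z0 y"
proof -
  \<comment> \<open>The weight that writes \<open>y\<close> as a convex combination of
    \<open>x\<close> and 0; the point 0 corresponds to the radius 1.\<close>
  define t where "t = (x - y) / x"
  have x: "x < 0" using assms by simp
  have t: "0 \<le> t" "t \<le> 1" using x assms unfolding t_def by (auto simp: divide_simps)
  have "(1 - t) * x + t * 0 = y" using x unfolding t_def by (simp add: field_simps)
  then have "U (exp y) z0 \<le> (1 - t) * U (exp x) z0 + t * U 1 z0"
    using U_log_convex[OF t, of x 0 z0] by simp
  moreover have t': "1 - t = y / x" using x unfolding t_def by (simp add: field_simps)
  then have "t = 1 - y / x" by simp
  ultimately have "U (exp y) z0 \<le> (y / x) * U (exp x) z0 + (1 - y / x) * U 1 z0" by simp
  then have "(y / x) * (U 1 z0 - U (exp x) z0) \<le> U 1 z0 - U (exp y) z0" by (simp add: algebra_simps)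
  then have "((y / x) * (U 1 z0 - U (exp x) z0)) / (- y) \<le> (U 1 z0 - U (exp y) z0) / (- y)"
    using assms by (intro divide_right_mono) auto
  moreover have "((y / x) * X) / (- y) = X / (- x)" for X using assms x by (simp add: field_simps)
  ultimately show ?thesis unfolding slope_def by simp
qed

text \<open>This direction holds with the exact constant at every radius up to 1, and the borderline
  growth 1 depends on that; the opposite bound admits only constants above the growth.\<close>

lemma U_le_growth: "0 < r \<Longrightarrow> r \<le> 1 \<Longrightarrow> U r z0 \<le> U 1 z0 + growth z0 * ln r"
proof (cases "r = 1")
  case False
  assume "0 < r" "r \<le> 1"
  then have l: "ln r < 0" using False by simp
  have "growth z0 \<le> (U 1 z0 - U r z0) / (- ln r)"
    using growth_le_slope[OF l, of z0] \<open>0 < r\<close> by (simp add: slope_def)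
  then show ?thesis using l by (simp add: field_simps)
qed simp

lemma U_ge_growth:
  assumes "growth z0 < c"
  shows "eventually (\<lambda>r. U 1 z0 + c * ln r \<le> U r z0) (at_right 0)"
proof -
  obtain x where x: "x < 0" "slope z0 x < c" using slope_less[OF assms] by blast
  have "eventually (\<lambda>r. 0 < r \<and> r < exp x) (at_right 0)" by (auto simp: eventually_at_right_field intro!: exI[of _ "exp x"])
  then show ?thesis
  proof eventually_elim
    case (elim r)
    then have "ln r < ln (exp x)" by (subst ln_less_cancel_iff) auto
    then have l: "ln r < x" by simp
    have "slope z0 (ln r) < c" using slope_mono[of "ln r" x z0] l x by simp
    then have "(U 1 z0 - U r z0) / (- ln r) < c" using elim by (simp add: slope_def)
    then show ?case using l x by (simp add: field_simps)
  qed
qed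

end

section \<open>The Lelong number\<close>

context subharmonic_function
begin

text \<open>\<open>phi_le_concentric\<close> with \<open>R2 = n * r\<close> and
  \<open>R1 = (n + 1) * r\<close>. Both radii are comparable to \<open>r\<close>, so only the ratio
  of areas spoils the coefficient of \<open>ln r\<close>, and it tends to 1 with
  \<open>n\<close>.\<close>

lemma Sup_sphere_le:
  assumes M: "\<And>u. u \<in> cball z0 1 \<Longrightarrow> \<phi> u \<le> ereal M"
    and r: "0 < r" and n: "0 < n" "(real n + 2) * r \<le> 1"
  shows "(SUP \<zeta>\<in>sphere z0 r. \<phi> \<zeta>) \<le> ereal (M + (real n / (real n + 1))^2 * (U 1 z0 + growth z0 * ln (real n * r) - M))"
proof (rule SUP_least)
  fix w assume w: "w \<in> sphere z0 r"
  then have d: "cmod (w - z0) = r" by (simp add: dist_norm norm_minus_commute)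
  have "\<phi> w \<le> ereal (M + (real n * r / ((real n + 1) * r))^2 * (U (real n * r) z0 - M))"
    by (rule phi_le_concentric[OF M]) (use r n d in \<open>auto simp: algebra_simps\<close>)
  also have "\<dots> \<le> ereal (M + (real n / (real n + 1))^2 * (U 1 z0 + growth z0 * ln (real n * r) - M))"
  proof -
    have "U (real n * r) z0 \<le> U 1 z0 + growth z0 * ln (real n * r)"
      by (rule U_le_growth) (use r n in \<open>auto simp: algebra_simps\<close>)
    then have "(real n / (real n + 1))^2 * (U (real n * r) z0 - M) \<le> (real n / (real n + 1))^2 * (U 1 z0 + growth z0 * ln (real n * r) - M)"
      by (intro mult_left_mono) auto
    then show ?thesis using r by simp
  qed
  finally show "\<phi> w \<le> ereal (M + (real n / (real n + 1))^2 * (U 1 z0 + growth z0 * ln (real n * r) - M))" .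
qed

lemma ln_at_right_0_ratio:
  fixes a b c :: real
  assumes "0 < b"
  shows "((\<lambda>r. (a + c * ln (b * r)) / ln r) \<longlongrightarrow> c) (at_right 0)"
proof -
  have inv: "((\<lambda>r. 1 / ln r) \<longlongrightarrow> (0::real)) (at_right 0)"
    by (rule tendsto_divide_0[OF tendsto_const filterlim_mono[OF ln_at_0 at_bot_le_at_infinity order_refl]])
  have "((\<lambda>r. (a + c * ln b) * (1 / ln r) + c) \<longlongrightarrow> (a + c * ln b) * 0 + c) (at_right 0)"
    by (intro tendsto_intros inv)
  then have lim: "((\<lambda>r. (a + c * ln b) * (1 / ln r) + c) \<longlongrightarrow> c) (at_right 0)" by simp
  have "eventually (\<lambda>r::real. 0 < r \<and> r < 1) (at_right 0)" by (auto simp: eventually_at_right_field intro!: exI[of _ 1])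
  then have "eventually (\<lambda>r. (a + c * ln b) * (1 / ln r) + c = (a + c * ln (b * r)) / ln r) (at_right 0)"
  proof eventually_elim
    case (elim r)
    then have "ln r \<noteq> 0" by simp
    then show ?case using elim assms by (simp add: ln_mult field_simps)
  qed
  then show ?thesis by (rule Lim_transform_eventually[OF lim])
qed

text \<open>Since \<open>ln r < 0\<close>, upper bounds for the maximum are lower bounds for the
  quotient: they come from \<open>Sup_sphere_le\<close> with a large fixed \<open>n\<close>. For the
  other half, the maximum on a circle dominates the disc mean, which \<open>U_ge_growth\<close>
  bounds from below.\<close>

theorem lelong_tendsto: "((\<lambda>r. (SUP \<zeta>\<in>sphere z0 r. \<phi> \<zeta>) / ereal (ln r)) \<longlongrightarrow> ereal (growth z0)) (at_right 0)"
proof -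
  define S where "S r = (SUP \<zeta>\<in>sphere z0 r. \<phi> \<zeta>)" for r
  obtain M where M: "\<And>u. u \<in> cball z0 1 \<Longrightarrow> \<phi> u \<le> ereal M" using subharmonic_bounded_above[OF sub] by blast
  have small: "eventually (\<lambda>r::real. 0 < r \<and> r < d) (at_right 0)" if "0 < d" for d
    using that by (auto simp: eventually_at_right_field intro!: exI[of _ d])
  have divneg: "p / ereal l \<le> q / ereal l" if "l < 0" "q \<le> p" for p q l
    using that by (cases p; cases q) (auto simp: divide_ereal_def mult_right_mono_neg ereal_mult_le_0_iff)
  show ?thesis unfolding S_def[symmetric]
  proof (rule order_tendstoI)
    fix c assume "c < ereal (growth z0)"
    then obtain c' where c': "c < ereal c'" "c' < growth z0" using ereal_dense2[of c "ereal (growth z0)"] by auto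
    have "(\<lambda>n. (real n / (real n + 1))^2 * growth z0) \<longlonglongrightarrow> 1^2 * growth z0"
      by (intro tendsto_intros LIMSEQ_n_over_Suc_n[unfolded of_nat_Suc add.commute[of 1]])
    then have "eventually (\<lambda>n. c' < (real n / (real n + 1))^2 * growth z0) sequentially"
      using c'(2) by (intro order_tendstoD(1)) auto
    then have "eventually (\<lambda>n. c' < (real n / (real n + 1))^2 * growth z0 \<and> 0 < n) sequentially"
      using eventually_gt_at_top[of 0] by (rule eventually_conj)
    then obtain n where n: "c' < (real n / (real n + 1))^2 * growth z0" "0 < n"
      by (auto simp: eventually_sequentially)
    let ?k = "(real n / (real n + 1))^2"
    have "((\<lambda>r. ((M + ?k * (U 1 z0 - M)) + (?k * growth z0) * ln (real n * r)) / ln r) \<longlongrightarrow> ?k * growth z0) (at_right 0)"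
      by (rule ln_at_right_0_ratio) (use n in simp)
    from order_tendstoD(1)[OF this n(1)]
    have "eventually (\<lambda>r. c' < ((M + ?k * (U 1 z0 - M)) + (?k * growth z0) * ln (real n * r)) / ln r) (at_right 0)" .
    moreover have "eventually (\<lambda>r. 0 < r \<and> r < min 1 (1 / (real n + 2))) (at_right 0)" by (rule small) simp
    ultimately show "eventually (\<lambda>r. c < S r / ereal (ln r)) (at_right 0)"
    proof eventually_elim
      case (elim r)
      have "0 < r" "r < 1" using elim(2) by (simp_all only: min_less_iff_conj)
      then have l: "ln r < 0" by simp
      have "S r \<le> ereal (M + ?k * (U 1 z0 + growth z0 * ln (real n * r) - M))"
        unfolding S_def by (rule Sup_sphere_le[OF M]) (use elim n in \<open>auto simp: field_simps\<close>)
      then have "ereal (M + ?k * (U 1 z0 + growth z0 * ln (real n * r) - M)) / ereal (ln r) \<le> S r / ereal (ln r)"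
        by (rule divneg[OF l])
      moreover have eq: "M + ?k * (U 1 z0 + growth z0 * ln (real n * r) - M) = (M + ?k * (U 1 z0 - M)) + (?k * growth z0) * ln (real n * r)"
        by (simp add: algebra_simps)
      moreover have "ereal c' < ereal (M + ?k * (U 1 z0 + growth z0 * ln (real n * r) - M)) / ereal (ln r)"
        unfolding eq using elim(1) l by simp
      ultimately have "ereal c' < S r / ereal (ln r)" by order
      then show ?case using c'(1) by order
    qed
  next
    fix c assume "ereal (growth z0) < c"
    then obtain c' where c': "growth z0 < c'" "ereal c' < c" using ereal_dense2[of "ereal (growth z0)" c] by auto
    \<comment> \<open>Strictly between the growth, as \<open>U_ge_growth\<close> demands, and
      \<open>c'\<close>, so that the limit \<open>c2\<close> stays below \<open>c'\<close>.\<close>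
    define c2 where "c2 = (growth z0 + c') / 2"
    have c2: "growth z0 < c2" "c2 < c'" using c'(1) by (auto simp: c2_def)
    have "((\<lambda>r. (U 1 z0 + c2 * ln (1 * r)) / ln r) \<longlongrightarrow> c2) (at_right 0)" by (rule ln_at_right_0_ratio) simp
    from order_tendstoD(2)[OF this c2(2)]
    have "eventually (\<lambda>r. (U 1 z0 + c2 * ln r) / ln r < c') (at_right 0)" by simp
    moreover note U_ge_growth[OF c2(1)]
    moreover have "eventually (\<lambda>r::real. 0 < r \<and> r < 1) (at_right 0)" by (rule small) simp
    ultimately show "eventually (\<lambda>r. S r / ereal (ln r) < c) (at_right 0)"
    proof eventually_elim
      case (elim r)
      have l: "ln r < 0" using elim by simp
      have "ereal (U 1 z0 + c2 * ln r) \<le> ereal (U r z0)" using elim by simp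
      also have "\<dots> \<le> S r" unfolding S_def by (rule U_le_Sup_sphere) (use elim in simp)
      finally have "S r / ereal (ln r) \<le> ereal (U 1 z0 + c2 * ln r) / ereal (ln r)" by (rule divneg[OF l])
      also have "\<dots> < ereal c'" using elim l by simp
      also have "\<dots> < c" by (rule c')
      finally show ?case .
    qed
  qed
qed

corollary lelong_eq_growth: "lelong \<phi> z0 = ereal (growth z0)"
  unfolding lelong_def by (rule tendsto_Lim[OF trivial_limit_at_right_real lelong_tendsto])

end

section \<open>Divergence of the integral of 1 / (x ln (1/x)) at 0\<close>

lemma DERIV_neg_ln_neg_ln:
  fixes x :: real
  assumes x: "0 < x" "x < 1"
  shows "((\<lambda>x. - ln (- ln x)) has_real_derivative 1 / (x * ln (1 / x))) (at x within S)"
proof -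
  have l: "- ln x > 0" using x by simp
  have d1: "((\<lambda>x. - ln x) has_real_derivative (- (1 / x))) (at x within S)"
    using x by (intro DERIV_minus) (auto intro!: derivative_eq_intros simp: divide_inverse)
  have "((\<lambda>x. - ln (- ln x)) has_real_derivative - (1 / (- ln x) * (- (1 / x)))) (at x within S)"
    by (intro DERIV_minus DERIV_chain2[OF _ d1] DERIV_ln_divide l)
  moreover have "- (1 / (- ln x) * (- (1 / x))) = 1 / (x * ln (1 / x))"
    using x by (simp add: ln_div mult.commute)
  ultimately show ?thesis by (rule DERIV_cong)
qed

lemma nn_integral_log_divergent:
  assumes "0 < \<eta>" "\<eta> < 1"
  shows "(\<integral>\<^sup>+x\<in>{0<..<\<eta>}. ennreal (1 / (x * ln (1 / x))) \<partial>lborel) = \<infinity>"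
proof -
  have ge: "ennreal (real n) \<le> (\<integral>\<^sup>+x\<in>{0<..<\<eta>}. ennreal (1 / (x * ln (1 / x))) \<partial>lborel)" for n :: nat
  proof -
    define \<eta>' where "\<eta>' = \<eta> / 2"
    define E where "E = ln (- ln \<eta>')"
    have \<eta>': "0 < \<eta>'" "\<eta>' < \<eta>" "\<eta>' < 1" using assms by (auto simp: \<eta>'_def)
    \<comment> \<open>Solves \<open>ln (- ln \<delta>) = E + real n\<close>, so that the
      antiderivative grows by exactly \<open>n\<close> from \<delta> to
      \<open>\<eta>'\<close>.\<close>
    define \<delta> where "\<delta> = exp (- exp (E + real n))"
    have l: "0 < - ln \<eta>'" using \<eta>' by simp
    have eE: "exp E = - ln \<eta>'" unfolding E_def using l by simp
    have "\<delta> \<le> exp (- exp E)" unfolding \<delta>_def by simp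
    also have "\<dots> = \<eta>'" unfolding eE using \<eta>' by simp
    finally have \<delta>: "0 < \<delta>" "\<delta> \<le> \<eta>'" unfolding \<delta>_def by auto
    define F where "F = (\<lambda>x::real. - ln (- ln x))"
    have m: "(\<lambda>x::real. 1 / (x * ln (1 / x))) \<in> borel_measurable borel" by measurable
    have x01: "0 < x" "x < 1" if "x \<in> {\<delta>..\<eta>'}" for x using that \<delta> \<eta>' by auto
    have d: "DERIV F x :> 1 / (x * ln (1 / x))" if "x \<in> {\<delta>..\<eta>'}" for x
      unfolding F_def by (rule DERIV_neg_ln_neg_ln) (use x01[OF that] in auto)
    have nn: "0 \<le> 1 / (x * ln (1 / x))" if "x \<in> {\<delta>..\<eta>'}" for x
    proof -
      have "0 < x" "x < 1" using x01[OF that] by auto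
      then have "1 < 1 / x" using one_less_inverse[of x] by (simp only: inverse_eq_divide)
      then have "0 < x * ln (1 / x)" using \<open>0 < x\<close> by (intro mult_pos_pos ln_gt_zero)
      then show ?thesis by simp
    qed
    have "(\<integral>\<^sup>+x\<in>{\<delta>..\<eta>'}. ennreal (1 / (x * ln (1 / x))) \<partial>lborel) = ennreal (F \<eta>' - F \<delta>)"
      by (rule nn_integral_FTC_Icc[OF m d nn \<delta>(2)])
    also have "F \<eta>' - F \<delta> = real n" unfolding F_def \<delta>_def E_def[symmetric] by simp
    finally have "ennreal (real n) = (\<integral>\<^sup>+x\<in>{\<delta>..\<eta>'}. ennreal (1 / (x * ln (1 / x))) \<partial>lborel)" ..
    also have "\<dots> \<le> (\<integral>\<^sup>+x\<in>{0<..<\<eta>}. ennreal (1 / (x * ln (1 / x))) \<partial>lborel)"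
      using \<delta> \<eta>' by (intro nn_integral_mono) (auto simp: indicator_def)
    finally show ?thesis .
  qed
  show ?thesis
  proof (rule ccontr)
    assume "\<not> ?thesis"
    then obtain v where v: "(\<integral>\<^sup>+x\<in>{0<..<\<eta>}. ennreal (1 / (x * ln (1 / x))) \<partial>lborel) = ennreal v" "0 \<le> v"
      by (cases "\<integral>\<^sup>+x\<in>{0<..<\<eta>}. ennreal (1 / (x * ln (1 / x))) \<partial>lborel") (auto simp: infinity_ennreal_def)
    obtain n where "v < real n" using reals_Archimedean2 by blast
    then show False using ge[of n] v by (simp add: ennreal_le_iff)
  qed
qed

section \<open>Integrability along a Lipschitz graph\<close>

lemma exp_neg_ereal [simp]: "exp_neg (ereal v) = ennreal (exp (- v))"
  by (simp add: exp_neg_def)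

lemma exp_neg_MInf [simp]: "exp_neg (-\<infinity>) = \<infinity>"
  using MInfty_eq_minfinity by (simp add: exp_neg_def flip: MInfty_eq_minfinity)

lemma exp_neg_PInf [simp]: "exp_neg \<infinity> = 0"
  by (simp add: exp_neg_def flip: PInfty_eq_infinity)

lemma exp_neg_antimono: "x \<le> y \<Longrightarrow> exp_neg y \<le> exp_neg x"
  by (cases x; cases y) (auto intro!: ennreal_leI)

lemma exp_neg_borel [measurable]: "exp_neg \<in> borel_measurable borel"
proof -
  have eq: "exp_neg = (\<lambda>x. if x = \<infinity> then 0 else if x = -\<infinity> then \<infinity> else ennreal (exp (- real_of_ereal x)))"
  proof
    fix x show "exp_neg x = (if x = \<infinity> then 0 else if x = -\<infinity> then \<infinity> else ennreal (exp (- real_of_ereal x)))"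
      by (cases x) auto
  qed
  show ?thesis unfolding eq by measurable
qed

context subharmonic_function
begin

text \<open>Upper semicontinuity keeps the disc means from exceeding \<phi> in the limit
  (\<open>U_limsup\<close>), and this is the direction that Fatou's lemma asks for.\<close>

lemma exp_neg_le_liminf:
  assumes s: "filterlim s (at_right 0) sequentially"
  shows "exp_neg (\<phi> w) \<le> liminf (\<lambda>n. ennreal (exp (- U (s n) w)))"
  unfolding le_Liminf_iff
proof (intro allI impI)
  fix y assume y: "y < exp_neg (\<phi> w)"
  then obtain p where p: "y = ennreal p" "0 \<le> p" by (cases y) auto
  have "\<exists>c. \<phi> w < ereal c \<and> p < exp (- c)"
  proof (cases "\<phi> w = -\<infinity>")
    case True
    have "p < exp (- (- (p + 1)))" using exp_ge_add_one_self[of "p + 1"] by (simp add: add.commute)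
    then show ?thesis using True by (intro exI[of _ "- (p + 1)"]) auto
  next
    case False
    then obtain v where v: "\<phi> w = ereal v" using phi_less_infinity[of w] by (cases "\<phi> w") auto
    then have "p < exp (- v)" using y p by (simp add: ennreal_less_iff)
    then obtain p' where p': "p < p'" "p' < exp (- v)" using dense by blast
    then have "0 < p'" using p(2) by simp
    then have "ln p' < - v" using p'(2) by (metis exp_less_cancel_iff exp_ln)
    then show ?thesis using p'(1) \<open>0 < p'\<close> v by (intro exI[of _ "- ln p'"]) auto
  qed
  then obtain c where c: "\<phi> w < ereal c" "p < exp (- c)" by blast
  have "eventually (\<lambda>n. U (s n) w \<le> c) sequentially"
    by (rule eventually_compose_filterlim[OF U_limsup[OF c(1)] s])
  then show "eventually (\<lambda>n. y < ennreal (exp (- U (s n) w))) sequentially"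
  proof eventually_elim
    case (elim n)
    then have "exp (- c) \<le> exp (- U (s n) w)" by simp
    with c(2) have "p < exp (- U (s n) w)" by linarith
    then show ?case using p by (simp add: ennreal_less_iff)
  qed
qed

text \<open>The gap between the growth and 1 is spent three times: on the mass bound
  \<open>m\<close>, on the factor \<open>1 - d^2\<close> of \<open>riesz_mass_bound\<close>, and on
  replacing the limiting slope by the slope at a positive radius \<open>R\<close>. Then
  \<open>exp_integral_bound\<close> applies to \<open>U s\<close> for all small \<open>s\<close>
  with one bound, and Fatou's lemma leads to \<phi>.\<close>

lemma exp_neg_integrable_along_graph:
  assumes lt: "growth z0 < 1" and \<gamma> [measurable]: "\<gamma> \<in> borel_measurable borel" and Re: "\<And>s. Re (\<gamma> s) = s"
  shows "\<exists>\<epsilon>>0. \<forall>I A. I \<in> sets borel \<longrightarrow> emeasure lborel I \<le> ennreal A \<longrightarrow> 0 \<le> A \<longrightarrow> (\<forall>s\<in>I. cmod (\<gamma> s - z0) < \<epsilon>)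
    \<longrightarrow> (\<integral>\<^sup>+s\<in>I. exp_neg (\<phi> (\<gamma> s)) \<partial>lborel) < \<infinity>"
proof -
  define m where "m = (1 + growth z0) / 2"
  have m: "0 < m" "m < 1" "growth z0 < m" using lt growth_nonneg[of z0] by (auto simp: m_def)
  \<comment> \<open>This gives \<open>m * (1 - d^2) = (m + growth z0) / 2\<close>, strictly above
    the growth, so some slope still lies below it.\<close>
  define d where "d = sqrt ((1 - growth z0 / m) / 2)"
  have q: "0 < 1 - growth z0 / m" "1 - growth z0 / m \<le> 1" using m growth_nonneg[of z0] by (auto simp: divide_simps)
  have d2: "d^2 = (1 - growth z0 / m) / 2" unfolding d_def using q by simp
  have d0: "0 < d" unfolding d_def using q by simp
  have "d^2 < 1^2" using d2 q by simp
  then have d1: "d < 1" by (rule power_less_imp_less_base) simp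
  have "growth z0 < m * (1 - d^2)" unfolding d2 using m q by (simp add: field_simps)
  then obtain x where x: "x < 0" "slope z0 x < m * (1 - d^2)" using slope_less by blast
  define R where "R = exp x"
  have R: "0 < R" "R < 1" unfolding R_def using x by auto
  have lnR: "ln (1 / R) = - x" unfolding R_def by (simp add: ln_div)
  have slope: "U 1 z0 - U R z0 < m * (ln (1 / R) * (1 - d^2))"
    using x unfolding slope_def lnR R_def[symmetric] by (simp add: field_simps)
  define \<rho> where "\<rho> = d * R"
  have \<rho>: "0 < \<rho>" unfolding \<rho>_def using d0 R by simp
  \<comment> \<open>The lower bound on means of \<open>U s\<close> must be uniform in
    \<open>s < 1\<close>. By \<open>conv_disc_U\<close> these are means of
    \<open>U (\<rho> / 2)\<close> over discs of radius \<open>s\<close>, hence the margin 1.\<close>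
  obtain C where C: "0 \<le> C" "\<And>z. cmod z \<le> \<rho> + 1 \<Longrightarrow> \<bar>U (\<rho> / 2) (z0 + z)\<bar> \<le> C"
    using continuous_bounded_near[OF U_continuous[of "\<rho> / 2"]] \<rho> by (metis half_gt_zero)
  have sq: "filterlim (\<lambda>n. 1 / real (Suc n)) (at_right 0) sequentially"
    unfolding filterlim_at using LIMSEQ_inverse_real_of_nat by (auto simp: divide_inverse)
  show ?thesis
  proof (intro exI[of _ "\<rho> / 2"] conjI allI impI)
    fix I A assume I [measurable]: "I \<in> sets borel" and A: "emeasure lborel I \<le> ennreal A" "0 \<le> A" and near: "\<forall>s\<in>I. cmod (\<gamma> s - z0) < \<rho> / 2"
    let ?B = "ennreal (exp C) * exp_bound m (\<rho> / 2) A"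
    have ev: "eventually (\<lambda>s. (\<integral>\<^sup>+t\<in>I. ennreal (exp (- U s (\<gamma> t))) \<partial>lborel) \<le> ?B) (at_right 0)"
    proof -
      have "((\<lambda>s. conv (disc_kernel 1) (U s) z0 - conv (disc_kernel R) (U s) z0) \<longlongrightarrow> U 1 z0 - U R z0) (at_right 0)"
        by (intro tendsto_intros conv_disc_U_tendsto R) simp
      from order_tendstoD(2)[OF this slope]
      have "eventually (\<lambda>s. conv (disc_kernel 1) (U s) z0 - conv (disc_kernel R) (U s) z0 < m * (ln (1 / R) * (1 - d^2))) (at_right 0)" .
      moreover have "eventually (\<lambda>s::real. 0 < s \<and> s < 1) (at_right 0)" by (auto simp: eventually_at_right_field intro!: exI[of _ 1])
      ultimately show ?thesis
      proof eventually_elim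
        case (elim s)
        then have s: "0 < s" "s < 1" by auto
        show ?case unfolding \<rho>_def
        proof (rule exp_integral_bound[OF U_submean[OF s(1)] m(1,2) R d0 d1 elim(1) _ I A _ Re \<gamma>])
          show "cmod (\<gamma> t - z0) \<le> d * R / 2" if "t \<in> I" for t using near that unfolding \<rho>_def by force
          fix w assume w: "cmod (w - z0) \<le> d * R"
          have "- C = conv (disc_kernel s) (\<lambda>_. - C) w" using disc_kernel_integral[OF s(1)] by (simp add: conv_const)
          also have "\<dots> \<le> conv (disc_kernel s) (U (\<rho> / 2)) w"
          proof (rule conv_mono[OF kernel_disc])
            fix z assume "cmod z \<le> s"
            then have "cmod ((w - z0) + z) \<le> \<rho> + 1" using w s unfolding \<rho>_def by (intro norm_triangle_le) auto
            from C(2)[OF this] show "- C \<le> U (\<rho> / 2) (w + z)" by (simp add: algebra_simps abs_le_iff)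
          qed (use U_continuous[of "\<rho> / 2"] \<rho> in auto)
          also have "\<dots> = conv (disc_kernel (\<rho> / 2)) (U s) w" by (rule conv_disc_U) (use s \<rho> in auto)
          finally show "- C \<le> conv (disc_kernel (d * R / 2)) (U s) w" unfolding \<rho>_def .
        qed
      qed
    qed
    have "(\<integral>\<^sup>+s\<in>I. exp_neg (\<phi> (\<gamma> s)) \<partial>lborel) \<le> (\<integral>\<^sup>+s. liminf (\<lambda>n. ennreal (exp (- U (1 / real (Suc n)) (\<gamma> s))) * indicator I s) \<partial>lborel)"
      using exp_neg_le_liminf[OF sq] by (intro nn_integral_mono) (auto simp: indicator_def)
    also have "\<dots> \<le> liminf (\<lambda>n. \<integral>\<^sup>+s. ennreal (exp (- U (1 / real (Suc n)) (\<gamma> s))) * indicator I s \<partial>lborel)"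
    proof (rule nn_integral_liminf)
      fix n
      note [measurable] = continuous_borel[OF U_continuous[of "1 / real (Suc n)"]]
      show "(\<lambda>s. ennreal (exp (- U (1 / real (Suc n)) (\<gamma> s))) * indicator I s) \<in> borel_measurable lborel" by measurable
    qed
    also have "\<dots> \<le> liminf (\<lambda>n::nat. ?B)"
      by (rule Liminf_mono) (rule eventually_compose_filterlim[OF ev sq])
    also have "\<dots> = ?B" by (simp add: Liminf_const)
    also have "\<dots> < \<infinity>" using exp_bound_finite[OF m(1,2), of "\<rho> / 2" A] by (auto simp: ennreal_mult_less_top)
    finally show "(\<integral>\<^sup>+s\<in>I. exp_neg (\<phi> (\<gamma> s)) \<partial>lborel) < \<infinity>" .
  qed (use \<rho> in simp)
qed

text \<open>The radius \<open>|w - z0| ln (1 / |w - z0|)\<close> balances the two errors in the concentric estimate;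
  the resulting logarithmic loss still leaves a divergent integral.\<close>
lemma exp_neg_lower_bound:
  assumes ge: "1 \<le> growth z0"
  shows "\<exists>c>0. \<forall>w. 0 < cmod (w - z0) \<longrightarrow> cmod (w - z0) < exp (-2) \<longrightarrow>
    ennreal (c / (cmod (w - z0) * ln (1 / cmod (w - z0)))) \<le> exp_neg (\<phi> w)"
proof -
  obtain M0 where M0: "\<And>u. u \<in> cball z0 1 \<Longrightarrow> \<phi> u \<le> ereal M0" using subharmonic_bounded_above[OF sub] by blast
  \<comment> \<open>The maximum with \<open>U 1 z0\<close> gives
    \<open>U R2 z0 - M \<le> growth z0 * ln R2\<close> without an additive constant.\<close>
  define M where "M = max M0 (U 1 z0)"
  have M: "\<phi> u \<le> ereal M" if "u \<in> cball z0 1" for u using M0[OF that] unfolding M_def by (metis ereal_less_eq(3) max.cobounded1 order.trans)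
  have UM: "U 1 z0 \<le> M" unfolding M_def by simp
  show ?thesis
  proof (intro exI[of _ "exp (- (M + 2))"] conjI allI impI)
    fix w assume w: "0 < cmod (w - z0)" "cmod (w - z0) < exp (-2)"
    define r where "r = cmod (w - z0)"
    define l where "l = ln (1 / r)"
    have r: "0 < r" "r < exp (-2)" using w by (auto simp: r_def)
    have lr: "l = - ln r" using r unfolding l_def by (simp add: ln_div)
    have "ln r < ln (exp (-2))" using r by (subst ln_less_cancel_iff) auto
    then have l2: "2 < l" unfolding lr by simp
    have "l \<le> 1 / r - 1" unfolding l_def by (rule ln_le_minus_one) (use r in simp)
    then have lr1: "(l + 1) * r \<le> 1" using r by (simp add: field_simps)
    \<comment> \<open>With \<open>R1 = l * r\<close> the ratio of areas is
      \<open>(1 - 1 / l)^2\<close>, and \<open>r + R1 = (l + 1) * r \<le> 1\<close> keeps the discs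
      where \<open>M\<close> is a bound. The radius \<open>exp (-2)\<close> in the statement makes
      \<open>l > 2\<close>.\<close>
    define R2 where "R2 = (l - 1) * r"
    have R2: "0 < R2" "R2 \<le> 1" using l2 r lr1 unfolding R2_def by (auto simp: algebra_simps)
    have "\<phi> w \<le> ereal (M + (R2 / (l * r))^2 * (U R2 z0 - M))"
      by (rule phi_le_concentric[OF M R2(1)]) (use lr1 in \<open>auto simp: r_def[symmetric] R2_def algebra_simps\<close>)
    also have "R2 / (l * r) = 1 - 1 / l" unfolding R2_def using r l2 by (simp add: field_simps)
    also have "M + (1 - 1 / l)^2 * (U R2 z0 - M) \<le> M + 2 - l + ln l"
    proof -
      have lnR2: "ln R2 \<le> 0" using R2 by simp
      have "growth z0 * ln R2 \<le> 1 * ln R2" using ge lnR2 by (intro mult_right_mono_neg)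
      then have "U R2 z0 - M \<le> ln R2" using U_le_growth[OF R2, of z0] UM by linarith
      also have "ln R2 = ln (l - 1) - l" unfolding R2_def lr using r l2 lr by (subst ln_mult) auto
      also have "\<dots> \<le> - (l - ln l)" using l2 by simp
      finally have 1: "U R2 z0 - M \<le> - (l - ln l)" .
      have lnl: "0 \<le> ln l" using l2 by simp
      have lnl': "ln l \<le> l" using ln_le_minus_one[of l] l2 by simp
      have "(1 - 1 / l)^2 * (U R2 z0 - M) \<le> (1 - 1 / l)^2 * (- (l - ln l))" using 1 by (intro mult_left_mono) auto
      \<comment> \<open>The error is now linear: \<open>2 / l\<close> times \<open>l - ln l\<close>
        is at most 2, the constant in the result.\<close>
      also have "\<dots> \<le> (1 - 2 / l) * (- (l - ln l))"
      proof (rule mult_right_mono_neg)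
        have "(1 - 1 / l)^2 = (1 - 2 / l) + (1 / l)^2" by (simp add: power2_eq_square algebra_simps)
        then show "1 - 2 / l \<le> (1 - 1 / l)^2" by simp
      qed (use lnl' in simp)
      also have "\<dots> = - (l - ln l) + 2 - 2 * ln l / l" using l2 by (simp add: field_simps)
      also have "\<dots> \<le> 2 - l + ln l" using lnl l2 by simp
      finally show ?thesis by simp
    qed
    finally have "\<phi> w \<le> ereal (M + 2 - l + ln l)" by simp
    from exp_neg_antimono[OF this]
    have "ennreal (exp (- (M + 2 - l + ln l))) \<le> exp_neg (\<phi> w)" by simp
    also have "exp (- (M + 2 - l + ln l)) = exp (- (M + 2)) / (r * l)"
    proof -
      have "exp (- (M + 2 - l + ln l)) = exp (- (M + 2)) * exp (l - ln l)" by (simp add: exp_add[symmetric])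
      also have "exp (l - ln l) = exp l / l" using l2 by (simp add: exp_diff)
      also have "exp l = 1 / r" unfolding l_def using r by (intro exp_ln) simp
      finally show ?thesis by simp
    qed
    finally show "ennreal (exp (- (M + 2)) / (cmod (w - z0) * ln (1 / cmod (w - z0)))) \<le> exp_neg (\<phi> w)"
      unfolding r_def l_def .
  qed simp
qed

end

section \<open>The speed of a Lipschitz graph\<close>

lemma lipschitz_derivative_bound:
  fixes f :: "real \<Rightarrow> real"
  assumes "L-lipschitz_on UNIV f" "(f has_real_derivative D) (at x)"
  shows "\<bar>D\<bar> \<le> L"
proof (rule tendsto_upperbound)
  show "((\<lambda>y. \<bar>(f y - f x) / (y - x)\<bar>) \<longlongrightarrow> \<bar>D\<bar>) (at x)"
    using assms(2) unfolding has_field_derivative_iff by (rule tendsto_rabs)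
  show "eventually (\<lambda>y. \<bar>(f y - f x) / (y - x)\<bar> \<le> L) (at x)"
  proof (rule eventually_at_topological[THEN iffD2], intro exI[of _ UNIV] conjI ballI impI)
    fix y assume "y \<noteq> x"
    have "\<bar>f y - f x\<bar> \<le> L * \<bar>y - x\<bar>" using lipschitz_onD[OF assms(1), of y x] by (simp add: dist_real_def)
    then show "\<bar>(f y - f x) / (y - x)\<bar> \<le> L" using \<open>y \<noteq> x\<close> by (simp add: divide_le_eq)
  qed auto
qed simp

lemma lipschitz_extension_real:
  fixes y :: "real \<Rightarrow> real"
  assumes "L-lipschitz_on {a..b} y" "a \<le> b"
  shows "L-lipschitz_on UNIV (\<lambda>s. y (max a (min b s)))"
proof (rule lipschitz_onI)
  fix s s' :: real
  have "dist (y (max a (min b s))) (y (max a (min b s'))) \<le> L * dist (max a (min b s)) (max a (min b s'))"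
    by (rule lipschitz_onD[OF assms(1)]) (use assms(2) in auto)
  also have "\<dots> \<le> L * dist s s'"
    using lipschitz_on_nonneg[OF assms(1)] by (intro mult_left_mono) (auto simp: dist_real_def)
  finally show "dist (y (max a (min b s))) (y (max a (min b s'))) \<le> L * dist s s'" .
qed (rule lipschitz_on_nonneg[OF assms(1)])

text \<open>\<open>y\<close> is extended by constants to reach the theorem for the whole line. On
  the open interval the extension agrees with \<open>y\<close>; the endpoints, where
  \<open>at s\<close> is two-sided, are a null set. The speed is the modulus of
  \<open>Complex 1 D\<close> with \<open>|D| \<le> L\<close>.\<close>

lemma AE_graph_speed:
  fixes y :: "real \<Rightarrow> real"
  assumes lip: "L-lipschitz_on {a..b} y" and ab: "a < b"
  shows "AE s in lborel. s \<in> {a..b} \<longrightarrow> 1 \<le> norm (vector_derivative (\<lambda>s. Complex s (y s)) (at s)) \<and>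
    norm (vector_derivative (\<lambda>s. Complex s (y s)) (at s)) \<le> 1 + L"
proof -
  define yt where "yt s = y (max a (min b s))" for s
  have lipt: "L-lipschitz_on UNIV yt" unfolding yt_def[abs_def] using lipschitz_extension_real[OF lip] ab by simp
  have "AE s in lebesgue. s \<notin> {s. \<not> yt differentiable (at s)}"
    using lipschitz_differentiable_AE[OF lipt] by (intro AE_not_in) (simp add: negligible_iff_null_sets)
  then have "AE s in lborel. yt differentiable (at s)" by (simp add: AE_completion_iff)
  moreover have "AE s in lborel. s \<noteq> a" "AE s in lborel. s \<noteq> b" by (rule AE_lborel_singleton)+
  ultimately show ?thesis
  proof eventually_elim
    case (elim s)
    show ?case
    proof (intro impI)
      assume "s \<in> {a..b}"
      then have s: "s \<in> {a<..<b}" using elim by auto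
      obtain D where D: "(yt has_real_derivative D) (at s)" using elim(1) real_differentiable_def by blast
      have "(y has_real_derivative D) (at s)"
        by (rule has_field_derivative_transform_within_open[OF D open_greaterThanLessThan s]) (auto simp: yt_def)
      then have "((\<lambda>s. Complex s (y s)) has_vector_derivative Complex 1 D) (at s)"
        unfolding has_vector_derivative_complex_iff by (auto intro!: derivative_eq_intros)
      then have vd: "vector_derivative (\<lambda>s. Complex s (y s)) (at s) = Complex 1 D" by (rule vector_derivative_at)
      have "cmod (Complex 1 D) \<le> 1 + \<bar>D\<bar>" using cmod_le[of "Complex 1 D"] by simp
      moreover have "1 \<le> cmod (Complex 1 D)" using abs_Re_le_cmod[of "Complex 1 D"] by simp
      moreover have "\<bar>D\<bar> \<le> L" by (rule lipschitz_derivative_bound[OF lipt D])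
      ultimately show "1 \<le> norm (vector_derivative (\<lambda>s. Complex s (y s)) (at s)) \<and> norm (vector_derivative (\<lambda>s. Complex s (y s)) (at s)) \<le> 1 + L"
        unfolding vd by linarith
    qed
  qed
qed

theorem theorem2p12:
  fixes a b L t :: real and y :: "real \<Rightarrow> real" and \<phi> :: "complex \<Rightarrow> ereal"
  assumes "a < b"
    and "L-lipschitz_on {a..b} y"
    and "subharmonic \<phi>"
    and "\<exists>z. \<phi> z \<noteq> - \<infinity>"
    and "t \<in> {a..b}"
  shows "lelong \<phi> (Complex t (y t)) < 1 \<longleftrightarrow>
         (\<exists>\<epsilon>>0. arclength_integral (\<lambda>s. Complex s (y s))
                   {s\<in>{a..b}. dist (Complex s (y s)) (Complex t (y t)) < \<epsilon>}
                   (\<lambda>w. exp_neg (\<phi> w)) < \<infinity>)"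
proof -
  interpret subharmonic_function \<phi> using assms(3,4) by unfold_locales
  \<comment> \<open>The extension of \<open>y\<close> by its boundary values makes \<gamma>
    continuous on the line with \<open>Re (\<gamma> s) = s\<close> for every \<open>s\<close>, as
    the estimates along graphs require.\<close>
  define \<gamma> where "\<gamma> s = Complex s (y (max a (min b s)))" for s
  define z0 where "z0 = Complex t (y t)"
  have \<gamma>_eq: "Complex s (y s) = \<gamma> s" if "s \<in> {a..b}" for s using that by (simp add: \<gamma>_def)
  have L0: "0 \<le> L" using lipschitz_on_nonneg[OF assms(2)] .
  have "continuous_on UNIV (\<lambda>s. y (max a (min b s)))"
    by (rule lipschitz_on_continuous_on[OF lipschitz_extension_real[OF assms(2)]]) (use assms(1) in simp)
  then have \<gamma>_cont: "continuous_on UNIV \<gamma>" unfolding \<gamma>_def[abs_def] by (intro continuous_on_Complex continuous_on_id)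
  have \<gamma>_m [measurable]: "\<gamma> \<in> borel_measurable borel" by (rule borel_measurable_continuous_onI[OF \<gamma>_cont])
  define v where "v s = norm (vector_derivative (\<lambda>s. Complex s (y s)) (at s))" for s
  have v: "AE s in lborel. s \<in> {a..b} \<longrightarrow> 1 \<le> v s \<and> v s \<le> 1 + L"
    unfolding v_def by (rule AE_graph_speed[OF assms(2,1)])
  define S where "S \<epsilon> = {s\<in>{a..b}. dist (Complex s (y s)) z0 < \<epsilon>}" for \<epsilon>
  have S_eq: "S \<epsilon> = {s\<in>{a..b}. dist (\<gamma> s) z0 < \<epsilon>}" for \<epsilon> unfolding S_def using \<gamma>_eq by auto
  have S_m [measurable]: "S \<epsilon> \<in> sets borel" for \<epsilon> unfolding S_eq by measurable
  have arc: "arclength_integral (\<lambda>s. Complex s (y s)) (S \<epsilon>) (\<lambda>w. exp_neg (\<phi> w)) = (\<integral>\<^sup>+s\<in>S \<epsilon>. exp_neg (\<phi> (\<gamma> s)) * ennreal (v s) \<partial>lborel)" for \<epsilon>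
    unfolding arclength_integral_def v_def
    by (intro nn_integral_cong) (auto simp: indicator_def S_def \<gamma>_eq)
  have "growth z0 < 1 \<longleftrightarrow> (\<exists>\<epsilon>>0. (\<integral>\<^sup>+s\<in>S \<epsilon>. exp_neg (\<phi> (\<gamma> s)) * ennreal (v s) \<partial>lborel) < \<infinity>)"
  proof
    assume "growth z0 < 1"
    then obtain \<epsilon> where \<epsilon>: "\<epsilon> > 0" and fin: "\<And>I A. I \<in> sets borel \<Longrightarrow> emeasure lborel I \<le> ennreal A \<Longrightarrow> 0 \<le> A \<Longrightarrow>
        (\<forall>s\<in>I. cmod (\<gamma> s - z0) < \<epsilon>) \<Longrightarrow> (\<integral>\<^sup>+s\<in>I. exp_neg (\<phi> (\<gamma> s)) \<partial>lborel) < \<infinity>"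
      using exp_neg_integrable_along_graph[OF _ \<gamma>_m, of z0] by (auto simp: \<gamma>_def)
    have "emeasure lborel (S \<epsilon>) \<le> emeasure lborel {a..b}" unfolding S_def by (intro emeasure_mono) auto
    also have "\<dots> = ennreal (b - a)" using assms(1) by simp
    finally have fin': "(\<integral>\<^sup>+s\<in>S \<epsilon>. exp_neg (\<phi> (\<gamma> s)) \<partial>lborel) < \<infinity>"
      by (intro fin[of _ "b - a"] S_m) (use assms(1) in \<open>auto simp: S_eq dist_norm\<close>)
    have "(\<integral>\<^sup>+s\<in>S \<epsilon>. exp_neg (\<phi> (\<gamma> s)) * ennreal (v s) \<partial>lborel) \<le> (\<integral>\<^sup>+s. (exp_neg (\<phi> (\<gamma> s)) * indicator (S \<epsilon>) s) * ennreal (1 + L) \<partial>lborel)"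
    proof (rule nn_integral_mono_AE)
      show "AE s in lborel. exp_neg (\<phi> (\<gamma> s)) * ennreal (v s) * indicator (S \<epsilon>) s \<le> (exp_neg (\<phi> (\<gamma> s)) * indicator (S \<epsilon>) s) * ennreal (1 + L)"
        using v
      proof eventually_elim
        case (elim s)
        show ?case
        proof (cases "s \<in> S \<epsilon>")
          case True
          then have "v s \<le> 1 + L" using elim by (simp add: S_def)
          then show ?thesis using True by (simp add: mult_left_mono ennreal_leI del: ennreal_plus)
        qed simp
      qed
    qed
    also have "\<dots> = (\<integral>\<^sup>+s\<in>S \<epsilon>. exp_neg (\<phi> (\<gamma> s)) \<partial>lborel) * ennreal (1 + L)"
      by (rule nn_integral_multc) measurable
    also have "\<dots> < \<infinity>" using fin' by (auto simp: ennreal_mult_less_top)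
    finally show "\<exists>\<epsilon>>0. (\<integral>\<^sup>+s\<in>S \<epsilon>. exp_neg (\<phi> (\<gamma> s)) * ennreal (v s) \<partial>lborel) < \<infinity>" using \<epsilon> by blast
  next
    assume "\<exists>\<epsilon>>0. (\<integral>\<^sup>+s\<in>S \<epsilon>. exp_neg (\<phi> (\<gamma> s)) * ennreal (v s) \<partial>lborel) < \<infinity>"
    then obtain \<epsilon> where \<epsilon>: "\<epsilon> > 0" and fin: "(\<integral>\<^sup>+s\<in>S \<epsilon>. exp_neg (\<phi> (\<gamma> s)) * ennreal (v s) \<partial>lborel) < \<infinity>" by blast
    show "growth z0 < 1"
    proof (rule ccontr)
      assume "\<not> growth z0 < 1"
      then obtain c where c: "c > 0" and low: "\<And>w. 0 < cmod (w - z0) \<Longrightarrow> cmod (w - z0) < exp (-2) \<Longrightarrow>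
          ennreal (c / (cmod (w - z0) * ln (1 / cmod (w - z0)))) \<le> exp_neg (\<phi> w)"
        using exp_neg_lower_bound[of z0] by auto
      \<comment> \<open>One side of \<open>t\<close> suffices for divergence: the right side, except
        at the right endpoint.\<close>
      define \<sigma> where "\<sigma> = (if t < b then 1 else -1 :: real)"
      \<comment> \<open>The quotient by \<open>2 + L\<close> forces the distance on the graph below
        both \<epsilon> and the range of \<open>low\<close>; the entry \<open>1/2\<close> keeps
        \<open>ln (1 / x)\<close> positive; the last entry keeps the points in
        \<open>{a..b}\<close>.\<close>
      define \<eta> where "\<eta> = min (1/2) (min (min \<epsilon> (exp (-2)) / (2 + L)) (if t < b then b - t else b - a))"
      have \<sigma>: "\<sigma> \<noteq> 0" "\<bar>\<sigma>\<bar> = 1" by (auto simp: \<sigma>_def)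
      have \<eta>0: "0 < \<eta>" "\<eta> < 1" unfolding \<eta>_def using \<epsilon> L0 assms(1) by auto
      have \<eta>1: "\<eta> \<le> min \<epsilon> (exp (-2)) / (2 + L)" unfolding \<eta>_def by simp
      have "\<eta> \<le> (if t < b then b - t else b - a)" unfolding \<eta>_def by simp
      then have inab: "t + \<sigma> * x \<in> {a..b}" if "0 < x" "x < \<eta>" for x
        using that assms(5) by (auto simp: \<sigma>_def split: if_splits)
      have est: "ennreal (c / (1 + L) * (1 / (x * ln (1 / x)))) \<le> exp_neg (\<phi> (\<gamma> (t + \<sigma> * x)))" "t + \<sigma> * x \<in> S \<epsilon>"
        if x: "0 < x" "x < \<eta>" for x
      proof -
        let ?s = "t + \<sigma> * x"
        define r where "r = cmod (\<gamma> ?s - z0)"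
        have z0: "z0 = \<gamma> t" unfolding z0_def by (rule \<gamma>_eq[OF assms(5)])
        have "x = \<bar>Re (\<gamma> ?s - z0)\<bar>" using x \<sigma> by (simp add: z0 \<gamma>_def abs_mult)
        also have "\<dots> \<le> r" unfolding r_def by (rule abs_Re_le_cmod)
        finally have xr: "x \<le> r" .
        have "\<bar>Im (\<gamma> ?s - z0)\<bar> \<le> L * dist ?s t"
          using lipschitz_onD[OF lipschitz_extension_real[OF assms(2)], of ?s t] assms(1) by (simp add: z0 \<gamma>_def dist_real_def)
        moreover have "dist ?s t = x" "\<bar>Re (\<gamma> ?s - z0)\<bar> = x" using x \<sigma> by (auto simp: dist_real_def abs_mult z0 \<gamma>_def)
        ultimately have rx: "r \<le> (1 + L) * x" unfolding r_def using cmod_le[of "\<gamma> ?s - z0"] by (simp add: algebra_simps)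
        have "(2 + L) * x < (2 + L) * \<eta>" using x L0 by (intro mult_strict_left_mono) auto
        also have "\<dots> \<le> min \<epsilon> (exp (-2))" using \<eta>1 L0 by (simp add: pos_le_divide_eq mult.commute)
        finally have "(2 + L) * x < min \<epsilon> (exp (-2))" .
        moreover have "(1 + L) * x \<le> (2 + L) * x" using x by (intro mult_right_mono) auto
        ultimately have r: "r < \<epsilon>" "r < exp (-2)" using rx by auto
        show "?s \<in> S \<epsilon>" using inab[OF x] r(1) by (simp add: S_eq dist_norm r_def)
        have r0: "0 < r" using xr x by simp
        have "exp (-2) < (1::real)" by simp
        then have r1: "r < 1" using r(2) by linarith
        have lnr: "0 < ln (1 / r)" by (rule ln_gt_zero) (use r0 r1 in simp)
        have "ln (1 / r) \<le> ln (1 / x)" using xr x r0 by (subst ln_le_cancel_iff) (auto intro!: divide_left_mono)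
        \<comment> \<open>The comparison goes factor by factor: \<open>r \<le> (1 + L) * x\<close>
          for the first, \<open>x \<le> r\<close> for the logarithm.\<close>
        then have "r * ln (1 / r) \<le> ((1 + L) * x) * ln (1 / x)" using rx r0 lnr x by (intro mult_mono) auto
        moreover have "0 < r * ln (1 / r)" using r0 lnr by simp
        ultimately have "c / (((1 + L) * x) * ln (1 / x)) \<le> c / (r * ln (1 / r))"
          using c by (intro divide_left_mono) auto
        then have "ennreal (c / (1 + L) * (1 / (x * ln (1 / x)))) \<le> ennreal (c / (r * ln (1 / r)))"
          by (intro ennreal_leI) (simp add: mult.assoc)
        also have "\<dots> \<le> exp_neg (\<phi> (\<gamma> ?s))" using low[of "\<gamma> ?s"] r0 r(2) unfolding r_def by simp
        finally show "ennreal (c / (1 + L) * (1 / (x * ln (1 / x)))) \<le> exp_neg (\<phi> (\<gamma> ?s))" .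
      qed
      define H where "H s = (let x = \<sigma> * (s - t) in ennreal (c / (1 + L)) * (ennreal (1 / (x * ln (1 / x))) * indicator {0<..<\<eta>} x))" for s
      have Hm: "H \<in> borel_measurable borel" unfolding H_def Let_def by measurable
      have \<sigma>\<sigma>: "\<sigma> * \<sigma> = 1" by (simp add: \<sigma>_def)
      have "(\<integral>\<^sup>+s. H s \<partial>lborel) = (\<integral>\<^sup>+x. H (t + \<sigma> * x) \<partial>lborel)"
        using nn_integral_real_affine[OF Hm \<sigma>(1), of t] \<sigma>(2) by simp
      also have "\<dots> = (\<integral>\<^sup>+x. ennreal (c / (1 + L)) * (ennreal (1 / (x * ln (1 / x))) * indicator {0<..<\<eta>} x) \<partial>lborel)"
        unfolding H_def Let_def by (simp add: mult.assoc[symmetric] \<sigma>\<sigma>)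
      also have "\<dots> = ennreal (c / (1 + L)) * (\<integral>\<^sup>+x\<in>{0<..<\<eta>}. ennreal (1 / (x * ln (1 / x))) \<partial>lborel)"
        by (rule nn_integral_cmult) measurable
      also have "\<dots> = \<infinity>" using nn_integral_log_divergent[OF \<eta>0] c L0 by (simp add: ennreal_mult_top)
      finally have "(\<integral>\<^sup>+s. H s \<partial>lborel) = \<infinity>" .
      moreover have "(\<integral>\<^sup>+s. H s \<partial>lborel) \<le> (\<integral>\<^sup>+s\<in>S \<epsilon>. exp_neg (\<phi> (\<gamma> s)) * ennreal (v s) \<partial>lborel)"
      proof (rule nn_integral_mono_AE)
        show "AE s in lborel. H s \<le> exp_neg (\<phi> (\<gamma> s)) * ennreal (v s) * indicator (S \<epsilon>) s"
          using v
        proof eventually_elim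
          case (elim s)
          define x where "x = \<sigma> * (s - t)"
          have s: "s = t + \<sigma> * x" unfolding x_def by (simp add: mult.assoc[symmetric] \<sigma>\<sigma>)
          show ?case
          proof (cases "0 < x \<and> x < \<eta>")
            case True
            have "H s = ennreal (c / (1 + L) * (1 / (x * ln (1 / x))))"
              unfolding H_def Let_def x_def[symmetric] using True c L0 by (simp add: ennreal_mult'[symmetric])
            also have "\<dots> \<le> exp_neg (\<phi> (\<gamma> s))" unfolding s using est(1)[of x] True by simp
            also have "\<dots> = exp_neg (\<phi> (\<gamma> s)) * 1" by simp
            also have "\<dots> \<le> exp_neg (\<phi> (\<gamma> s)) * ennreal (v s)"
              using elim inab[of x] True unfolding s[symmetric] by (intro mult_left_mono) (auto simp: ennreal_1[symmetric] simp del: ennreal_1 intro!: ennreal_leI)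
            finally show ?thesis using est(2)[of x] True unfolding s[symmetric] by simp
          next
            case False
            then show ?thesis unfolding H_def Let_def x_def[symmetric] by auto
          qed
        qed
      qed
      ultimately show False using fin by (simp add: top_unique)
    qed
  qed
  then show ?thesis
    unfolding z0_def[symmetric] S_def[symmetric] arc lelong_eq_growth by (simp add: one_ereal_def)
qed

end
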